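(* For every $\tau\in\mathbb{H}^2$ set $$f(\tau)=\frac{\eta^4(2\tau)\,\eta^8(3\tau)}{\eta^8(\tau)\,\eta^4(6\tau)} .$$ Then the inverse function $\tau=\tau(f)$ yields $m(f)=c(2\tau(f))$, and $m(f)$ satisfies the differential equation $$\frac{d^2m}{df^2}+\left\{\frac{\frac13}{f}-\frac{\frac13}{f-1}+\frac{1}{f-\frac19}\right\}\frac{dm}{df}+\frac{f+\frac13}{3f^2(f-1)^2}\,m=0 .$$
   Context: $\mathbb{H}^2=\{\tau\in\mathbb{C}\mid \Im\tau>0\}$; $\eta(\tau)=e^{2\pi i\tau/24}\prod_{n\ge1}(1-e^{2\pi i n\tau})$ is the Dedekind eta function and $\eta^k(m\tau)=(\eta(m\tau))^k$. The cubic theta function $c$ is $c(\tau)=\sum_{m,n\in\mathbb{Z}}q^{(n+\frac13)^2+(n+\frac13)(m+\frac13)+(m+\frac13)^2}$, where $q^r=\exp(2\pi i r\tau)$ for rational $r$. The inverse function $\tau=\tau(f)$ means any local holomorphic inverse of $\tau\mapsto f(\tau)$; thus $m$ is regarded locally as a function of the variable $f$. *)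

theory Defs
  imports "HOL-Complex_Analysis.Complex_Analysis"
begin

definition upper_half_plane :: "complex set" where
  "upper_half_plane = {\<tau>. Im \<tau> > 0}"

text \<open>
  For rational \<open>r\<close> the power \<open>q\<^sup>r\<close> is read as the single-valued function \<open>exp (2\<pi>i r\<tau>)\<close>
  of \<open>\<tau>\<close>; no branch of a complex power of \<open>q\<close> is involved.
\<close>

definition q_pow :: "complex \<Rightarrow> rat \<Rightarrow> complex" where
  "q_pow \<tau> r = exp (2 * of_real pi * \<i> * of_rat r * \<tau>)"

text \<open>The library's \<open>prodinf\<close> starts at \<open>0\<close>, hence the shift by \<open>Suc\<close>.\<close>

definition dedekind_eta :: "complex \<Rightarrow> complex" where
  "dedekind_eta \<tau> =
     exp (2 * of_real pi * \<i> * \<tau> / 24) *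
     (\<Prod>n. 1 - exp (2 * of_real pi * \<i> * of_nat (Suc n) * \<tau>))"

definition cubic_theta_c :: "complex \<Rightarrow> complex" where
  "cubic_theta_c \<tau> =
     (\<Sum>\<^sub>\<infinity>(m, n)\<in>(UNIV :: (int \<times> int) set).
        q_pow \<tau> ((of_int n + 1/3)\<^sup>2 + (of_int n + 1/3) * (of_int m + 1/3) + (of_int m + 1/3)\<^sup>2))"

definition eta_quotient_f :: "complex \<Rightarrow> complex" where
  "eta_quotient_f \<tau> =
     (dedekind_eta (2 * \<tau>) ^ 4 * dedekind_eta (3 * \<tau>) ^ 8) /
     (dedekind_eta \<tau> ^ 8 * dedekind_eta (6 * \<tau>) ^ 4)"

text \<open>
  A local holomorphic inverse of \<open>F\<close>, taken as a function on \<open>D\<close>: a holomorphic \<open>g\<close> on an open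
  set \<open>U\<close> of values, with values in \<open>D\<close>, such that \<open>F \<circ> g\<close> is the identity on \<open>U\<close>. Such a \<open>g\<close> is
  injective, so \<open>g ` U\<close> is open and \<open>F\<close> restricted to it is the two-sided inverse of \<open>g\<close>.
\<close>

definition local_holomorphic_inverse ::
  "(complex \<Rightarrow> complex) \<Rightarrow> complex set \<Rightarrow> complex set \<Rightarrow> (complex \<Rightarrow> complex) \<Rightarrow> bool" where
  "local_holomorphic_inverse F D U g \<longleftrightarrow>
     open U \<and> g holomorphic_on U \<and> g ` U \<subseteq> D \<and> (\<forall>z\<in>U. F (g z) = z)"

end

(*
  Restrict Weierstrass' zeta and p-functions of the lattice of nome q to points of order 6. The
  addition theorem for zeta and the heat equation for theta, both obtained from a Liouville argument
  in the elliptic variable alone (no modular transformation is used), express everything through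
  a = zeta(1/6), b = zeta(1/3) and the Eisenstein series E_2, and show that these three functions
  satisfy a closed polynomial system of differential equations in q, of Ramanujan's type. Values of
  theta at points of order 6 are eta quotients; this gives f = a / (3 (a - 2 b)), and the logarithmic
  derivatives of f and of c(2 tau) = 3 eta(6 tau)^3 / eta(2 tau) as polynomials in a, b, E_2. The
  differential equation then is a polynomial identity. The eta quotient for c comes from Jacobi's
  triple product.
*)
theory Submission
  imports Defs "HOL-Real_Asymp.Real_Asymp"
begin

section \<open>Lambert-type series\<close>

text \<open>Without modular transformations there is no dimension count, so an identity can only
  come from Liouville's theorem in w at fixed q, or from uniqueness for a linear equation in q at q
  = 0. Order 6 suffices for closure: doubling sends order 6 to order 3, doubling a point of order 3
  only inverts it, and the sum of the two points has order 2, where zeta vanishes by oddness. So a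
  and b are the only zeta values left, and each instance of the addition theorem is a linear
  equation for values of \<open>wp\<close>. No separate Ramanujan identity for E_2 is needed: k =
  \<open>eis_const q\<close> is 9 b^2 - 3 wp(1/3), and \<open>wp\<close> can be differentiated in q
  by the heat equation. The singular points have the same source: q df/dq = 2 f (a - 3 b) (a + b),
  and f, f - 1, f - 1/9 are, up to constants, a, a - 3 b, a + b divided by a - 2 b. A local inverse
  forces df/dq to be nonzero, so it meets none of 0, 1, 1/9, and the coefficients of the equation
  become polynomials in a and b times powers of d log q / df.\<close>

text \<open>The summation index of \<open>q\<^sup>n\<close> runs over \<open>n \<ge> 1\<close>, hence the shift by \<open>Suc\<close>.\<close>

definition lambert_sum :: "nat \<Rightarrow> (complex \<Rightarrow> complex) \<Rightarrow> complex \<Rightarrow> complex \<Rightarrow> complex" where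
  "lambert_sum j \<phi> q w = (\<Sum>n. of_nat (Suc n) ^ j * \<phi> (q ^ Suc n * w))"

lemma summable_poly_times_power:
  fixes r :: real
  assumes "0 \<le> r" "r < 1"
  shows "summable (\<lambda>n. real (Suc n) ^ j * r ^ Suc n)"
proof (cases "r = 0")
  case False
  define s where "s = (r + 1) / 2"
  have s: "0 < r" "r < s" "s < 1" using assms False by (auto simp: s_def)
  have "(\<lambda>n. real (Suc n) ^ j * r ^ Suc n) \<in> O(\<lambda>n. s ^ n)"
    using s by real_asymp
  moreover have "summable (\<lambda>n. norm (s ^ n))" using s by (simp add: summable_geometric norm_power)
  ultimately show ?thesis by (rule summable_comparison_test_bigo[rotated])
qed simp

lemma norm_power_times_less_1:
  fixes q w :: complex
  assumes "norm q < 1" "norm (q * w) < 1"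
  shows "norm (q ^ Suc n * w) < 1"
proof -
  have "norm (q ^ Suc n * w) = norm q ^ n * norm (q * w)"
    by (simp add: norm_mult norm_power mult_ac)
  also have "\<dots> \<le> 1 * norm (q * w)"
    by (intro mult_right_mono power_le_one) (use assms in auto)
  finally show ?thesis using assms by simp
qed

text \<open>Since phi vanishes at 0, the geometric decay of the arguments q^n w passes to the terms
  of a Lambert series; the constant comes from the mean value bound on a smaller disc.\<close>

lemma linear_bound_holomorphic_disc:
  fixes \<phi> :: "complex \<Rightarrow> complex"
  assumes "\<phi> holomorphic_on ball 0 1" "\<phi> 0 = 0"
  obtains B where "B \<ge> 0" "\<And>s. norm s \<le> 1/2 \<Longrightarrow> norm (\<phi> s) \<le> B * norm s"
proof -
  have sub: "cball 0 (1/2) \<subseteq> ball (0::complex) 1" by auto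
  have "continuous_on (cball 0 (1/2)) (deriv \<phi>)"
    by (meson assms(1) continuous_on_subset holomorphic_deriv holomorphic_on_imp_continuous_on open_ball sub)
  then have "bounded (deriv \<phi> ` cball 0 (1/2))"
    by (intro compact_imp_bounded compact_continuous_image) auto
  then obtain B where "\<forall>y\<in>deriv \<phi> ` cball 0 (1/2). norm y \<le> B"
    unfolding bounded_iff by blast
  then have B: "\<And>x. x \<in> cball 0 (1/2) \<Longrightarrow> norm (deriv \<phi> x) \<le> B" by blast
  have "norm (\<phi> s) \<le> B * norm s" if "norm s \<le> 1/2" for s
  proof -
    have "norm (\<phi> s - \<phi> 0) \<le> B * norm (s - 0)"
    proof (rule field_differentiable_bound[of "cball 0 (1/2)"])
      show "(\<phi> has_field_derivative deriv \<phi> z) (at z within cball 0 (1/2))" if "z \<in> cball 0 (1/2)" for z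
        using holomorphic_derivI[OF assms(1) open_ball] sub that has_field_derivative_at_within by blast
    qed (use that B in auto)
    then show ?thesis using assms by simp
  qed
  moreover have "B \<ge> 0" using B[of 0] norm_ge_zero order_trans by (metis centre_in_cball zero_le_divide_1_iff zero_le_numeral)
  ultimately show ?thesis using that by blast
qed

text \<open>Both variables move along a parameter x, so one termwise differentiation yields the
  w-derivative, the q-derivative and holomorphy at q = 0. The two norm bounds keep every q^n w in
  the disc where phi is holomorphic.\<close>

lemma lambert_sum_composition:
  fixes Q W Q' W' \<phi> :: "complex \<Rightarrow> complex"
  assumes S: "open S"
    and Q: "\<And>x. x \<in> S \<Longrightarrow> (Q has_field_derivative Q' x) (at x)"
    and W: "\<And>x. x \<in> S \<Longrightarrow> (W has_field_derivative W' x) (at x)"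
    and phi: "\<phi> holomorphic_on ball 0 1" "\<phi> 0 = 0"
    and Q1: "\<And>x. x \<in> S \<Longrightarrow> norm (Q x) < 1"
    and QW: "\<And>x. x \<in> S \<Longrightarrow> norm (Q x * W x) < 1"
    and x: "x \<in> S"
  shows "(\<lambda>n. of_nat (Suc n) ^ j * \<phi> (Q x ^ Suc n * W x)) sums lambert_sum j \<phi> (Q x) (W x)" (is ?A)
    and "((\<lambda>x. lambert_sum j \<phi> (Q x) (W x)) has_field_derivative
           (\<Sum>n. of_nat (Suc n) ^ j * (deriv \<phi> (Q x ^ Suc n * W x) *
             (of_nat (Suc n) * Q x ^ n * Q' x * W x + Q x ^ Suc n * W' x)))) (at x)" (is ?B)
proof -
  define f where "f n x = of_nat (Suc n) ^ j * \<phi> (Q x ^ Suc n * W x)" for n x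
  define f' where "f' n x = of_nat (Suc n) ^ j * (deriv \<phi> (Q x ^ Suc n * W x) *
      (of_nat (Suc n) * Q x ^ n * Q' x * W x + Q x ^ Suc n * W' x))" for n x
  obtain B where B: "B \<ge> 0" "\<And>s. norm s \<le> 1/2 \<Longrightarrow> norm (\<phi> s) \<le> B * norm s"
    using linear_bound_holomorphic_disc[OF phi] by blast
  have "\<exists>g g'. \<forall>x \<in> S. ((\<lambda>n. f n x) sums g x) \<and> ((\<lambda>n. f' n x) sums g' x) \<and> (g has_field_derivative g' x) (at x)"
  proof (rule series_and_derivative_comparison_complex[OF S])
    fix n x assume x: "x \<in> S"
    have "norm (Q x ^ Suc n * W x) < 1"
      using norm_power_times_less_1 Q1[OF x] QW[OF x] by blast
    then have "(\<phi> has_field_derivative deriv \<phi> (Q x ^ Suc n * W x)) (at (Q x ^ Suc n * W x))"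
      using holomorphic_derivI[OF phi(1)] by auto
    moreover have "((\<lambda>x. Q x ^ Suc n * W x) has_field_derivative
        (of_nat (Suc n) * Q x ^ n * Q' x * W x + Q x ^ Suc n * W' x)) (at x)"
      using DERIV_mult[OF DERIV_power[OF Q[OF x], of "Suc n"] W[OF x]]
      by (simp add: algebra_simps)
    ultimately show "(f n has_field_derivative f' n x) (at x)"
      unfolding f_def f'_def by (intro DERIV_cmult DERIV_chain2[where f=\<phi>])
  next
    fix x assume x: "x \<in> S"
    \<comment> \<open>Near x, |Q| stays below r < 1 and |W| below C, so the terms are dominated by a
      multiple of n^j r^n.\<close>
    define r where "r = (norm (Q x) + 1) / 2"
    have r: "norm (Q x) < r" "0 \<le> r" "r < 1" using Q1[OF x] by (auto simp: r_def)
    define C where "C = norm (W x) + 1"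
    have cQ: "isCont Q x" and cW: "isCont W x" using Q[OF x] W[OF x] DERIV_isCont by blast+
    have "((\<lambda>y. norm (Q y)) \<longlongrightarrow> norm (Q x)) (nhds x)" "((\<lambda>y. norm (W y)) \<longlongrightarrow> norm (W x)) (nhds x)"
      using cQ cW unfolding isCont_def tendsto_at_iff_tendsto_nhds by (auto intro: tendsto_norm)
    then have "\<forall>\<^sub>F y in nhds x. norm (Q y) < r" "\<forall>\<^sub>F y in nhds x. norm (W y) < C"
      using r(1) by (auto simp: C_def elim!: order_tendstoD(2))
    then have "\<forall>\<^sub>F y in nhds x. norm (Q y) < r \<and> norm (W y) < C" by eventually_elim auto
    then obtain d where d: "d > 0" "\<And>y. dist y x < d \<Longrightarrow> norm (Q y) < r \<and> norm (W y) < C"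
      unfolding eventually_nhds_metric by blast
    define h where "h n = complex_of_real (B * C * (real (Suc n) ^ j * r ^ Suc n))" for n
    have C0: "C > 0" by (simp add: C_def add_nonneg_pos)
    have sh: "summable h"
      unfolding h_def summable_of_real_iff using r by (intro summable_mult summable_poly_times_power) auto
    have "(\<lambda>n. r ^ Suc n * C) \<longlonglongrightarrow> 0 * C"
      by (rule tendsto_mult[OF LIMSEQ_Suc[OF LIMSEQ_power_zero] tendsto_const]) (use r in auto)
    \<comment> \<open>The linear bound for phi holds for |s| <= 1/2 only, so the majorant applies
      from some n on.\<close>
    then have "\<forall>\<^sub>F n in sequentially. r ^ Suc n * C < 1/2" by (intro order_tendstoD(2)) auto
    then have ev: "\<forall>\<^sub>F n in sequentially. \<forall>y\<in>ball x d \<inter> S. cmod (f n y) \<le> cmod (h n)"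
    proof eventually_elim
      case (elim n)
      show ?case
      proof
        fix y assume y: "y \<in> ball x d \<inter> S"
        then have *: "norm (Q y) < r" "norm (W y) < C" using d by (auto simp: dist_commute)
        have le: "norm (Q y ^ Suc n * W y) \<le> r ^ Suc n * C"
          unfolding norm_mult norm_power using * r C0
          by (intro mult_mono power_mono) auto
        then have "norm (\<phi> (Q y ^ Suc n * W y)) \<le> B * norm (Q y ^ Suc n * W y)"
          using elim by (intro B) linarith
        also have "\<dots> \<le> B * (r ^ Suc n * C)" using le B by (intro mult_left_mono) auto
        finally have "norm (f n y) \<le> real (Suc n) ^ j * (B * (r ^ Suc n * C))"
          unfolding f_def norm_mult norm_power norm_of_nat by (intro mult_left_mono) auto
        also have "\<dots> = norm (h n)"
          unfolding h_def norm_of_real using B C0 r by (simp add: abs_mult)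
        finally show "norm (f n y) \<le> norm (h n)" .
      qed
    qed
    have "range h \<subseteq> \<real>\<^sub>\<ge>\<^sub>0" using B C0 r by (auto simp: h_def intro!: mult_nonneg_nonneg)
    then show "\<exists>d h. 0 < d \<and> summable h \<and> range h \<subseteq> \<real>\<^sub>\<ge>\<^sub>0 \<and>
        (\<forall>\<^sub>F n in sequentially. \<forall>y\<in>ball x d \<inter> S. cmod (f n y) \<le> cmod (h n))"
      using sh ev d(1) by blast
  qed
  then obtain g g' where g: "\<And>x. x \<in> S \<Longrightarrow> (\<lambda>n. f n x) sums g x"
     "\<And>x. x \<in> S \<Longrightarrow> (\<lambda>n. f' n x) sums g' x" "\<And>x. x \<in> S \<Longrightarrow> (g has_field_derivative g' x) (at x)"
    by blast
  have geq: "g y = lambert_sum j \<phi> (Q y) (W y)" if "y \<in> S" for y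
    using g(1)[OF that] unfolding lambert_sum_def f_def by (simp add: sums_iff)
  show ?A using g(1)[OF x] geq[OF x] unfolding f_def by simp
  have "g' x = (\<Sum>n. f' n x)" using g(2)[OF x] by (simp add: sums_iff)
  moreover have "((\<lambda>x. lambert_sum j \<phi> (Q x) (W x)) has_field_derivative g' x) (at x)"
    using g(3)[OF x] by (rule has_field_derivative_transform_within_open[OF _ S x]) (rule geq)
  ultimately show ?B unfolding f'_def by simp
qed

lemma sums_lambert_sum:
  assumes "\<phi> holomorphic_on ball 0 1" "\<phi> 0 = 0" "norm q < 1" "norm (q * w) < 1"
  shows "(\<lambda>n. of_nat (Suc n) ^ j * \<phi> (q ^ Suc n * w)) sums lambert_sum j \<phi> q w"
proof (rule lambert_sum_composition(1)[where S="{x. norm x < 1 \<and> norm (x * w) < 1}" and Q="\<lambda>x. x" and W="\<lambda>x. w"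
      and Q'="\<lambda>_. 1" and W'="\<lambda>_. 0"])
  show "open {x::complex. norm x < 1 \<and> norm (x * w) < 1}"
    by (intro open_Collect_conj open_Collect_less continuous_intros)
qed (use assms in auto)

text \<open>psi is the Euler derivative s phi'(s): w d/dw acts on each term through phi alone and
  keeps the weight j.\<close>

lemma DERIV_lambert_sum_w:
  assumes phi: "\<phi> holomorphic_on ball 0 1" "\<phi> 0 = 0" and "norm q < 1" "norm (q * w) < 1" "w \<noteq> 0"
    and psi: "\<And>s. norm s < 1 \<Longrightarrow> \<psi> s = s * deriv \<phi> s"
  shows "((\<lambda>w. lambert_sum j \<phi> q w) has_field_derivative lambert_sum j \<psi> q w / w) (at w)"
proof -
  have "open {w::complex. norm (q * w) < 1}"
    by (intro open_Collect_less continuous_intros)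
  then have "((\<lambda>w. lambert_sum j \<phi> q w) has_field_derivative
     (\<Sum>n. of_nat (Suc n) ^ j * (deriv \<phi> (q ^ Suc n * w) *
        (of_nat (Suc n) * q ^ n * 0 * w + q ^ Suc n * 1)))) (at w)"
    by (rule lambert_sum_composition(2)) (use assms in auto)
  then have *: "((\<lambda>w. lambert_sum j \<phi> q w) has_field_derivative
     (\<Sum>n. of_nat (Suc n) ^ j * (deriv \<phi> (q ^ Suc n * w) * q ^ Suc n))) (at w)"
    by (simp only: mult_zero_right mult_zero_left add_0_left mult_1_right)
  have "of_nat (Suc n) ^ j * (deriv \<phi> (q ^ Suc n * w) * q ^ Suc n) =
     of_nat (Suc n) ^ j * \<psi> (q ^ Suc n * w) / w" for n
    using \<open>w \<noteq> 0\<close> psi[OF norm_power_times_less_1[OF assms(3,4)], of n] by (simp add: field_simps)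
  moreover have "(\<Sum>n. of_nat (Suc n) ^ j * \<psi> (q ^ Suc n * w) / w) = lambert_sum j \<psi> q w / w"
    unfolding lambert_sum_def
  proof (rule suminf_divide)
    have h: "(\<lambda>s. s * deriv \<phi> s) holomorphic_on ball 0 1" by (intro holomorphic_intros phi holomorphic_deriv) auto
    have "(\<lambda>n. of_nat (Suc n) ^ j * (\<lambda>s. s * deriv \<phi> s) (q ^ Suc n * w)) sums lambert_sum j (\<lambda>s. s * deriv \<phi> s) q w"
      by (rule sums_lambert_sum[OF h _ assms(3,4)]) simp
    then show "summable (\<lambda>n. of_nat (Suc n) ^ j * \<psi> (q ^ Suc n * w))"
      using psi[OF norm_power_times_less_1[OF assms(3,4)]] sums_summable by (metis (no_types, lifting) ext)
  qed
  ultimately show ?thesis using * by simp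
qed

text \<open>Since q^n w has degree n in q, q d/dq acts like w d/dw but also multiplies the term by
  n, hence \<open>Suc j\<close>.\<close>

lemma DERIV_lambert_sum_q:
  assumes phi: "\<phi> holomorphic_on ball 0 1" "\<phi> 0 = 0" and "norm q < 1" "norm (q * w) < 1" "q \<noteq> 0"
    and psi: "\<And>s. norm s < 1 \<Longrightarrow> \<psi> s = s * deriv \<phi> s"
  shows "((\<lambda>q. lambert_sum j \<phi> q w) has_field_derivative lambert_sum (Suc j) \<psi> q w / q) (at q)"
proof -
  have "open {q::complex. norm q < 1 \<and> norm (q * w) < 1}"
    by (intro open_Collect_conj open_Collect_less continuous_intros)
  then have "((\<lambda>q. lambert_sum j \<phi> q w) has_field_derivative
     (\<Sum>n. of_nat (Suc n) ^ j * (deriv \<phi> (q ^ Suc n * w) *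
        (of_nat (Suc n) * q ^ n * 1 * w + q ^ Suc n * 0)))) (at q)"
    by (rule lambert_sum_composition(2)) (use assms in auto)
  then have *: "((\<lambda>q. lambert_sum j \<phi> q w) has_field_derivative
     (\<Sum>n. of_nat (Suc n) ^ j * (deriv \<phi> (q ^ Suc n * w) * (of_nat (Suc n) * q ^ n * w)))) (at q)"
    by (simp only: mult_zero_right mult_zero_left add_0_right mult_1_right)
  have "of_nat (Suc n) ^ j * (deriv \<phi> (q ^ Suc n * w) * (of_nat (Suc n) * q ^ n * w)) =
     of_nat (Suc n) ^ Suc j * \<psi> (q ^ Suc n * w) / q" for n
    using \<open>q \<noteq> 0\<close> psi[OF norm_power_times_less_1[OF assms(3,4)], of n] by (simp add: field_simps)
  moreover have "(\<Sum>n. of_nat (Suc n) ^ Suc j * \<psi> (q ^ Suc n * w) / q) = lambert_sum (Suc j) \<psi> q w / q"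
    unfolding lambert_sum_def
  proof (rule suminf_divide)
    have h: "(\<lambda>s. s * deriv \<phi> s) holomorphic_on ball 0 1" by (intro holomorphic_intros phi holomorphic_deriv) auto
    have "(\<lambda>n. of_nat (Suc n) ^ Suc j * (\<lambda>s. s * deriv \<phi> s) (q ^ Suc n * w)) sums lambert_sum (Suc j) (\<lambda>s. s * deriv \<phi> s) q w"
      by (rule sums_lambert_sum[OF h _ assms(3,4)]) simp
    then show "summable (\<lambda>n. of_nat (Suc n) ^ Suc j * \<psi> (q ^ Suc n * w))"
      using psi[OF norm_power_times_less_1[OF assms(3,4)]] sums_summable by (metis (no_types, lifting) ext)
  qed
  ultimately show ?thesis using * by simp
qed

text \<open>The division by q in \<open>DERIV_lambert_sum_q\<close> excludes q = 0; holomorphy there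
  is what the initial value argument for \<open>hauptmodul_eq\<close> needs.\<close>

lemma lambert_sum_holomorphic_q:
  assumes "\<phi> holomorphic_on ball 0 1" "\<phi> 0 = 0" "norm w \<le> 1"
  shows "(\<lambda>q. lambert_sum j \<phi> q w) holomorphic_on ball 0 1"
proof (rule holomorphic_onI)
  fix q :: complex assume q: "q \<in> ball 0 1"
  have *: "norm (x * w) < 1" if "norm x < 1" for x :: complex
    using mult_left_le[of "norm w" "norm x"] assms(3) that by (simp add: norm_mult)
  obtain D where "((\<lambda>q. lambert_sum j \<phi> q w) has_field_derivative D) (at q)"
  proof (rule that, rule lambert_sum_composition(2)[OF open_ball[of 0 1]])
    show "((\<lambda>q. q) has_field_derivative 1) (at x)" "((\<lambda>q. w) has_field_derivative 0) (at x)" for x by auto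
  qed (use assms q * in auto)
  then show "(\<lambda>q. lambert_sum j \<phi> q w) field_differentiable at q within ball 0 1"
    unfolding field_differentiable_def using has_field_derivative_at_within by blast
qed

text \<open>
  The annulus contains a compact fundamental domain for multiplication by \<open>q\<close>, so \<open>\<bar>G\<bar>\<close>
  attains its supremum at an interior point.
\<close>

lemma annulus_constant:
  fixes G :: "complex \<Rightarrow> complex"
  assumes q: "0 < norm q" "norm q < 1"
    and holo: "G holomorphic_on {w. norm q < norm w \<and> norm w < 1 / norm q}"
    and inv: "\<And>w. 1 < norm w \<Longrightarrow> norm w < 1 / norm q \<Longrightarrow> G (q * w) = G w"
  shows "G constant_on {w. norm q < norm w \<and> norm w < 1 / norm q}"
proof -
  define A where "A = {w::complex. norm q < norm w \<and> norm w < 1 / norm q}"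
  \<comment> \<open>The inner radius rho is |q| times the outer radius 1 / rho, so for every w in
    the annulus one of w, q w, w / q lies in K.\<close>
  define \<rho> where "\<rho> = sqrt (norm q)"
  define K where "K = cball 0 (1/\<rho>) - ball (0::complex) \<rho>"
  have rho: "\<rho> > 0" "\<rho> < 1" "\<rho> * \<rho> = norm q" using q by (auto simp: \<rho>_def)
  have rq: "norm q < \<rho>" "norm q * (1/\<rho>) = \<rho>" 
  proof -
    have "\<rho> * \<rho> < \<rho> * 1" using rho by (intro mult_strict_left_mono) auto
    then show "norm q < \<rho>" using rho by simp
    show "norm q * (1/\<rho>) = \<rho>" using rho by (simp flip: rho(3))
  qed
  have rq2: "1 / \<rho> < 1 / norm q" using rq rho q by (simp add: frac_less2)
  have KA: "K \<subseteq> A" using rq rq2 by (auto simp: K_def A_def)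
  have oA: "open A" unfolding A_def
    by (intro open_Collect_conj open_Collect_less continuous_intros)
  have conA: "connected A"
    using connected_annulus(1)[where a="0::complex" and ?r1.0="norm q" and ?r2.0="1 / norm q"] by (simp add: A_def)
  have "compact K" unfolding K_def by (intro compact_diff) auto
  moreover have "1 \<in> K" using rho by (auto simp: K_def)
  moreover have "continuous_on K (\<lambda>w. norm (G w))"
    by (intro continuous_on_norm continuous_on_subset[OF holomorphic_on_imp_continuous_on[OF holo] KA[unfolded A_def]])
  ultimately obtain \<xi> where xi: "\<xi> \<in> K" "\<And>w. w \<in> K \<Longrightarrow> norm (G w) \<le> norm (G \<xi>)"
    using continuous_attains_sup[of K "\<lambda>w. norm (G w)"] by blast
  have "norm (G w) \<le> norm (G \<xi>)" if w: "w \<in> A" for w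
  proof -
    consider "w \<in> K" | "norm w > 1 / \<rho>" | "norm w < \<rho>" 
      unfolding K_def by (metis DiffI mem_ball_0 mem_cball_0 not_le)
    then show ?thesis
    proof cases
      \<comment> \<open>Multiplication by q moves the outer collar into K, division by q the inner
        one. Both times \<open>inv\<close> is applied at a point of norm greater than 1.\<close>
      case 2
      have "1 < 1 / \<rho>" using rho by simp
      then have 1: "norm w > 1" using 2 by linarith
      have "norm (q * w) < 1" using w q by (auto simp: A_def norm_mult field_simps)
      moreover have "norm (q * w) > \<rho>"
        using 2 q rq(2) unfolding norm_mult by (metis mult_less_cancel_left_pos)
      ultimately have "q * w \<in> K" using \<open>1 < 1/\<rho>\<close> by (auto simp: K_def)
      then have "norm (G (q * w)) \<le> norm (G \<xi>)" using xi by blast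
      then show ?thesis using inv[of w] w 1 by (auto simp: A_def)
    next
      case 3
      have n: "norm (w / q) = norm w / norm q" by (simp add: norm_divide)
      have "norm (w / q) > 1" using w q by (simp add: A_def n field_simps)
      moreover have "norm (w / q) < 1 / \<rho>"
      proof -
        have "norm w / norm q < \<rho> / norm q" using 3 q by (intro divide_strict_right_mono) auto
        also have "\<rho> / norm q = 1 / \<rho>" using rho(1) unfolding rho(3)[symmetric] by simp
        finally show ?thesis unfolding n .
      qed
      ultimately have "w / q \<in> K" using rho by (auto simp: K_def)
      then have "norm (G (w / q)) \<le> norm (G \<xi>)" using xi by blast
      moreover have "G (q * (w / q)) = G (w / q)"
        using \<open>norm (w / q) > 1\<close> \<open>norm (w / q) < 1 / \<rho>\<close> rq2 by (intro inv) auto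
      ultimately show ?thesis using q by auto
    qed (use xi in auto)
  qed
  then show ?thesis
    using maximum_modulus_principle[OF holo[folded A_def] oA conA oA _ _] xi KA unfolding A_def[symmetric] by blast
qed

section \<open>Heat equation and addition theorem\<close>

text \<open>Closed forms of the series of n^j s^n over n >= 1 for j = 0, 1, 2, 3; each is the image
  of the previous one under s d/ds.\<close>

definition "rho0 s = s / (1 - s)" for s :: complex
definition "rho1 s = s / (1 - s) ^ 2" for s :: complex
definition "rho2 s = s * (1 + s) / (1 - s) ^ 3" for s :: complex
definition "rho3 s = s * (1 + 4 * s + s ^ 2) / (1 - s) ^ 4" for s :: complex

lemma rho_0 [simp]: "rho0 0 = 0" "rho1 0 = 0" "rho2 0 = 0" "rho3 0 = 0"
  by (simp_all add: rho0_def rho1_def rho2_def rho3_def)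

lemma rho_holomorphic [simp]:
  "rho0 holomorphic_on ball 0 1" "rho1 holomorphic_on ball 0 1"
  "rho2 holomorphic_on ball 0 1" "rho3 holomorphic_on ball 0 1"
  unfolding rho0_def rho1_def rho2_def rho3_def by (auto intro!: holomorphic_intros)

lemma DERIV_rho:
  assumes "s \<noteq> 1" "s \<noteq> 0"
  shows "(rho0 has_field_derivative rho1 s / s) (at s)"
    and "(rho1 has_field_derivative rho2 s / s) (at s)"
    and "(rho2 has_field_derivative rho3 s / s) (at s)"
proof -
  have [simp]: "1 - s \<noteq> 0" using assms by simp
  show "(rho0 has_field_derivative rho1 s / s) (at s)"
    unfolding rho0_def[abs_def] rho1_def using assms
    by (auto intro!: derivative_eq_intros simp: divide_simps power2_eq_square) 
  show "(rho1 has_field_derivative rho2 s / s) (at s)"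
    unfolding rho1_def[abs_def] rho2_def using assms
    by (auto intro!: derivative_eq_intros simp: divide_simps) algebra
  show "(rho2 has_field_derivative rho3 s / s) (at s)"
    unfolding rho2_def[abs_def] rho3_def using assms
    by (auto intro!: derivative_eq_intros simp: divide_simps) algebra
qed

lemma rho_deriv:
  assumes "norm s < 1"
  shows "rho1 s = s * deriv rho0 s" "rho2 s = s * deriv rho1 s" "rho3 s = s * deriv rho2 s"
proof -
  have "s \<noteq> 1" using assms by auto
  then show "rho1 s = s * deriv rho0 s" "rho2 s = s * deriv rho1 s" "rho3 s = s * deriv rho2 s"
    \<comment> \<open>\<open>DERIV_rho\<close> divides by s, so s = 0 is treated apart; there both
      sides are 0.\<close>
    by (cases "s = 0"; use DERIV_rho[of s, THEN DERIV_imp_deriv] in simp)+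
qed

text \<open>For q nonzero this is where q w and q / w both lie in the unit disc, so that the Lambert
  series in w and in 1 / w converge for |q| < 1.\<close>

definition annulus :: "complex \<Rightarrow> complex set" where
  "annulus q = {w. norm q < norm w \<and> norm w < 1 / norm q}"

lemma open_annulus: "open (annulus q)"
  unfolding annulus_def by (intro open_Collect_conj open_Collect_less continuous_intros)

lemma annulusD:
  assumes "w \<in> annulus q" "q \<noteq> 0"
  shows "w \<noteq> 0" "norm (q * w) < 1" "norm (q * (1 / w)) < 1"
proof -
  show "w \<noteq> 0" using assms by (auto simp: annulus_def)
  then show "norm (q * w) < 1" "norm (q * (1 / w)) < 1"
    using assms by (auto simp: annulus_def norm_mult norm_divide field_simps)
qed

lemma annulus_unit: "norm q < 1 \<Longrightarrow> q \<noteq> 0 \<Longrightarrow> norm v = 1 \<Longrightarrow> v \<in> annulus q"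
  by (simp add: annulus_def)

lemma annulus_mult_unit: "w \<in> annulus q \<Longrightarrow> norm v = 1 \<Longrightarrow> w * v \<in> annulus q"
  by (simp add: annulus_def norm_mult)

lemma DERIV_lambert_sum_inverse_w:
  assumes phi: "\<phi> holomorphic_on ball 0 1" "\<phi> 0 = 0" and "norm q < 1" "norm (q * (1 / w)) < 1" "w \<noteq> 0"
    and psi: "\<And>s. norm s < 1 \<Longrightarrow> \<psi> s = s * deriv \<phi> s"
  shows "((\<lambda>w. lambert_sum j \<phi> q (1 / w)) has_field_derivative - lambert_sum j \<psi> q (1 / w) / w) (at w)"
proof -
  have "((\<lambda>w. 1 / w) has_field_derivative (- 1 / w ^ 2)) (at w)"
    using \<open>w \<noteq> 0\<close> by (auto intro!: derivative_eq_intros simp: power2_eq_square)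
  from DERIV_chain2[OF DERIV_lambert_sum_w[OF phi assms(3,4) _ psi, of j] this]
  show ?thesis using \<open>w \<noteq> 0\<close> by (simp add: power2_eq_square)
qed

text \<open>
  Write \<open>\<theta>(w)\<close> for \<open>w\<close> to the power \<open>-1/2\<close> times the product of \<open>1 - w\<close> and all
  \<open>(1 - q\<^sup>n w) (1 - q\<^sup>n / w)\<close>, and \<open>D\<close> for \<open>w d/dw\<close>. Then \<open>theta_logderiv\<close> is \<open>D log \<theta>\<close> (a
  Weierstrass zeta function), \<open>wp\<close> is \<open>- D\<^sup>2 log \<theta>\<close> (the Weierstrass function up to an
  additive constant), \<open>wp1 = D wp\<close>, \<open>wp2 = D wp1\<close>; \<open>theta_qderiv\<close> is \<open>q d/dq log \<theta>\<close>, with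
  \<open>theta_qderiv1\<close>, \<open>theta_qderiv2\<close> its images under \<open>D\<close>, \<open>D\<^sup>2\<close>; and \<open>eis_const\<close> is \<open>E\<^sub>2 / 4\<close>.
\<close>

definition theta_logderiv :: "complex \<Rightarrow> complex \<Rightarrow> complex" where
  "theta_logderiv q w = (w + 1) / (2 * (w - 1)) + (lambert_sum 0 rho0 q (1 / w) - lambert_sum 0 rho0 q w)"
definition wp :: "complex \<Rightarrow> complex \<Rightarrow> complex" where
  "wp q w = rho1 w + (lambert_sum 0 rho1 q w + lambert_sum 0 rho1 q (1 / w))"
definition wp1 :: "complex \<Rightarrow> complex \<Rightarrow> complex" where
  "wp1 q w = rho2 w + (lambert_sum 0 rho2 q w - lambert_sum 0 rho2 q (1 / w))"
definition wp2 :: "complex \<Rightarrow> complex \<Rightarrow> complex" where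
  "wp2 q w = rho3 w + (lambert_sum 0 rho3 q w + lambert_sum 0 rho3 q (1 / w))"
definition theta_qderiv :: "complex \<Rightarrow> complex \<Rightarrow> complex" where
  "theta_qderiv q w = - (lambert_sum 1 rho0 q w + lambert_sum 1 rho0 q (1 / w))"
definition theta_qderiv1 :: "complex \<Rightarrow> complex \<Rightarrow> complex" where
  "theta_qderiv1 q w = - (lambert_sum 1 rho1 q w - lambert_sum 1 rho1 q (1 / w))"
definition theta_qderiv2 :: "complex \<Rightarrow> complex \<Rightarrow> complex" where
  "theta_qderiv2 q w = - (lambert_sum 1 rho2 q w + lambert_sum 1 rho2 q (1 / w))"
definition eis_const :: "complex \<Rightarrow> complex" where
  "eis_const q = 1 / 4 - 6 * lambert_sum 0 rho1 q 1"

section \<open>Derivatives, inversion and quasi-periods in the elliptic variable\<close>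

context
  fixes q :: complex
  assumes q: "norm q < 1" "q \<noteq> 0"
begin

text \<open>The factor 1 - w of theta does not depend on q, so \<open>theta_qderiv\<close> and
  \<open>theta_qderiv1\<close> are regular at w = 1.\<close>

lemma DERIV_annulus_w:
  assumes w: "w \<in> annulus q"
  shows "w \<noteq> 1 \<Longrightarrow> (theta_logderiv q has_field_derivative - wp q w / w) (at w)"
    and "w \<noteq> 1 \<Longrightarrow> (wp q has_field_derivative wp1 q w / w) (at w)"
    and "w \<noteq> 1 \<Longrightarrow> (wp1 q has_field_derivative wp2 q w / w) (at w)"
    and "(theta_qderiv q has_field_derivative theta_qderiv1 q w / w) (at w)"
    and "(theta_qderiv1 q has_field_derivative theta_qderiv2 q w / w) (at w)"
proof -
  note D = annulusD[OF w q(2)]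
  note i = DERIV_lambert_sum_w[OF rho_holomorphic(1) rho_0(1) q(1) D(2,1) rho_deriv(1)]
    DERIV_lambert_sum_w[OF rho_holomorphic(2) rho_0(2) q(1) D(2,1) rho_deriv(2)]
    DERIV_lambert_sum_w[OF rho_holomorphic(3) rho_0(3) q(1) D(2,1) rho_deriv(3)]
    DERIV_lambert_sum_inverse_w[OF rho_holomorphic(1) rho_0(1) q(1) D(3,1) rho_deriv(1)]
    DERIV_lambert_sum_inverse_w[OF rho_holomorphic(2) rho_0(2) q(1) D(3,1) rho_deriv(2)]
    DERIV_lambert_sum_inverse_w[OF rho_holomorphic(3) rho_0(3) q(1) D(3,1) rho_deriv(3)]
  show "(theta_logderiv q has_field_derivative - wp q w / w) (at w)" if "w \<noteq> 1"
  proof -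
    have "((\<lambda>w. (w + 1) / (2 * (w - 1))) has_field_derivative - rho1 w / w) (at w)"
    proof -
      have "w - 1 \<noteq> 0" "1 - w \<noteq> 0" using that by auto
      then have "((\<lambda>w. (w + 1) / (2 * (w - 1))) has_field_derivative
          (1 * (2 * (w - 1)) - (w + 1) * 2) / ((2 * (w - 1)) * (2 * (w - 1)))) (at w)"
        by (intro DERIV_divide) (auto intro!: derivative_eq_intros)
      also have "1 * (2 * (w - 1)) - (w + 1) * 2 = - 4" by algebra
      also have "(2 * (w - 1)) * (2 * (w - 1)) = 4 * (1 - w) ^ 2" by algebra
      finally show ?thesis unfolding rho1_def using D(1) by simp
    qed
    from DERIV_add[OF this DERIV_diff[OF i(4) i(1), of 0 0]] show ?thesis
      unfolding theta_logderiv_def[abs_def] wp_def by (simp add: add_divide_distrib diff_divide_distrib algebra_simps)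
  qed
  show "(wp q has_field_derivative wp1 q w / w) (at w)" if "w \<noteq> 1"
    using DERIV_add[OF DERIV_rho(2)[OF that D(1)] DERIV_add[OF i(2) i(5), of 0 0]]
    unfolding wp_def[abs_def] wp1_def by (simp add: add_divide_distrib diff_divide_distrib)
  show "(wp1 q has_field_derivative wp2 q w / w) (at w)" if "w \<noteq> 1"
    using DERIV_add[OF DERIV_rho(3)[OF that D(1)] DERIV_diff[OF i(3) i(6), of 0 0]]
    unfolding wp1_def[abs_def] wp2_def by (simp add: add_divide_distrib diff_divide_distrib)
  show "(theta_qderiv q has_field_derivative theta_qderiv1 q w / w) (at w)"
    using DERIV_minus[OF DERIV_add[OF i(1) i(4), of 1 1]]
    unfolding theta_qderiv_def[abs_def] theta_qderiv1_def by (simp add: add_divide_distrib diff_divide_distrib)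
  show "(theta_qderiv1 q has_field_derivative theta_qderiv2 q w / w) (at w)"
    using DERIV_minus[OF DERIV_diff[OF i(2) i(5), of 1 1]]
    unfolding theta_qderiv1_def[abs_def] theta_qderiv2_def by (simp add: add_divide_distrib diff_divide_distrib)
qed

text \<open>theta(1 / w) = - theta(w), so an odd number of applications of D to log theta gives an
  odd function, an even positive number an even one.\<close>

lemma inverse_symmetry:
  assumes "w \<noteq> 0" "w \<noteq> 1"
  shows "theta_logderiv q (1 / w) = - theta_logderiv q w"
    and "wp q (1 / w) = wp q w"
    and "wp1 q (1 / w) = - wp1 q w"
proof -
  have e: "1 - w \<noteq> 0" "w - 1 \<noteq> 0" "1 - 1 / w \<noteq> 0" "1 / w - 1 \<noteq> 0" using assms by (auto simp: field_simps)
  have "(1 / w + 1) / (2 * (1 / w - 1)) = - ((w + 1) / (2 * (w - 1)))"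
    using e assms by (simp add: divide_simps) algebra
  then show "theta_logderiv q (1 / w) = - theta_logderiv q w"
    unfolding theta_logderiv_def by simp
  have "1 - 1 / w = (w - 1) / w" using assms by (simp add: field_simps)
  then have "rho1 (1 / w) = rho1 w" "rho2 (1 / w) = - rho2 w"
    unfolding rho1_def rho2_def using e assms by (simp_all add: divide_simps) algebra+
  then show "wp q (1 / w) = wp q w" "wp1 q (1 / w) = - wp1 q w"
    unfolding wp_def wp1_def by simp_all
qed

text \<open>Replacing w by q w shifts the summation index by one: a term leaves or enters, and the
  factor n of the weighted series leaves an unweighted series behind. The bounds on w put both w and
  q w in the annulus.\<close>

lemma lambert_sum_shift:
  assumes phi: "\<phi> holomorphic_on ball 0 1" "\<phi> 0 = 0" and w: "1 < norm w" "norm w < 1 / norm q"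
  shows "lambert_sum 0 \<phi> q (q * w) = lambert_sum 0 \<phi> q w - \<phi> (q * w)"
    and "lambert_sum 0 \<phi> q (1 / (q * w)) = lambert_sum 0 \<phi> q (1 / w) + \<phi> (1 / w)"
    and "lambert_sum 1 \<phi> q (q * w) = lambert_sum 1 \<phi> q w - lambert_sum 0 \<phi> q w"
    and "lambert_sum 1 \<phi> q (1 / (q * w)) =
      lambert_sum 1 \<phi> q (1 / w) + lambert_sum 0 \<phi> q (1 / w) + \<phi> (1 / w)"
proof -
  have w0: "w \<noteq> 0" using w by auto
  have n1: "norm (q * w) < 1" using w q by (simp add: norm_mult field_simps)
  have n2: "norm (q * (q * w)) < 1" using n1 q by (metis mult_less_cancel_right2 norm_ge_zero norm_mult order_less_trans not_less_iff_gr_or_eq mult_le_cancel_right2 order_le_less_trans less_eq_real_def)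
  have n3: "norm (1 / w) < 1" using w w0 by (auto simp: norm_divide divide_simps)
  have n4: "norm (q * (1 / w)) < 1" using q n3 mult_strict_mono[of "norm q" 1 "norm (1/w)" 1]
    unfolding norm_mult by simp
  have n5: "norm (q * (1 / (q * w))) < 1" using q n3 by simp
  note S = sums_lambert_sum[OF phi q(1)]
  have a: "(\<lambda>n. \<phi> (q ^ Suc n * w)) sums lambert_sum 0 \<phi> q w" using S[OF n1, of 0] by simp
  have b: "(\<lambda>n. \<phi> (q ^ Suc n * (q * w))) sums (lambert_sum 0 \<phi> q w - \<phi> (q * w))"
    using a sums_Suc_iff[of "\<lambda>n. \<phi> (q ^ Suc n * w)" "lambert_sum 0 \<phi> q w - \<phi> (q * w)"]
    by (simp add: mult_ac)
  show "lambert_sum 0 \<phi> q (q * w) = lambert_sum 0 \<phi> q w - \<phi> (q * w)"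
    using S[OF n2, of 0] b by (simp add: sums_iff)
  have a': "(\<lambda>n. \<phi> (q ^ Suc n * (1 / w))) sums lambert_sum 0 \<phi> q (1 / w)" using S[OF n4, of 0] by simp
  have b': "(\<lambda>n. \<phi> (q ^ n * (1 / w))) sums (lambert_sum 0 \<phi> q (1 / w) + \<phi> (1 / w))"
    using a' sums_Suc_iff[of "\<lambda>n. \<phi> (q ^ n * (1 / w))" "lambert_sum 0 \<phi> q (1 / w)"] by simp
  have e: "q ^ Suc n * (1 / (q * w)) = q ^ n * (1 / w)" for n using q by simp
  show "lambert_sum 0 \<phi> q (1 / (q * w)) = lambert_sum 0 \<phi> q (1 / w) + \<phi> (1 / w)"
    using S[OF n5, of 0] b' unfolding e by (simp add: sums_iff)
  have c: "(\<lambda>n. of_nat (Suc n) * \<phi> (q ^ Suc n * w) - \<phi> (q ^ Suc n * w)) sums (lambert_sum 1 \<phi> q w - lambert_sum 0 \<phi> q w)"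
    using sums_diff[OF S[OF n1, of 1] a] by simp
  have "(\<lambda>n. of_nat n * \<phi> (q ^ Suc n * w)) sums (lambert_sum 1 \<phi> q w - lambert_sum 0 \<phi> q w)"
    using c by (simp add: algebra_simps)
  then have "(\<lambda>n. of_nat (Suc n) * \<phi> (q ^ Suc n * (q * w))) sums (lambert_sum 1 \<phi> q w - lambert_sum 0 \<phi> q w)"
    using sums_Suc_iff[of "\<lambda>n. of_nat n * \<phi> (q ^ Suc n * w)" "lambert_sum 1 \<phi> q w - lambert_sum 0 \<phi> q w"]
    by (simp add: mult_ac)
  then show "lambert_sum 1 \<phi> q (q * w) = lambert_sum 1 \<phi> q w - lambert_sum 0 \<phi> q w"
    using S[OF n2, of 1] by (simp add: sums_iff)
  have c': "(\<lambda>n. of_nat (Suc n) * \<phi> (q ^ Suc n * (1 / w)) + \<phi> (q ^ Suc n * (1 / w))) sums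
      (lambert_sum 1 \<phi> q (1 / w) + lambert_sum 0 \<phi> q (1 / w))"
    using sums_add[OF S[OF n4, of 1] a'] by simp
  then have "(\<lambda>n. of_nat (Suc (Suc n)) * \<phi> (q ^ Suc n * (1 / w))) sums
      (lambert_sum 1 \<phi> q (1 / w) + lambert_sum 0 \<phi> q (1 / w))"
    by (simp add: algebra_simps)
  then have "(\<lambda>n. of_nat (Suc n) * \<phi> (q ^ n * (1 / w))) sums
      (lambert_sum 1 \<phi> q (1 / w) + lambert_sum 0 \<phi> q (1 / w) + \<phi> (1 / w))"
    using sums_Suc_iff[of "\<lambda>n. of_nat (Suc n) * \<phi> (q ^ n * (1 / w))" "lambert_sum 1 \<phi> q (1 / w) + lambert_sum 0 \<phi> q (1 / w)"]
    by simp
  then show "lambert_sum 1 \<phi> q (1 / (q * w)) =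
      lambert_sum 1 \<phi> q (1 / w) + lambert_sum 0 \<phi> q (1 / w) + \<phi> (1 / w)"
    using S[OF n5, of 1] unfolding e by (simp add: sums_iff)
qed

text \<open>These are the logarithmic derivatives of theta(q w) = - q^(-1/2) w^(-1) theta(w). The
  q-derivative also acts on the argument q w, which produces the \<open>theta_logderiv\<close> term
  and 1 - 1/2 = 1/2.\<close>

lemma quasi_periodicity:
  assumes w: "1 < norm w" "norm w < 1 / norm q"
  shows "theta_logderiv q (q * w) = theta_logderiv q w - 1"
    and "wp q (q * w) = wp q w"
    and "theta_qderiv q (q * w) = theta_qderiv q w - theta_logderiv q w + 1 / 2"
proof -
  have n1: "norm (q * w) < 1" using w q by (simp add: norm_mult field_simps)
  have ne: "w \<noteq> 0" "w - 1 \<noteq> 0" "1 - w \<noteq> 0" "1 - q * w \<noteq> 0" "q * w - 1 \<noteq> 0" "1 - 1 / w \<noteq> 0"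
    using w n1 by auto
  note s = lambert_sum_shift[OF rho_holomorphic(1) rho_0(1) w] lambert_sum_shift[OF rho_holomorphic(2) rho_0(2) w]
  \<comment> \<open>The elementary term is expressed by \<open>rho0 (q * w)\<close> at q w and by
    \<open>rho0 (1 / w)\<close> at w, exactly the terms that the shift removes and adds.\<close>
  have c: "(q * w + 1) / (2 * (q * w - 1)) = - 1 / 2 - rho0 (q * w)"
    unfolding rho0_def using ne by (simp add: divide_simps) algebra
  have r: "(w + 1) / (2 * (w - 1)) = rho0 (1 / w) + 1 / 2"
    unfolding rho0_def using ne by (simp add: divide_simps) (simp add: algebra_simps)
  show "theta_logderiv q (q * w) = theta_logderiv q w - 1"
    unfolding theta_logderiv_def s c r by (simp add: algebra_simps)
  have "rho1 (1 / w) = rho1 w"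
    unfolding rho1_def using ne by (simp add: divide_simps) algebra
  then show "wp q (q * w) = wp q w"
    unfolding wp_def s by (simp add: algebra_simps)
  show "theta_qderiv q (q * w) = theta_qderiv q w - theta_logderiv q w + 1 / 2"
    unfolding theta_qderiv_def theta_logderiv_def s r by (simp add: algebra_simps)
qed

text \<open>Removable singularities reduce this to \<open>annulus_constant\<close>. K lies on the
  unit circle, while |q w| < 1 < |w| in the invariance, so patching G on K leaves the invariance
  intact.\<close>

lemma annulus_constant_singular:
  assumes K: "finite K" "K \<subseteq> sphere 0 1"
    and holo: "G holomorphic_on annulus q - K"
    and lim: "\<And>k. k \<in> K \<Longrightarrow> (G \<longlongrightarrow> l k) (at k)"
    and inv: "\<And>w. 1 < norm w \<Longrightarrow> norm w < 1 / norm q \<Longrightarrow> G (q * w) = G w"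
    and w: "w \<in> annulus q - K" and k: "k \<in> K"
  shows "G w = l k"
proof -
  define G' where "G' w = (if w \<in> K then l w else G w)" for w
  have "G' holomorphic_on annulus q"
  proof (rule no_isolated_singularity'[OF _ _ open_annulus K(1)])
    show "(G' \<longlongrightarrow> G' z) (at z within annulus q)" if "z \<in> K" for z
    proof -
      have "\<forall>\<^sub>F w in at z. w \<notin> K"
      proof -
        have "open (- (K - {z}))" using K(1) by (intro open_Compl finite_imp_closed) auto
        from eventually_at_in_open[OF this, of z] show ?thesis by (rule eventually_mono) auto
      qed
      then have "\<forall>\<^sub>F w in at z. G w = G' w"
        by eventually_elim (simp add: G'_def)
      then have "(G' \<longlongrightarrow> l z) (at z)" using lim[OF that] by (rule Lim_transform_eventually[rotated])
      then show ?thesis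
        using tendsto_within_subset[OF _ subset_UNIV] that by (auto simp: G'_def)
    qed
    show "G' holomorphic_on annulus q - K"
      using holo by (rule holomorphic_transform) (simp add: G'_def)
  qed
  then have "G' constant_on annulus q"
    unfolding annulus_def
  proof (rule annulus_constant[rotated 2])
    fix w :: complex assume w: "1 < norm w" "norm w < 1 / norm q"
    have "norm (q * w) < 1" using w q by (simp add: norm_mult field_simps)
    then show "G' (q * w) = G' w" using inv[OF w] w K(2) by (auto simp: G'_def)
  qed (use q in auto)
  moreover have "k \<in> annulus q" using k K(2) by (intro annulus_unit q) auto
  ultimately have "G' w = G' k" using w unfolding constant_on_def by auto
  then show ?thesis using w k by (simp add: G'_def)
qed

end

text \<open>With h = (w + 1) / (2 (w - 1)) one has h^2 = 1/4 + \<open>rho1 w\<close> exactly, so the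
  double pole cancels; g vanishes at 1, so 2 h g tends to 2 d. Both Liouville arguments below
  evaluate their constants this way.\<close>

lemma polar_limit:
  fixes g T :: "complex \<Rightarrow> complex"
  assumes g: "(g has_field_derivative d) (at 1)" "g 1 = 0" and T: "(T \<longlongrightarrow> t) (at 1)"
  shows "((\<lambda>w. ((w + 1) / (2 * (w - 1)) + g w) ^ 2 - rho1 w - T w) \<longlongrightarrow> 1 / 4 + 2 * d - t) (at 1)"
proof -
  have 1: "((\<lambda>w. g w / (w - 1)) \<longlongrightarrow> d) (at 1)"
    using g unfolding has_field_derivative_iff by simp
  have 2: "(g \<longlongrightarrow> 0) (at 1)" using DERIV_isCont[OF g(1)] g(2) by (simp add: isCont_def)
  have "((\<lambda>w. 1 / 4 + (w + 1) * (g w / (w - 1)) + g w ^ 2 - T w) \<longlongrightarrow> 1 / 4 + (1 + 1) * d + 0 ^ 2 - t) (at 1)"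
    by (intro tendsto_intros 1 2 T)
  then have "((\<lambda>w. 1 / 4 + (w + 1) * (g w / (w - 1)) + g w ^ 2 - T w) \<longlongrightarrow> 1 / 4 + 2 * d - t) (at 1)"
    by simp
  then show ?thesis
  proof (rule Lim_transform_eventually)
    show "\<forall>\<^sub>F w in at 1. 1 / 4 + (w + 1) * (g w / (w - 1)) + g w ^ 2 - T w =
        ((w + 1) / (2 * (w - 1)) + g w) ^ 2 - rho1 w - T w"
      unfolding eventually_at_filter
    proof (intro always_eventually allI impI)
      fix w :: complex assume "w \<noteq> 1"
      then have "w - 1 \<noteq> 0" "1 - w \<noteq> 0" by auto
      then have "((w + 1) / (2 * (w - 1))) ^ 2 - rho1 w = 1 / 4"
        unfolding rho1_def power_divide by (simp add: divide_simps) algebra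
      moreover have "2 * ((w + 1) / (2 * (w - 1))) * g w = (w + 1) * (g w / (w - 1))"
        using \<open>w - 1 \<noteq> 0\<close> by (simp add: divide_simps) (simp add: algebra_simps)
      moreover have "1 / 4 + b + g w ^ 2 - T w = (h + g w) ^ 2 - rho1 w - T w"
        if "h ^ 2 - rho1 w = 1 / 4" "2 * h * g w = b" for h b
      proof -
        have "rho1 w = h ^ 2 - (h ^ 2 - rho1 w)" by simp
        also have "h ^ 2 - rho1 w = 1 / 4" by (rule that)
        finally show ?thesis unfolding that(2)[symmetric] by (simp add: power2_sum)
      qed
      ultimately show "1 / 4 + (w + 1) * (g w / (w - 1)) + g w ^ 2 - T w =
        ((w + 1) / (2 * (w - 1)) + g w) ^ 2 - rho1 w - T w"
        by blast
    qed
  qed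
qed

section \<open>Liouville arguments: the heat equation and the addition theorem\<close>

context
  fixes q :: complex
  assumes q: "norm q < 1" "q \<noteq> 0"
begin

lemma annulus_1: "1 \<in> annulus q"
  by (rule annulus_unit) (use q in auto)

lemma DERIV_regular_part:
  "((\<lambda>w. lambert_sum 0 rho0 q (1 / w) - lambert_sum 0 rho0 q w) has_field_derivative
      - 2 * lambert_sum 0 rho1 q 1) (at 1)"
  using DERIV_diff[OF DERIV_lambert_sum_inverse_w[OF rho_holomorphic(1) rho_0(1) q(1) _ _ rho_deriv(1)]
     DERIV_lambert_sum_w[OF rho_holomorphic(1) rho_0(1) q(1) _ _ rho_deriv(1)], of 1 0 0] q
  by simp

lemma wp_regular_part_tendsto:
  "((\<lambda>w. lambert_sum 0 rho1 q w + lambert_sum 0 rho1 q (1 / w)) \<longlongrightarrow> 2 * lambert_sum 0 rho1 q 1) (at 1)"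
proof -
  have "isCont (lambert_sum 0 rho1 q) 1" "isCont (\<lambda>w. lambert_sum 0 rho1 q (1 / w)) 1"
    using DERIV_isCont[OF DERIV_lambert_sum_w[OF rho_holomorphic(2) rho_0(2) q(1) _ _ rho_deriv(2)], of 1 0]
      DERIV_isCont[OF DERIV_lambert_sum_inverse_w[OF rho_holomorphic(2) rho_0(2) q(1) _ _ rho_deriv(2)], of 1 0] q
    by simp_all
  then have "isCont (\<lambda>w. lambert_sum 0 rho1 q w + lambert_sum 0 rho1 q (1 / w)) 1"
    by (intro continuous_intros)
  then show ?thesis by (simp add: isCont_def)
qed

lemma isCont_annulus:
  assumes "w \<in> annulus q"
  shows "w \<noteq> 1 \<Longrightarrow> isCont (theta_logderiv q) w" "w \<noteq> 1 \<Longrightarrow> isCont (wp q) w" "isCont (theta_qderiv q) w"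
  using DERIV_annulus_w[OF q assms] DERIV_isCont by blast+

lemma holomorphic_annulus:
  "theta_logderiv q holomorphic_on annulus q - {1}" "wp q holomorphic_on annulus q - {1}"
  "theta_qderiv q holomorphic_on annulus q"
proof -
  have *: "f holomorphic_on A" if "\<And>x. x \<in> A \<Longrightarrow> (f has_field_derivative f' x) (at x)"
    for f f' :: "complex \<Rightarrow> complex" and A
    using that by (meson field_differentiable_at_within field_differentiable_def holomorphic_onI)
  show "theta_logderiv q holomorphic_on annulus q - {1}" by (rule *, rule DERIV_annulus_w(1)[OF q]) auto
  show "wp q holomorphic_on annulus q - {1}" by (rule *, rule DERIV_annulus_w(2)[OF q]) auto
  show "theta_qderiv q holomorphic_on annulus q" by (rule *, rule DERIV_annulus_w(4)[OF q]) auto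
qed

text \<open>The square of \<open>theta_logderiv\<close> minus \<open>wp\<close> is D^2 theta divided
  by theta, so this is the logarithmic form of a heat equation 2 q d/dq theta = D^2 theta + C(q)
  theta. Under w -> q w the function G is invariant because (zeta - 1)^2 + 2 zeta - 1 = zeta^2; it
  is regular at w = 1, and its limit there is the constant.\<close>

theorem theta_heat_equation:
  assumes w: "w \<in> annulus q" "w \<noteq> 1"
  shows "theta_qderiv q w =
    (theta_logderiv q w ^ 2 - wp q w - eis_const q) / 2 - 2 * lambert_sum 1 rho0 q 1"
proof -
  define G where "G w = theta_logderiv q w ^ 2 - wp q w - 2 * theta_qderiv q w" for w
  define c where "c = 1 / 4 + 2 * (- 2 * lambert_sum 0 rho1 q 1)
    - (2 * lambert_sum 0 rho1 q 1 + 2 * theta_qderiv q 1)"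
  have "G w = c"
  proof (rule annulus_constant_singular[OF q, where K="{1}" and k=1 and G=G and l="\<lambda>_. c"])
    show "G holomorphic_on annulus q - {1}"
      unfolding G_def by (intro holomorphic_intros holomorphic_annulus holomorphic_on_subset[OF holomorphic_annulus(3)]) auto
    show "(G \<longlongrightarrow> c) (at k)" if "k \<in> {1}" for k
    proof -
      have "(theta_qderiv q \<longlongrightarrow> theta_qderiv q 1) (at 1)"
        using isCont_annulus(3)[OF annulus_1] by (simp add: isCont_def)
      from polar_limit[OF DERIV_regular_part _ tendsto_add[OF wp_regular_part_tendsto tendsto_mult[OF tendsto_const[of 2] this]]]
      show ?thesis using that
        unfolding G_def c_def theta_logderiv_def[abs_def] wp_def[abs_def] by (simp add: diff_diff_eq add.assoc)
    qed
    show "G (q * w) = G w" if "1 < norm w" "norm w < 1 / norm q" for w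
      unfolding G_def quasi_periodicity[OF q that] by (simp add: power2_eq_square algebra_simps)
  qed (use w in auto)
  moreover have "theta_qderiv q 1 = - 2 * lambert_sum 1 rho0 q 1"
    by (simp add: theta_qderiv_def)
  ultimately show ?thesis unfolding G_def c_def eis_const_def by (simp add: field_simps)
qed

text \<open>By oddness the left side is the square of the sum of the zeta values at three points u,
  v, 1 / (u v) with product 1. As u varies, the quasi-periods of zeta(u) and zeta(u v) cancel, and
  so do the poles of the difference G at u = 1 and u = 1 / v; \<open>eis_const\<close> absorbs the
  additive normalization of \<open>wp\<close>.\<close>

theorem theta_logderiv_addition:
  assumes u: "u \<in> annulus q" "u \<noteq> 1" "u * v \<noteq> 1" and v: "norm v = 1" "v \<noteq> 1"
  shows "(theta_logderiv q u + theta_logderiv q v - theta_logderiv q (u * v)) ^ 2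
    = wp q u + wp q v + wp q (u * v) + eis_const q"
proof -
  define G where "G u = (theta_logderiv q u + theta_logderiv q v - theta_logderiv q (u * v)) ^ 2
     - wp q u - wp q v - wp q (u * v)" for u
  have v0: "v \<noteq> 0" and n: "norm (1 / v) = 1" using v by (auto simp: norm_divide)
  have va: "v \<in> annulus q" using v q by (intro annulus_unit) auto
  define k where "k = eis_const q"
  have lim1: "(G \<longlongrightarrow> k) (at 1)"
  proof -
    \<comment> \<open>The part of the zeta sum that is regular at u = 1; it vanishes there because u
      v = v.\<close>
    define g where "g u = (lambert_sum 0 rho0 q (1 / u) - lambert_sum 0 rho0 q u)
       + (theta_logderiv q v - theta_logderiv q (u * v))" for u
    have "((\<lambda>u. theta_logderiv q (u * v)) has_field_derivative (- wp q v / v * v)) (at 1)"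
      using DERIV_annulus_w(1)[OF q va v(2)]
      by (intro DERIV_chain2[where f="theta_logderiv q"]) (auto intro!: derivative_eq_intros)
    from DERIV_add[OF DERIV_regular_part DERIV_diff[OF DERIV_const[of "theta_logderiv q v"] this]] v0
    have "(g has_field_derivative - 2 * lambert_sum 0 rho1 q 1 + wp q v) (at 1)"
      unfolding g_def by simp
    moreover have "g 1 = 0" by (simp add: g_def)
    moreover have "((\<lambda>u. wp q (u * v)) \<longlongrightarrow> wp q v) (at 1)"
    proof -
      have "isCont (\<lambda>u. wp q (u * v)) 1"
        by (rule isCont_o2[where g="wp q"]) (use isCont_annulus(2)[OF va v(2)] in \<open>auto intro!: continuous_intros\<close>)
      then show ?thesis by (simp add: isCont_def)
    qed
    then have "((\<lambda>u. (lambert_sum 0 rho1 q u + lambert_sum 0 rho1 q (1 / u)) + (wp q v + wp q (u * v))) \<longlongrightarrow>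
        2 * lambert_sum 0 rho1 q 1 + (wp q v + wp q v)) (at 1)"
      by (intro tendsto_intros wp_regular_part_tendsto)
    ultimately have "((\<lambda>w. ((w + 1) / (2 * (w - 1)) + g w) ^ 2 - rho1 w -
        ((lambert_sum 0 rho1 q w + lambert_sum 0 rho1 q (1 / w)) + (wp q v + wp q (w * v)))) \<longlongrightarrow>
        1 / 4 + 2 * (- 2 * lambert_sum 0 rho1 q 1 + wp q v) -
        (2 * lambert_sum 0 rho1 q 1 + (wp q v + wp q v))) (at 1)"
      by (rule polar_limit)
    moreover have "1 / 4 + 2 * (- 2 * lambert_sum 0 rho1 q 1 + wp q v) -
        (2 * lambert_sum 0 rho1 q 1 + (wp q v + wp q v)) = k"
      by (simp add: k_def eis_const_def)
    moreover have "G = (\<lambda>w. ((w + 1) / (2 * (w - 1)) + g w) ^ 2 - rho1 w -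
        ((lambert_sum 0 rho1 q w + lambert_sum 0 rho1 q (1 / w)) + (wp q v + wp q (w * v))))"
      unfolding G_def g_def theta_logderiv_def[of q u for u] wp_def[of q u for u] 
      by (rule ext) (simp add: theta_logderiv_def wp_def algebra_simps)
    ultimately show ?thesis by simp
  qed
  \<comment> \<open>The involution u -> 1 / (u v) fixes v, exchanges the other two points and swaps
    the two poles, so the limit at 1 / v is inherited from the one at 1.\<close>
  have sym: "G (1 / (u * v)) = G u" if "u \<noteq> 0" "u \<noteq> 1" "u * v \<noteq> 1" for u
  proof -
    have "1 / (u * v) * v = 1 / u" using v0 by simp
    then show ?thesis unfolding G_def
      using inverse_symmetry[OF q, of u] inverse_symmetry[OF q, of "u * v"] that v0
      by (simp add: algebra_simps)
  qed
  have lim2: "(G \<longlongrightarrow> k) (at (1 / v))"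
  proof -
    have "filterlim (\<lambda>u. 1 / (u * v)) (at 1) (at (1 / v))"
      unfolding filterlim_at
    proof
      show "\<forall>\<^sub>F u in at (1 / v). 1 / (u * v) \<in> UNIV \<and> 1 / (u * v) \<noteq> 1"
        unfolding eventually_at_filter using v0 by (auto simp: field_simps)
      have "((\<lambda>u. 1 / (u * v)) \<longlongrightarrow> 1 / (1 / v * v)) (at (1 / v))"
        using v0 by (intro tendsto_intros) auto
      then show "((\<lambda>u. 1 / (u * v)) \<longlongrightarrow> 1) (at (1 / v))" using v0 by simp
    qed
    then have "((\<lambda>u. G (1 / (u * v))) \<longlongrightarrow> k) (at (1 / v))"
      by (rule filterlim_compose[OF lim1])
    moreover have "\<forall>\<^sub>F u in at (1 / v). G (1 / (u * v)) = G u"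
    proof -
      have "open (- {0, 1 :: complex})" by (intro open_Compl finite_imp_closed) auto
      from eventually_at_in_open[OF this, of "1 / v"] v0 v(2) show ?thesis
        by (auto elim!: eventually_mono intro!: sym simp: field_simps)
    qed
    ultimately show ?thesis by (rule Lim_transform_eventually)
  qed
  have "G u = k"
  proof (rule annulus_constant_singular[OF q, where K="{1, 1 / v}" and k=1 and G=G and l="\<lambda>_. k"])
    show "{1, 1 / v} \<subseteq> sphere 0 1" using n by auto
    show "(G \<longlongrightarrow> k) (at z)" if "z \<in> {1, 1 / v}" for z using that lim1 lim2 by auto
    have "(\<lambda>u. u * v) ` (annulus q - {1, 1 / v}) \<subseteq> annulus q - {1}"
      using annulus_mult_unit v v0 by (auto simp: field_simps)
    moreover have "(\<lambda>u. u * v) holomorphic_on annulus q - {1, 1 / v}" by (intro holomorphic_intros)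
    ultimately have "(\<lambda>u. theta_logderiv q (u * v)) holomorphic_on annulus q - {1, 1 / v}"
      "(\<lambda>u. wp q (u * v)) holomorphic_on annulus q - {1, 1 / v}"
      using holomorphic_on_compose_gen[OF _ holomorphic_annulus(1)]
         holomorphic_on_compose_gen[OF _ holomorphic_annulus(2)]
      unfolding o_def by blast+
    then show "G holomorphic_on annulus q - {1, 1 / v}"
      unfolding G_def
      by (intro holomorphic_intros holomorphic_on_subset[OF holomorphic_annulus(1)]
          holomorphic_on_subset[OF holomorphic_annulus(2)]) auto
    show "G (q * w) = G w" if "1 < norm w" "norm w < 1 / norm q" for w
    proof -
      have "1 < norm (w * v)" "norm (w * v) < 1 / norm q" using that v by (auto simp: norm_mult)
      from quasi_periodicity[OF q that] quasi_periodicity[OF q this] show ?thesis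
        unfolding G_def by (simp add: mult.assoc add_diff_eq)
    qed
  qed (use u v0 in \<open>auto simp: field_simps\<close>)
  then show ?thesis unfolding G_def k_def by (simp add: algebra_simps)
qed

text \<open>Applying D in u to the addition theorem once and twice, with D S = wp(u v) - wp(u),
  gives \<open>wp1\<close> and \<open>wp2\<close> at torsion points without the cubic differential
  equation of \<open>wp\<close>.\<close>

lemma addition_deriv:
  assumes u: "u \<in> annulus q" "u \<noteq> 1" "u * v \<noteq> 1" and v: "norm v = 1" "v \<noteq> 1"
  defines "S \<equiv> theta_logderiv q u + theta_logderiv q v - theta_logderiv q (u * v)"
  shows "2 * S * (wp q (u * v) - wp q u) = wp1 q u + wp1 q (u * v)"
    and "2 * (wp q (u * v) - wp q u) ^ 2 + 2 * S * (wp1 q (u * v) - wp1 q u) = wp2 q u + wp2 q (u * v)"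
proof -
  define A where "A = annulus q - {1, 1 / v}"
  have v0: "v \<noteq> 0" using v by auto
  have A: "open A" unfolding A_def by (intro open_Diff open_annulus finite_imp_closed) auto
  have uA: "u \<in> A" using u v0 by (auto simp: A_def field_simps)
  have D: "x \<noteq> 0" "x \<noteq> 1" "x \<in> annulus q" "x * v \<in> annulus q" "x * v \<noteq> 1" if "x \<in> A" for x
  proof -
    show "x \<noteq> 0" "x \<noteq> 1" "x \<in> annulus q" "x * v \<in> annulus q"
      using that annulusD(1)[OF _ q(2)] annulus_mult_unit[OF _ v(1)] by (auto simp: A_def)
    show "x * v \<noteq> 1" using that v0 by (auto simp: A_def field_simps)
  qed
  have 1: "(theta_logderiv q has_field_derivative - wp q x / x) (at x)"
      "(wp q has_field_derivative wp1 q x / x) (at x)"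
      "(wp1 q has_field_derivative wp2 q x / x) (at x)" if "x \<in> A" for x
    using DERIV_annulus_w[OF q, of x] D[OF that] by blast+
  have 2: "((\<lambda>x. f (x * v)) has_field_derivative f' / x) (at x)"
    if "x \<in> A" "(f has_field_derivative f' / (x * v)) (at (x * v))" for f f' x
  proof -
    have "((\<lambda>x. f (x * v)) has_field_derivative f' / (x * v) * v) (at x)"
      by (rule DERIV_chain2[where f=f and g="\<lambda>x. x * v", OF that(2)]) (auto intro!: derivative_eq_intros)
    then show ?thesis using v0 by simp
  qed
  have 3: "((\<lambda>x. theta_logderiv q (x * v)) has_field_derivative - wp q (x * v) / x) (at x)"
      "((\<lambda>x. wp q (x * v)) has_field_derivative wp1 q (x * v) / x) (at x)"
      "((\<lambda>x. wp1 q (x * v)) has_field_derivative wp2 q (x * v) / x) (at x)" if "x \<in> A" for x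
    using DERIV_annulus_w(1-3)[OF q, of "x * v"] D[OF that] by (blast intro: 2[OF that])+
  define F where "F x = theta_logderiv q x + theta_logderiv q v - theta_logderiv q (x * v)" for x
  have dF: "(F has_field_derivative (wp q (x * v) - wp q x) / x) (at x)" if "x \<in> A" for x
    unfolding F_def using D[OF that]
    by (auto intro!: derivative_eq_intros 1[OF that] 3[OF that] simp: diff_divide_distrib)
  have first: "2 * F x * (wp q (x * v) - wp q x) = wp1 q x + wp1 q (x * v)" if x: "x \<in> A" for x
  proof -
    have "((\<lambda>x. F x ^ 2 - wp q x - wp q v - wp q (x * v)) has_field_derivative
       (2 * F x * ((wp q (x * v) - wp q x) / x) - wp1 q x / x - wp1 q (x * v) / x)) (at x)"
      by (auto intro!: derivative_eq_intros dF[OF x] 1[OF x] 3[OF x])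
    moreover have "((\<lambda>x. F x ^ 2 - wp q x - wp q v - wp q (x * v)) has_field_derivative 0) (at x)"
    proof (rule has_field_derivative_transform_within_open[OF _ A x])
      show "((\<lambda>x. eis_const q) has_field_derivative 0) (at x)" by simp
      show "eis_const q = F y ^ 2 - wp q y - wp q v - wp q (y * v)" if "y \<in> A" for y
        using theta_logderiv_addition[of y v] D[OF that] v unfolding F_def by simp
    qed
    ultimately have "2 * F x * ((wp q (x * v) - wp q x) / x) - wp1 q x / x - wp1 q (x * v) / x = 0"
      by (rule DERIV_unique)
    then have "(2 * F x * (wp q (x * v) - wp q x) - wp1 q x - wp1 q (x * v)) / x = 0"
      by (simp add: diff_divide_distrib right_diff_distrib)
    then show ?thesis using D(1)[OF x] by (simp add: algebra_simps)
  qed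
  then show "2 * S * (wp q (u * v) - wp q u) = wp1 q u + wp1 q (u * v)"
    using uA unfolding S_def F_def by blast
  have "((\<lambda>x. 2 * F x * (wp q (x * v) - wp q x) - wp1 q x - wp1 q (x * v)) has_field_derivative
       (2 * ((wp q (u * v) - wp q u) / u) * (wp q (u * v) - wp q u) +
        2 * F u * (wp1 q (u * v) / u - wp1 q u / u) - wp2 q u / u - wp2 q (u * v) / u)) (at u)"
    by (auto intro!: derivative_eq_intros dF[OF uA] 1[OF uA] 3[OF uA])
  moreover have "((\<lambda>x. 2 * F x * (wp q (x * v) - wp q x) - wp1 q x - wp1 q (x * v)) has_field_derivative 0) (at u)"
  proof (rule has_field_derivative_transform_within_open[OF _ A uA])
    show "((\<lambda>x. 0) has_field_derivative 0) (at u)" by simp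
    show "0 = 2 * F y * (wp q (y * v) - wp q y) - wp1 q y - wp1 q (y * v)" if "y \<in> A" for y
      using first[OF that] by simp
  qed
  ultimately have "2 * ((wp q (u * v) - wp q u) / u) * (wp q (u * v) - wp q u) +
        2 * F u * (wp1 q (u * v) / u - wp1 q u / u) - wp2 q u / u - wp2 q (u * v) / u = 0"
    by (rule DERIV_unique)
  then have "(2 * (wp q (u * v) - wp q u) ^ 2 + 2 * F u * (wp1 q (u * v) - wp1 q u) - wp2 q u - wp2 q (u * v)) / u = 0"
    by (simp add: add_divide_distrib diff_divide_distrib power2_eq_square algebra_simps)
  then show "2 * (wp q (u * v) - wp q u) ^ 2 + 2 * S * (wp1 q (u * v) - wp1 q u) = wp2 q u + wp2 q (u * v)"
    using D(1)[OF uA] unfolding S_def F_def[symmetric] by (simp add: diff_eq_eq add.commute)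
qed

text \<open>D removes the w-independent terms of the heat equation. As D commutes with q d/dq, the
  results are q-derivatives of \<open>theta_logderiv\<close> and, up to sign, of
  \<open>wp\<close>.\<close>

lemma heat_deriv:
  assumes w: "w \<in> annulus q" "w \<noteq> 1"
  shows "theta_qderiv1 q w = - theta_logderiv q w * wp q w - wp1 q w / 2"
    and "theta_qderiv2 q w = wp q w ^ 2 - theta_logderiv q w * wp1 q w - wp2 q w / 2"
proof -
  define A where "A = annulus q - {1}"
  have A: "open A" unfolding A_def by (intro open_Diff open_annulus finite_imp_closed) auto
  have wA: "w \<in> A" using w by (auto simp: A_def)
  have D: "x \<noteq> 0" "x \<noteq> 1" "x \<in> annulus q" if "x \<in> A" for x
    using that annulusD(1)[OF _ q(2)] by (auto simp: A_def)
  have 1: "(theta_logderiv q has_field_derivative - wp q x / x) (at x)"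
      "(wp q has_field_derivative wp1 q x / x) (at x)"
      "(wp1 q has_field_derivative wp2 q x / x) (at x)"
      "(theta_qderiv q has_field_derivative theta_qderiv1 q x / x) (at x)"
      "(theta_qderiv1 q has_field_derivative theta_qderiv2 q x / x) (at x)" if "x \<in> A" for x
    using DERIV_annulus_w[OF q, of x] D[OF that] by blast+
  have first: "theta_qderiv1 q x = - theta_logderiv q x * wp q x - wp1 q x / 2" if x: "x \<in> A" for x
  proof -
    have "((\<lambda>x. (theta_logderiv q x ^ 2 - wp q x - eis_const q) / 2 - 2 * lambert_sum 1 rho0 q 1)
       has_field_derivative (2 * theta_logderiv q x * (- wp q x / x) - wp1 q x / x) / 2) (at x)"
      by (auto intro!: derivative_eq_intros 1[OF x] simp: mult_ac)
    then have "(theta_qderiv q has_field_derivative (2 * theta_logderiv q x * (- wp q x / x) - wp1 q x / x) / 2) (at x)"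
      by (rule has_field_derivative_transform_within_open[OF _ A x])
        (use theta_heat_equation D in auto)
    from DERIV_unique[OF 1(4)[OF x] this]
    have "theta_qderiv1 q x / x = (- theta_logderiv q x * wp q x - wp1 q x / 2) / x"
      by (simp add: diff_divide_distrib)
    then show ?thesis using D[OF x] by simp
  qed
  then show "theta_qderiv1 q w = - theta_logderiv q w * wp q w - wp1 q w / 2" using wA by blast
  have "((\<lambda>x. - theta_logderiv q x * wp q x - wp1 q x / 2)
       has_field_derivative - (- wp q w / w) * wp q w - theta_logderiv q w * (wp1 q w / w) - wp2 q w / w / 2) (at w)"
    by (auto intro!: derivative_eq_intros 1[OF wA] simp: mult_ac)
  then have "(theta_qderiv1 q has_field_derivative
      - (- wp q w / w) * wp q w - theta_logderiv q w * (wp1 q w / w) - wp2 q w / w / 2) (at w)"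
    by (rule has_field_derivative_transform_within_open[OF _ A wA]) (use first in auto)
  from DERIV_unique[OF 1(5)[OF wA] this]
  have "theta_qderiv2 q w / w = (wp q w ^ 2 - theta_logderiv q w * wp1 q w - wp2 q w / 2) / w"
    by (simp add: diff_divide_distrib power2_eq_square)
  then show "theta_qderiv2 q w = wp q w ^ 2 - theta_logderiv q w * wp1 q w - wp2 q w / 2"
    using D[OF wA] by simp
qed

end

section \<open>Points of order six\<close>

definition zeta6 :: complex where "zeta6 = cis (pi / 3)"
text \<open>\<open>zeta6\<close> is a root of z^2 - z + 1, so this is its square, a primitive cube
  root of unity.\<close>

definition omega :: complex where "omega = zeta6 - 1"

lemma zeta6_Complex: "zeta6 = Complex (1 / 2) (sqrt 3 / 2)"
  by (simp add: zeta6_def cis.ctr cos_60 sin_60)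

lemma zeta6_square: "zeta6 * zeta6 = omega"
  by (simp add: omega_def zeta6_Complex complex_eq_iff)

lemma zeta6_cube: "zeta6 * omega = - 1"
  using zeta6_square by (simp add: omega_def algebra_simps)

lemma omega_square: "omega * omega = - zeta6"
  using zeta6_cube by (metis minus_equation_iff mult.assoc mult_minus1_right mult.commute zeta6_square)

lemma norm_zeta6 [simp]: "norm zeta6 = 1"
  by (simp add: zeta6_def)

lemma norm_omega [simp]: "norm omega = 1"
  by (metis norm_mult norm_zeta6 mult_1 zeta6_square)

lemma zeta6_neq: "zeta6 \<noteq> 0" "zeta6 \<noteq> 1" "omega \<noteq> 0" "omega \<noteq> 1"
  by (auto simp: zeta6_Complex omega_def complex_eq_iff)

lemma inverse_zeta6: "1 / zeta6 = - omega" "1 / omega = - zeta6"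
  using zeta6_neq zeta6_cube by (auto simp: field_simps)

context
  fixes q :: complex
  assumes q: "norm q < 1" "q \<noteq> 0"
begin

text \<open>-1 is its own inverse, so odd functions vanish there.\<close>

lemma theta_logderiv_minus1: "theta_logderiv q (- 1) = 0" "wp1 q (- 1) = 0"
  using inverse_symmetry(1,3)[OF q, of "- 1"] by auto

text \<open>The addition theorem at (omega, omega), (zeta6, zeta6), (zeta6, omega), with products 1
  / omega, omega, -1, is a triangular linear system for the values of \<open>wp\<close>. Its
  derivatives give \<open>wp1\<close> first at zeta6, since \<open>wp1\<close> vanishes at -1, then
  at omega; the second derivative at (omega, omega) gives \<open>wp2\<close>.\<close>

lemma torsion_values:
  defines "y1 \<equiv> theta_logderiv q zeta6" and "y2 \<equiv> theta_logderiv q omega" and "k \<equiv> eis_const q"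
  shows "wp q zeta6 = 2 * y1 ^ 2 - 2 * y1 * y2 - y2 ^ 2 - k / 3"
    and "wp q omega = 3 * y2 ^ 2 - k / 3"
    and "wp q (- 1) = - (y1 ^ 2) + 4 * y1 * y2 - y2 ^ 2 - k / 3"
    and "wp1 q zeta6 = 6 * y1 * (y1 + y2) * (2 * y2 - y1)"
    and "wp1 q omega = - 2 * (y1 + y2) * (y1 - 2 * y2) ^ 2"
    and "wp2 q omega = - 6 * y2 * wp1 q omega"
proof -
  have za: "zeta6 \<in> annulus q" and oa: "omega \<in> annulus q" using q by (auto intro: annulus_unit)
  have o2: "omega * omega = 1 / omega" by (simp add: omega_square inverse_zeta6)
  have o2': "omega * omega \<noteq> 1" using zeta6_neq by (simp add: o2 field_simps)
  have zo': "zeta6 * omega \<noteq> 1" by (simp add: zeta6_cube)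
  have zz': "zeta6 * zeta6 \<noteq> 1" using zeta6_neq by (simp add: zeta6_square)
  note sym = inverse_symmetry[OF q zeta6_neq(3,4)]
  note oo = theta_logderiv_addition[OF q oa zeta6_neq(4) o2' norm_omega zeta6_neq(4)]
    and zz = theta_logderiv_addition[OF q za zeta6_neq(2) zz' norm_zeta6 zeta6_neq(2)]
    and zo = theta_logderiv_addition[OF q za zeta6_neq(2) zo' norm_omega zeta6_neq(4)]
  have e1: "9 * y2 ^ 2 = 3 * wp q omega + k"
    using oo unfolding o2 sym y2_def[symmetric] k_def[symmetric] by (simp add: power2_eq_square)
  have e2: "(2 * y1 - y2) ^ 2 = 2 * wp q zeta6 + wp q omega + k"
    using zz unfolding zeta6_square y1_def[symmetric] y2_def[symmetric] k_def[symmetric] by simp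
  have e3: "(y1 + y2) ^ 2 = wp q zeta6 + wp q omega + wp q (- 1) + k"
    using zo unfolding zeta6_cube theta_logderiv_minus1 y1_def[symmetric] y2_def[symmetric] k_def[symmetric] by simp
  show V2: "wp q omega = 3 * y2 ^ 2 - k / 3" using e1 by (simp add: field_simps)
  show V1: "wp q zeta6 = 2 * y1 ^ 2 - 2 * y1 * y2 - y2 ^ 2 - k / 3"
  proof -
    have "2 * wp q zeta6 = 2 * (2 * y1 ^ 2 - 2 * y1 * y2 - y2 ^ 2 - k / 3)"
      using e2 unfolding V2 by (simp add: field_simps power2_eq_square)
    then show ?thesis by (simp only: mult_cancel_left) simp
  qed
  show V3: "wp q (- 1) = - (y1 ^ 2) + 4 * y1 * y2 - y2 ^ 2 - k / 3"
  proof -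
    have "3 * wp q (- 1) = 3 * (- (y1 ^ 2) + 4 * y1 * y2 - y2 ^ 2 - k / 3)"
      using e3 unfolding V2 V1 by (simp add: field_simps power2_eq_square)
    then show ?thesis by (simp only: mult_cancel_left) simp
  qed
  note doo = addition_deriv[OF q oa zeta6_neq(4) o2' norm_omega zeta6_neq(4)]
    and dzz = addition_deriv[OF q za zeta6_neq(2) zz' norm_zeta6 zeta6_neq(2)]
    and dzo = addition_deriv[OF q za zeta6_neq(2) zo' norm_omega zeta6_neq(4)]
  have "2 * (y1 + y2) * (wp q (- 1) - wp q zeta6) = wp1 q zeta6"
    using dzo(1) unfolding zeta6_cube theta_logderiv_minus1 y1_def[symmetric] y2_def[symmetric] by simp
  moreover have "wp q (- 1) - wp q zeta6 = 6 * y1 * y2 - 3 * y1 ^ 2" unfolding V1 V3 by simp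
  ultimately have "wp1 q zeta6 = 2 * (y1 + y2) * (6 * y1 * y2 - 3 * y1 ^ 2)" by simp
  also have "\<dots> = 6 * y1 * (y1 + y2) * (2 * y2 - y1)" by algebra
  finally show W1: "wp1 q zeta6 = 6 * y1 * (y1 + y2) * (2 * y2 - y1)" .
  have "2 * (2 * y1 - y2) * (wp q omega - wp q zeta6) = wp1 q zeta6 + wp1 q omega"
    using dzz(1) unfolding zeta6_square y1_def[symmetric] y2_def[symmetric] by simp
  moreover have "wp q omega - wp q zeta6 = 4 * y2 ^ 2 + 2 * y1 * y2 - 2 * y1 ^ 2" unfolding V1 V2 by simp
  ultimately have "wp1 q omega = 2 * (2 * y1 - y2) * (4 * y2 ^ 2 + 2 * y1 * y2 - 2 * y1 ^ 2) - wp1 q zeta6" by simp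
  also have "\<dots> = - 2 * (y1 + y2) * (y1 - 2 * y2) ^ 2" unfolding W1 by algebra
  finally show "wp1 q omega = - 2 * (y1 + y2) * (y1 - 2 * y2) ^ 2" .
  \<comment> \<open>The product omega * omega is 1 / omega, and \<open>rho3\<close> is invariant
    under inversion, so the two \<open>wp2\<close> terms agree.\<close>
  have "wp2 q (omega * omega) = wp2 q omega"
  proof -
    have "rho3 (1 / omega) = rho3 omega"
      unfolding rho3_def using zeta6_neq by (simp add: divide_simps) algebra
    then show ?thesis unfolding wp2_def o2 by simp
  qed
  then show "wp2 q omega = - 6 * y2 * wp1 q omega"
    using doo(2) unfolding o2 sym y2_def[symmetric] by (simp add: mult.assoc)
qed

text \<open>The elementary terms in w are constant in q, so q d/dq gives
  \<open>theta_qderiv1\<close> and minus \<open>theta_qderiv2\<close>, which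
  \<open>heat_deriv\<close> expresses through w-derivatives.\<close>

lemma DERIV_unit_q:
  assumes w: "norm w = 1" "w \<noteq> 1"
  shows "((\<lambda>q. theta_logderiv q w) has_field_derivative
      (- theta_logderiv q w * wp q w - wp1 q w / 2) / q) (at q)"
    and "((\<lambda>q. wp q w) has_field_derivative
      (- (wp q w ^ 2) + theta_logderiv q w * wp1 q w + wp2 q w / 2) / q) (at q)"
proof -
  have wa: "w \<in> annulus q" using w q by (auto intro: annulus_unit)
  have n: "norm (q * w) < 1" "norm (q * (1 / w)) < 1" using w q by (auto simp: norm_mult norm_divide)
  note i = DERIV_lambert_sum_q[OF rho_holomorphic(1) rho_0(1) q(1) n(1) q(2) rho_deriv(1), of 0]
     DERIV_lambert_sum_q[OF rho_holomorphic(1) rho_0(1) q(1) n(2) q(2) rho_deriv(1), of 0]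
     DERIV_lambert_sum_q[OF rho_holomorphic(2) rho_0(2) q(1) n(1) q(2) rho_deriv(2), of 0]
     DERIV_lambert_sum_q[OF rho_holomorphic(2) rho_0(2) q(1) n(2) q(2) rho_deriv(2), of 0]
  have "((\<lambda>q. theta_logderiv q w) has_field_derivative theta_qderiv1 q w / q) (at q)"
    using DERIV_add[OF DERIV_const DERIV_diff[OF i(2) i(1)], of "(w + 1) / (2 * (w - 1))"]
    unfolding theta_logderiv_def theta_qderiv1_def by (simp add: diff_divide_distrib)
  then show "((\<lambda>q. theta_logderiv q w) has_field_derivative
      (- theta_logderiv q w * wp q w - wp1 q w / 2) / q) (at q)"
    unfolding heat_deriv[OF q wa w(2)] .
  have "((\<lambda>q. wp q w) has_field_derivative - theta_qderiv2 q w / q) (at q)"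
    using DERIV_add[OF DERIV_const DERIV_add[OF i(3) i(4)], of "rho1 w"]
    unfolding wp_def theta_qderiv2_def by (simp add: add_divide_distrib add.commute)
  then show "((\<lambda>q. wp q w) has_field_derivative
      (- (wp q w ^ 2) + theta_logderiv q w * wp1 q w + wp2 q w / 2) / q) (at q)"
    unfolding heat_deriv[OF q wa w(2)] by (rule DERIV_cong) (simp add: algebra_simps)
qed

end

lemma torsion_system:
  fixes q :: complex
  assumes q: "norm q < 1" "q \<noteq> 0"
  defines "y1 \<equiv> theta_logderiv q zeta6" and "y2 \<equiv> theta_logderiv q omega" and "k \<equiv> eis_const q"
  shows "((\<lambda>q. theta_logderiv q zeta6) has_field_derivative
      y1 * (y1 ^ 2 - y1 * y2 - 5 * y2 ^ 2 + k / 3) / q) (at q)"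
    and "((\<lambda>q. theta_logderiv q omega) has_field_derivative
      (k * y2 / 3 + y1 ^ 3 - 3 * y1 ^ 2 * y2 + y2 ^ 3) / q) (at q)"
    and "(eis_const has_field_derivative
      (k ^ 2 / 3 + 6 * y1 ^ 3 * y2 - 18 * y1 ^ 2 * y2 ^ 2 - 3 * y2 ^ 4) / q) (at q)"
proof -
  note t = torsion_values[OF q, folded y1_def y2_def k_def]
  have a1: "- y1 * wp q zeta6 - wp1 q zeta6 / 2 = y1 * (y1 ^ 2 - y1 * y2 - 5 * y2 ^ 2 + k / 3)"
    unfolding t by (simp add: field_simps power2_eq_square)
  have a2: "- y2 * wp q omega - wp1 q omega / 2 = k * y2 / 3 + y1 ^ 3 - 3 * y1 ^ 2 * y2 + y2 ^ 3"
    unfolding t by (simp add: field_simps power2_eq_square power3_eq_cube)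
  have a3: "18 * y2 * (k * y2 / 3 + y1 ^ 3 - 3 * y1 ^ 2 * y2 + y2 ^ 3) -
     3 * (- (wp q omega ^ 2) + y2 * wp1 q omega + wp2 q omega / 2) =
     k ^ 2 / 3 + 6 * y1 ^ 3 * y2 - 18 * y1 ^ 2 * y2 ^ 2 - 3 * y2 ^ 4"
    unfolding t by (simp add: field_simps power2_eq_square power3_eq_cube power4_eq_xxxx)
  show "((\<lambda>q. theta_logderiv q zeta6) has_field_derivative
      y1 * (y1 ^ 2 - y1 * y2 - 5 * y2 ^ 2 + k / 3) / q) (at q)"
    using DERIV_unit_q(1)[OF q norm_zeta6 zeta6_neq(2)] unfolding y1_def[symmetric] a1 .
  show d2: "((\<lambda>q. theta_logderiv q omega) has_field_derivative
      (k * y2 / 3 + y1 ^ 3 - 3 * y1 ^ 2 * y2 + y2 ^ 3) / q) (at q)"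
    using DERIV_unit_q(1)[OF q norm_omega zeta6_neq(4)] unfolding y2_def[symmetric] a2 .
  define A where "A = ball (0::complex) 1 - {0}"
  \<comment> \<open>Near q, \<open>eis_const\<close> equals 9 y2^2 - 3 wp(omega) by
    \<open>torsion_values\<close>, so its derivative follows from those of y2 and wp(omega).\<close>
  have "((\<lambda>q. 9 * theta_logderiv q omega ^ 2) has_field_derivative 18 * y2 * d) (at q)"
    if "((\<lambda>q. theta_logderiv q omega) has_field_derivative d) (at q)" for d
    using DERIV_cmult[OF DERIV_power[OF that, of 2], of 9] unfolding y2_def by (simp add: mult_ac)
  from DERIV_diff[OF this[OF d2] DERIV_cmult[OF DERIV_unit_q(2)[OF q norm_omega zeta6_neq(4)], of 3]]
  have "((\<lambda>q. 9 * theta_logderiv q omega ^ 2 - 3 * wp q omega) has_field_derivative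
     18 * y2 * ((k * y2 / 3 + y1 ^ 3 - 3 * y1 ^ 2 * y2 + y2 ^ 3) / q) -
     3 * ((- (wp q omega ^ 2) + y2 * wp1 q omega + wp2 q omega / 2) / q)) (at q)"
    unfolding y2_def .
  also have "18 * y2 * ((k * y2 / 3 + y1 ^ 3 - 3 * y1 ^ 2 * y2 + y2 ^ 3) / q) -
     3 * ((- (wp q omega ^ 2) + y2 * wp1 q omega + wp2 q omega / 2) / q) =
     (k ^ 2 / 3 + 6 * y1 ^ 3 * y2 - 18 * y1 ^ 2 * y2 ^ 2 - 3 * y2 ^ 4) / q"
    unfolding a3[symmetric] by (simp add: diff_divide_distrib)
  finally show "(eis_const has_field_derivative
      (k ^ 2 / 3 + 6 * y1 ^ 3 * y2 - 18 * y1 ^ 2 * y2 ^ 2 - 3 * y2 ^ 4) / q) (at q)"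
  proof (rule has_field_derivative_transform_within_open[where S=A])
    show "open A" unfolding A_def by (rule open_delete) simp
    show "q \<in> A" using q by (simp add: A_def)
    show "9 * theta_logderiv x omega ^ 2 - 3 * wp x omega = eis_const x" if "x \<in> A" for x
      using torsion_values(2)[of x] that by (simp add: A_def)
  qed
qed

section \<open>The triple product\<close>

definition qpoch :: "complex \<Rightarrow> complex \<Rightarrow> complex" where
  "qpoch x p = (\<Prod>n. 1 - x * p ^ n)"

lemma qpoch_convergent:
  assumes "norm p < 1"
  shows "convergent_prod (\<lambda>n. 1 - x * p ^ n :: complex)"
proof (rule abs_convergent_prod_imp_convergent_prod)
  have "summable (\<lambda>n. norm x * norm p ^ n)" using assms by (intro summable_mult summable_geometric) auto
  then show "abs_convergent_prod (\<lambda>n. 1 - x * p ^ n)"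
    by (simp add: abs_convergent_prod_conv_summable norm_mult norm_power)
qed

lemma qpoch_has_prod:
  assumes "norm p < 1"
  shows "(\<lambda>n. 1 - x * p ^ n) has_prod qpoch x p"
  unfolding qpoch_def using qpoch_convergent[OF assms] by (rule convergent_prod_has_prod)

lemma qpoch_tendsto:
  assumes "norm p < 1"
  shows "(\<lambda>n. \<Prod>k<n. 1 - x * p ^ k) \<longlonglongrightarrow> qpoch x p"
  using has_prod_imp_tendsto'[OF qpoch_has_prod[OF assms]] .

lemma qpoch_nonzero:
  assumes "norm p < 1" "norm x < 1"
  shows "qpoch x p \<noteq> 0"
proof -
  have "norm (x * p ^ n) < 1" for n
  proof -
    have "norm (x * p ^ n) \<le> norm x * 1"
      unfolding norm_mult norm_power using assms by (intro mult_left_mono power_le_one) auto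
    then show ?thesis using assms by simp
  qed
  then have "1 - x * p ^ n \<noteq> 0" for n by (metis eq_iff_diff_eq_0 norm_one order_less_irrefl)
  then show ?thesis unfolding qpoch_def by (intro prodinf_nonzero qpoch_convergent assms) 
qed

lemma qpoch_0_step:
  assumes "norm p < 1"
  shows "qpoch x p = (1 - x) * qpoch (x * p) p"
proof (rule LIMSEQ_unique[OF LIMSEQ_Suc[OF qpoch_tendsto[OF assms]]])
  have "(\<Prod>k<Suc n. 1 - x * p ^ k) = (1 - x) * (\<Prod>k<n. 1 - x * p * p ^ k)" for n
    by (subst prod.lessThan_Suc_shift) (simp add: mult_ac)
  then show "(\<lambda>n. \<Prod>k<Suc n. 1 - x * p ^ k) \<longlonglongrightarrow> (1 - x) * qpoch (x * p) p"
    by (simp only:) (intro tendsto_intros qpoch_tendsto assms)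
qed

lemma qpoch_split2:
  assumes "norm p < 1"
  shows "qpoch x p = qpoch x (p ^ 2) * qpoch (x * p) (p ^ 2)"
proof (rule LIMSEQ_unique)
  have p2: "norm (p ^ 2) < 1" using assms by (simp add: norm_power power_less_one_iff)
  have "(\<Prod>k<2*n. 1 - x * p ^ k) = (\<Prod>k<n. 1 - x * (p ^ 2) ^ k) * (\<Prod>k<n. 1 - x * p * (p ^ 2) ^ k)" for n
    by (induction n) (simp_all add: power_mult[symmetric] mult_ac)
  then show "(\<lambda>n. \<Prod>k<2*n. 1 - x * p ^ k) \<longlonglongrightarrow> qpoch x (p ^ 2) * qpoch (x * p) (p ^ 2)"
    by (simp only:) (intro tendsto_intros qpoch_tendsto p2)
  show "(\<lambda>n. \<Prod>k<2*n. 1 - x * p ^ k) \<longlonglongrightarrow> qpoch x p"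
    using LIMSEQ_subseq_LIMSEQ[OF qpoch_tendsto[OF assms, of x], of "\<lambda>n. 2 * n"]
    by (simp add: strict_mono_def o_def)
qed

lemma qpoch_split3:
  assumes "norm p < 1"
  shows "qpoch x p = qpoch x (p ^ 3) * qpoch (x * p) (p ^ 3) * qpoch (x * p ^ 2) (p ^ 3)"
proof (rule LIMSEQ_unique)
  have p3: "norm (p ^ 3) < 1" using assms by (simp add: norm_power power_less_one_iff)
  have "(\<Prod>k<3*n. 1 - x * p ^ k) = (\<Prod>k<n. 1 - x * (p ^ 3) ^ k) * (\<Prod>k<n. 1 - x * p * (p ^ 3) ^ k)
      * (\<Prod>k<n. 1 - x * p ^ 2 * (p ^ 3) ^ k)" for n
  proof (induction n)
    case (Suc n)
    have *: "3 * Suc n = Suc (Suc (Suc (3 * n)))" by simp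
    have "(\<Prod>k<3*Suc n. 1 - x * p ^ k) = (\<Prod>k<3*n. 1 - x * p ^ k) * (1 - x * p ^ (3*n)) *
        (1 - x * p ^ Suc (3*n)) * (1 - x * p ^ Suc (Suc (3*n)))"
      unfolding * by simp
    then show ?case unfolding Suc by (simp add: power_mult[symmetric] power2_eq_square mult_ac)
  qed simp
  then show "(\<lambda>n. \<Prod>k<3*n. 1 - x * p ^ k) \<longlonglongrightarrow> 
      qpoch x (p ^ 3) * qpoch (x * p) (p ^ 3) * qpoch (x * p ^ 2) (p ^ 3)"
    by (simp only:) (intro tendsto_intros qpoch_tendsto p3)
  show "(\<lambda>n. \<Prod>k<3*n. 1 - x * p ^ k) \<longlonglongrightarrow> qpoch x p"
    using LIMSEQ_subseq_LIMSEQ[OF qpoch_tendsto[OF assms, of x], of "\<lambda>n. 3 * n"]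
    by (simp add: strict_mono_def o_def)
qed

lemma qpoch_square:
  assumes "norm p < 1"
  shows "qpoch (x ^ 2) (p ^ 2) = qpoch x p * qpoch (- x) p"
proof -
  have "(1 - x * p ^ n) * (1 - (- x) * p ^ n) = 1 - x ^ 2 * (p ^ 2) ^ n" for n
    by (simp add: algebra_simps power2_eq_square power_mult_distrib)
  then show ?thesis
    using prodinf_mult[OF qpoch_convergent[OF assms, of x] qpoch_convergent[OF assms, of "- x"]]
    unfolding qpoch_def by simp
qed

lemma qpoch_cube:
  assumes "norm p < 1" and w: "1 + w + w ^ 2 = 0"
  shows "qpoch (x ^ 3) (p ^ 3) = qpoch x p * (qpoch (w * x) p * qpoch (w ^ 2 * x) p)"
proof -
  have "(1 - x * p ^ n) * ((1 - w * x * p ^ n) * (1 - w ^ 2 * x * p ^ n)) = 1 - x ^ 3 * (p ^ 3) ^ n" for n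
  proof -
    have "(1 - a) * ((1 - w * a) * (1 - w ^ 2 * a)) = 1 - a ^ 3" for a
      using w by algebra
    from this[of "x * p ^ n"] show ?thesis by (simp add: power_mult_distrib power_commutes mult_ac flip: power_mult)
  qed
  moreover have "qpoch (w * x) p * qpoch (w ^ 2 * x) p = (\<Prod>n. (1 - w * x * p ^ n) * (1 - w ^ 2 * x * p ^ n))"
    unfolding qpoch_def by (intro prodinf_mult qpoch_convergent assms)
  moreover have "qpoch x p * (\<Prod>n. (1 - w * x * p ^ n) * (1 - w ^ 2 * x * p ^ n)) =
     (\<Prod>n. (1 - x * p ^ n) * ((1 - w * x * p ^ n) * (1 - w ^ 2 * x * p ^ n)))"
    unfolding qpoch_def by (intro prodinf_mult convergent_prod_mult qpoch_convergent assms)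
  ultimately show ?thesis by (simp add: qpoch_def)
qed

section \<open>Gaussian binomials and Jacobi's triple product\<close>

definition qfact :: "complex \<Rightarrow> nat \<Rightarrow> complex" where
  "qfact p n = (\<Prod>k<n. 1 - p * p ^ k)"

text \<open>The Gaussian binomial coefficient of \<open>2 N\<close> over \<open>N + j\<close> in base \<open>p\<close>.\<close>

definition jtp_coeff :: "complex \<Rightarrow> nat \<Rightarrow> int \<Rightarrow> complex" where
  "jtp_coeff p N j = (if \<bar>j\<bar> \<le> int N then
     qfact p (2 * N) / (qfact p (nat (int N + j)) * qfact p (nat (int N - j))) else 0)"

text \<open>\<open>j * (j - 1)\<close> is even for every integer j, so \<open>div 2\<close> is
  exact, also for negative j.\<close>

definition jtp_term :: "complex \<Rightarrow> complex \<Rightarrow> int \<Rightarrow> complex" where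
  "jtp_term p w j = (- 1) powi j * p powi (j * (j - 1) div 2) * w powi j"

lemma qfact_Suc: "qfact p (Suc n) = qfact p n * (1 - p ^ Suc n)"
  by (simp add: qfact_def)

lemma qfact_nonzero:
  assumes "norm p < 1"
  shows "qfact p n \<noteq> 0"
proof -
  have "p * p ^ k \<noteq> 1" for k
  proof
    assume "p * p ^ k = 1"
    then have "norm p ^ Suc k = 1" by (metis norm_one norm_power power_Suc)
    then show False using assms by (metis norm_ge_zero power_less_one_iff less_irrefl zero_less_Suc)
  qed
  then show ?thesis by (auto simp: qfact_def)
qed

text \<open>Comparing coefficients in the step from N to N + 1 of
  \<open>finite_triple_product\<close> gives this recurrence. The value 0 outside |j| <= N lets it
  hold for every integer j.\<close>

lemma jtp_coeff_rec:
  assumes p: "norm p < 1" "p \<noteq> 0"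
  shows "jtp_coeff p (Suc N) j =
     (1 + p ^ (2 * N + 1)) * jtp_coeff p N j
     + p powi (int N + 1 - j) * jtp_coeff p N (j - 1) + p powi (int N + 1 + j) * jtp_coeff p N (j + 1)"
proof -
  note nz = qfact_nonzero[OF p(1)]
  have nz2: "1 - p ^ Suc n \<noteq> 0" for n using nz[of "Suc n"] by (simp add: qfact_Suc)
  consider "\<bar>j\<bar> > int N + 1" | "j = int N + 1" | "j = - (int N + 1)" | "\<bar>j\<bar> \<le> int N" by linarith
  then show ?thesis
  proof cases
    case 1
    then have "\<not> \<bar>j\<bar> \<le> int N" "\<not> \<bar>j\<bar> \<le> int (Suc N)" "\<not> \<bar>j - 1\<bar> \<le> int N" "\<not> \<bar>j + 1\<bar> \<le> int N"
      by linarith+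
    then show ?thesis by (simp add: jtp_coeff_def)
  next
    case 2
    have "nat (int N + 1 + (int N + 1)) = 2 * Suc N" "nat (int N + int N) = 2 * N" by auto
    then show ?thesis using nz 2 by (simp add: jtp_coeff_def qfact_def[of p 0])
  next
    case 3
    have "nat (int N + 1 + (int N + 1)) = 2 * Suc N" "nat (int N + int N) = 2 * N"  by auto
    then show ?thesis using nz 3 by (simp add: jtp_coeff_def qfact_def[of p 0])
  next
    case 4
    define a b where "a = nat (int N + j)" and "b = nat (int N - j)"
    have j: "j = int a - int N" "2 * N = a + b" "int N = int a - j" "int N = int b + j" using 4 by (auto simp: a_def b_def)
    define X where "X = qfact p (2 * N) / (qfact p (Suc a) * qfact p (Suc b))"
    have frac: "z / (x * y) = z / (x * u * (y * v)) * u * v" if "u \<noteq> 0" "v \<noteq> 0" "x \<noteq> 0" "y \<noteq> 0"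
      for x y z u v :: complex using that by simp
    have c0: "jtp_coeff p N j = X * (1 - p ^ Suc a) * (1 - p ^ Suc b)"
      using 4 nz nz2 unfolding jtp_coeff_def X_def a_def[symmetric] b_def[symmetric] qfact_Suc
      by (simp only: if_True) (rule frac[OF nz2 nz2 nz nz])
    have cS: "jtp_coeff p (Suc N) j = X * (1 - p ^ (2 * N + 1)) * (1 - p ^ (2 * N + 2))"
    proof -
      have "nat (int (Suc N) + j) = Suc a" "nat (int (Suc N) - j) = Suc b" "2 * Suc N = Suc (Suc (2 * N))" using 4 by (auto simp: a_def b_def)
      then show ?thesis using 4 unfolding jtp_coeff_def X_def by (simp add: qfact_Suc)
    qed
    have c1: "jtp_coeff p N (j + 1) = X * (1 - p ^ Suc b) * (1 - p ^ b)"
    proof (cases "b = 0")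
      case True
      then have "j = int N" using j by simp
      then show ?thesis using True by (simp add: jtp_coeff_def)
    next
      case False
      then obtain b' where b': "b = Suc b'" by (cases b) auto
      have "nat (int N + (j + 1)) = Suc a" "nat (int N - (j + 1)) = b'" "\<bar>j + 1\<bar> \<le> int N" using 4 b' by (auto simp: a_def b_def)
      then have "jtp_coeff p N (j + 1) = qfact p (2 * N) / (qfact p (Suc a) * qfact p b')"
        by (simp add: jtp_coeff_def)
      also have "\<dots> = X * 1 * ((1 - p ^ Suc b') * (1 - p ^ Suc (Suc b')))"
        unfolding X_def b' qfact_Suc[of p "Suc b'"] qfact_Suc[of p b'] mult.assoc[of "qfact p b'"]
        using frac[of 1 "(1 - p ^ Suc b') * (1 - p ^ Suc (Suc b'))" "qfact p (Suc a)" "qfact p b'"] nz nz2[of b'] nz2[of "Suc b'"] by simp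
      finally show ?thesis unfolding b' by simp
    qed
    have c2: "jtp_coeff p N (j - 1) = X * (1 - p ^ Suc a) * (1 - p ^ a)"
    proof (cases "a = 0")
      case True
      then have "j = - int N" using j by simp
      then show ?thesis using True by (simp add: jtp_coeff_def)
    next
      case False
      then obtain a' where a': "a = Suc a'" by (cases a) auto
      have "nat (int N - (j - 1)) = Suc b" "nat (int N + (j - 1)) = a'" "\<bar>j - 1\<bar> \<le> int N" using 4 a' by (auto simp: a_def b_def)
      then have "jtp_coeff p N (j - 1) = qfact p (2 * N) / (qfact p a' * qfact p (Suc b))"
        by (simp add: jtp_coeff_def)
      also have "\<dots> = X * ((1 - p ^ Suc a') * (1 - p ^ Suc (Suc a'))) * 1"
        unfolding X_def a' qfact_Suc[of p "Suc a'"] qfact_Suc[of p a'] mult.assoc[of "qfact p a'"]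
        using frac[of "(1 - p ^ Suc a') * (1 - p ^ Suc (Suc a'))" 1 "qfact p a'" "qfact p (Suc b)"] nz nz2[of a'] nz2[of "Suc a'"] by simp
      finally show ?thesis unfolding a' by simp
    qed
    have e: "p powi (int N + 1 - j) = p ^ Suc b" "p powi (int N + 1 + j) = p ^ Suc a"
    proof -
      have "int N + 1 - j = int (Suc b)" "int N + 1 + j = int (Suc a)" using 4 by (auto simp: a_def b_def)
      then show "p powi (int N + 1 - j) = p ^ Suc b" "p powi (int N + 1 + j) = p ^ Suc a"
        by (simp_all only: power_int_of_nat)
    qed
    have f: "p ^ (2 * N + 1) = p * p ^ a * p ^ b" "p ^ (2 * N + 2) = p * p * p ^ a * p ^ b"
      unfolding j(2) by (simp_all add: power_add power2_eq_square)
    show ?thesis unfolding c0 c1 c2 cS e f power_Suc by (simp add: algebra_simps)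
  qed
qed


lemma triangular_shift: "(j + 1) * (j + 1 - 1) div 2 = j * (j - 1) div 2 + (j :: int)"
proof -
  have "(j + 1) * (j + 1 - 1) = j * (j - 1) + j * 2" by (simp add: algebra_simps)
  then show ?thesis by simp
qed

lemma jtp_term_Suc:
  assumes "p \<noteq> 0" "w \<noteq> 0"
  shows "jtp_term p w (j + 1) = - jtp_term p w j * p powi j * w"
  unfolding jtp_term_def triangular_shift using assms by (simp add: power_int_add mult_ac)

text \<open>The two new factors multiply to 1 + p^(2N+1) - p^N w - p^(N+1) / w, so the terms at j, j
  - 1 and j + 1 combine as in \<open>jtp_coeff_rec\<close>. Summing over all integers makes the
  shifts mere reindexings by bijections.\<close>

lemma finite_triple_product:
  assumes p: "norm p < 1" "p \<noteq> 0" and w: "w \<noteq> 0"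
  shows "((\<lambda>j. jtp_coeff p N j * jtp_term p w j) has_sum
     (\<Prod>k<N. (1 - w * p ^ k) * (1 - p / w * p ^ k))) UNIV"
proof (induction N)
  case 0
  have "((\<lambda>j. jtp_coeff p 0 j * jtp_term p w j) has_sum (\<Sum>j\<in>{0}. jtp_coeff p 0 j * jtp_term p w j)) UNIV"
    by (rule has_sum_finite_neutralI[where B="{0}"]) (auto simp: jtp_coeff_def)
  then show ?case by (simp add: jtp_coeff_def jtp_term_def qfact_def)
next
  case (Suc N)
  define c t where "c = jtp_coeff p N" and "t = jtp_term p w"
  define P where "P = (\<Prod>k<N. (1 - w * p ^ k) * (1 - p / w * p ^ k))"
  have IH: "((\<lambda>j. c j * t j) has_sum P) UNIV" using Suc by (simp add: c_def t_def P_def)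
  have b1: "bij_betw (\<lambda>j::int. j - 1) UNIV UNIV" by (rule bij_betwI[where g="\<lambda>j. j + 1"]) auto
  have b2: "bij_betw (\<lambda>j::int. j + 1) UNIV UNIV" by (rule bij_betwI[where g="\<lambda>j. j - 1"]) auto
  have 1: "((\<lambda>j. c (j - 1) * t (j - 1)) has_sum P) UNIV"
    using has_sum_reindex_bij_betw[OF b1, of "\<lambda>j. c j * t j"] IH by simp
  have 2: "((\<lambda>j. c (j + 1) * t (j + 1)) has_sum P) UNIV"
    using has_sum_reindex_bij_betw[OF b2, of "\<lambda>j. c j * t j"] IH by simp
  have "((\<lambda>j. (1 + p ^ (2 * N + 1)) * (c j * t j) + (- (p ^ N * w)) * (c (j - 1) * t (j - 1))
       + (- (p ^ (N + 1) / w)) * (c (j + 1) * t (j + 1))) has_sum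
      ((1 + p ^ (2 * N + 1)) * P + (- (p ^ N * w)) * P + (- (p ^ (N + 1) / w)) * P)) UNIV"
    by (intro has_sum_add has_sum_cmult_right IH 1 2)
  moreover have "(1 + p ^ (2 * N + 1)) * P + (- (p ^ N * w)) * P + (- (p ^ (N + 1) / w)) * P =
      (\<Prod>k<Suc N. (1 - w * p ^ k) * (1 - p / w * p ^ k))"
  proof -
    have "(1 - w * p ^ N) * (1 - p / w * p ^ N) = 1 + p ^ (2 * N + 1) - p ^ N * w - p ^ (N + 1) / w"
      using w by (simp add: field_simps power_add mult_2_right)
    then show ?thesis unfolding P_def by (simp add: algebra_simps)
  qed
  moreover have "(1 + p ^ (2 * N + 1)) * (c j * t j) + (- (p ^ N * w)) * (c (j - 1) * t (j - 1))
       + (- (p ^ (N + 1) / w)) * (c (j + 1) * t (j + 1)) = jtp_coeff p (Suc N) j * t j" for j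
  proof -
    have t1: "t (j + 1) = - t j * p powi j * w"
      using jtp_term_Suc[OF p(2) w, of j] by (simp add: t_def)
    have t2: "t j = - t (j - 1) * p powi (j - 1) * w"
      using jtp_term_Suc[OF p(2) w, of "j - 1"] by (simp add: t_def)
    have e1: "p powi (int N + 1 - j) * p powi (j - 1) = p ^ N"
      using p by (simp flip: power_int_add)
    have e2: "p powi (int N + 1 + j) = p ^ (N + 1) * p powi j"
      using p by (simp add: power_int_add)
    have "p powi (int N + 1 - j) * t j = - (p ^ N * w) * t (j - 1)"
      unfolding t2 e1[symmetric] by (simp add: mult_ac)
    moreover have "p powi (int N + 1 + j) * t j = - (p ^ (N + 1) / w) * t (j + 1)"
      unfolding t1 e2 using w by simp
    moreover have "(A * c0 + B * c1 + D * c2) * x = A * (c0 * x) + B' * (c1 * x1) + D' * (c2 * x2)"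
      if "B * x = B' * x1" "D * x = D' * x2" for A B D B' D' c0 c1 c2 x x1 x2 :: complex
    proof -
      have "(A * c0 + B * c1 + D * c2) * x = A * (c0 * x) + c1 * (B * x) + c2 * (D * x)"
        by (simp add: algebra_simps)
      then show ?thesis unfolding that by (simp add: algebra_simps)
    qed
    ultimately show ?thesis
      unfolding jtp_coeff_rec[OF p] c_def by metis
  qed
  ultimately show ?case by (simp add: t_def)
qed

text \<open>The ratio of consecutive terms is - p^j w, which tends to 0 as j grows; negative indices
  reduce to this because j -> - j replaces w by p / w.\<close>

lemma jtp_term_abs_summable:
  assumes p: "norm p < 1" "p \<noteq> 0" and w: "w \<noteq> 0"
  shows "(\<lambda>j. norm (jtp_term p w j)) summable_on UNIV"
proof -
  have nat_part: "summable (\<lambda>n. norm (jtp_term p v (int n)))" if "v \<noteq> 0" for v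
  proof -
    have "(\<lambda>n. norm p ^ n * norm v) \<longlonglongrightarrow> 0 * norm v"
      using p by (intro tendsto_mult LIMSEQ_power_zero tendsto_const) auto
    then have "\<forall>\<^sub>F n in sequentially. norm p ^ n * norm v < 1/2" by (intro order_tendstoD(2)) auto
    then obtain N where N: "\<And>n. n \<ge> N \<Longrightarrow> norm p ^ n * norm v < 1/2"
      unfolding eventually_sequentially by blast
    show ?thesis
    proof (rule summable_ratio_test[where c="1/2" and N=N])
      fix n assume "n \<ge> N"
      have "norm (jtp_term p v (int (Suc n))) = norm (jtp_term p v (int n)) * (norm p ^ n * norm v)"
        using jtp_term_Suc[OF p(2) that, of "int n"] by (simp add: norm_mult norm_power add.commute)
      also have "\<dots> \<le> norm (jtp_term p v (int n)) * (1 / 2)"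
        using N[OF \<open>n \<ge> N\<close>] by (intro mult_left_mono) auto
      finally show "norm (norm (jtp_term p v (int (Suc n)))) \<le> 1 / 2 * norm (norm (jtp_term p v (int n)))"
        by simp
    qed simp
  qed
  have refl: "jtp_term p w (- int n) = jtp_term p (p / w) (int n)" for n
  proof -
    have "- int n * (- int n - 1) = int n * (int n - 1) + int n * 2" by (simp add: algebra_simps)
    then have "- int n * (- int n - 1) div 2 = int n * (int n - 1) div 2 + int n" by simp
    then show ?thesis unfolding jtp_term_def
      using p w by (simp only:) (simp add: power_int_add power_int_minus power_divide field_simps flip: power_mult_distrib)
  qed
  have "(\<lambda>j. norm (jtp_term p w j)) summable_on (range int)"
    using norm_summable_imp_summable_on[of "\<lambda>n. norm (jtp_term p w (int n))"] nat_part[OF w]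
    by (subst summable_on_reindex) (auto simp: o_def)
  moreover have "(\<lambda>j. norm (jtp_term p w j)) summable_on (range (\<lambda>n. - int n))"
    using norm_summable_imp_summable_on[of "\<lambda>n. norm (jtp_term p (p / w) (int n))"] nat_part[of "p / w"] p w
    by (subst summable_on_reindex) (auto simp: o_def refl inj_on_def)
  ultimately have "(\<lambda>j. norm (jtp_term p w j)) summable_on (range int \<union> range (\<lambda>n. - int n))"
    by (rule summable_on_union)
  moreover have "range int \<union> range (\<lambda>n. - int n) = UNIV"
    by (auto intro: int_cases2)
  ultimately show ?thesis by simp
qed

lemma jtp_coeff_tendsto:
  assumes p: "norm p < 1"
  shows "(\<lambda>N. jtp_coeff p N j) \<longlonglongrightarrow> 1 / qpoch p p"
proof -
  have nz: "qpoch p p \<noteq> 0" using qpoch_nonzero p by blast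
  have E: "qfact p \<longlonglongrightarrow> qpoch p p"
    unfolding qfact_def[abs_def] by (rule qpoch_tendsto[OF p])
  have f: "filterlim (\<lambda>N. nat (int N + i)) at_top at_top" for i
    unfolding filterlim_at_top
  proof
    fix Z show "\<forall>\<^sub>F x in sequentially. Z \<le> nat (int x + i)"
      using eventually_ge_at_top[of "Z + nat \<bar>i\<bar>"] by eventually_elim linarith
  qed
  have f2: "filterlim (\<lambda>N::nat. 2 * N) at_top at_top"
    by (rule filterlim_subseq) (simp add: strict_mono_def)
  have "(\<lambda>N. qfact p (2 * N) / (qfact p (nat (int N + j)) * qfact p (nat (int N + (- j)))))
     \<longlonglongrightarrow> qpoch p p / (qpoch p p * qpoch p p)"
    by (intro tendsto_intros filterlim_compose[OF E f] filterlim_compose[OF E f2]) (use nz in auto)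
  moreover have "\<forall>\<^sub>F N in sequentially. qfact p (2 * N) / (qfact p (nat (int N + j)) * qfact p (nat (int N + (- j)))) = jtp_coeff p N j"
    using eventually_ge_at_top[of "nat \<bar>j\<bar>"] by eventually_elim (simp add: jtp_coeff_def)
  ultimately have "(\<lambda>N. jtp_coeff p N j) \<longlonglongrightarrow> qpoch p p / (qpoch p p * qpoch p p)"
    by (rule Lim_transform_eventually)
  then show ?thesis using nz by simp
qed

text \<open>\<open>qfact\<close> and its inverse both converge, hence are bounded; uniformity in N
  and j supplies the dominating constant for Tannery's theorem.\<close>

lemma jtp_coeff_bounded:
  assumes p: "norm p < 1"
  obtains K where "\<And>N j. norm (jtp_coeff p N j) \<le> K"
proof -
  have nz: "qpoch p p \<noteq> 0" using qpoch_nonzero p by blast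
  have E: "qfact p \<longlonglongrightarrow> qpoch p p"
    unfolding qfact_def[abs_def] by (rule qpoch_tendsto[OF p])
  obtain K1 where K1: "\<And>n. norm (qfact p n) \<le> K1"
    using convergent_imp_Bseq[OF convergentI[OF E]] unfolding Bseq_def by blast
  have "(\<lambda>n. inverse (qfact p n)) \<longlonglongrightarrow> inverse (qpoch p p)" by (intro tendsto_inverse E nz)
  from convergent_imp_Bseq[OF convergentI[OF this]]
  obtain K2 where K2: "\<And>n. norm (inverse (qfact p n)) \<le> K2"
    unfolding Bseq_def by blast
  have pos: "K1 \<ge> 0" "K2 \<ge> 0"
    using order_trans[OF norm_ge_zero K1[of 0]] order_trans[OF norm_ge_zero K2[of 0]] by auto
  have "norm (jtp_coeff p N j) \<le> K1 * (K2 * K2)" for N j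
  proof (cases "\<bar>j\<bar> \<le> int N")
    case True
    then have "norm (jtp_coeff p N j) = norm (qfact p (2 * N)) * (norm (inverse (qfact p (nat (int N + j)))) *
       norm (inverse (qfact p (nat (int N - j)))))"
      by (simp add: jtp_coeff_def norm_mult norm_divide norm_inverse divide_inverse)
    also have "\<dots> \<le> K1 * (K2 * K2)" by (intro mult_mono K1 K2 pos mult_nonneg_nonneg) auto
    finally show ?thesis .
  qed (use pos in \<open>auto simp: jtp_coeff_def\<close>)
  then show ?thesis using that by blast
qed

theorem jacobi_triple_product:
  assumes p: "norm p < 1" "p \<noteq> 0" and w: "w \<noteq> 0"
  shows "(jtp_term p w has_sum qpoch p p * qpoch w p * qpoch (p / w) p) UNIV"
proof -
  \<comment> \<open>Enumerating the integers by the naturals makes Tannery's theorem for ordinary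
    series applicable; absolute convergence allows the return to \<open>has_sum\<close>.\<close>
  define e where "e = int_decode"
  have e: "bij_betw e UNIV UNIV" unfolding e_def by (rule bij_int_decode)
  define t where "t k = jtp_term p w (e k)" for k
  obtain K where K: "\<And>N j. norm (jtp_coeff p N j) \<le> K" using jtp_coeff_bounded[OF p(1)] by blast
  have st: "summable (\<lambda>k. norm (t k))"
    using jtp_term_abs_summable[OF p w] summable_on_reindex_bij_betw[OF e, of "\<lambda>j. norm (jtp_term p w j)"]
    unfolding t_def by (simp add: summable_on_imp_summable)
  have lim: "(\<lambda>N. suminf (\<lambda>k. jtp_coeff p N (e k) * t k)) \<longlonglongrightarrow> suminf (\<lambda>k. 1 / qpoch p p * t k)"
  proof (rule tannerys_theorem[THEN conjunct2, THEN conjunct2])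
    show "(\<lambda>n. jtp_coeff p n (e k) * t k) \<longlonglongrightarrow> 1 / qpoch p p * t k" for k
      by (intro tendsto_intros jtp_coeff_tendsto p)
    show "\<forall>\<^sub>F (k, n) in sequentially \<times>\<^sub>F sequentially. norm (jtp_coeff p n (e k) * t k) \<le> K * norm (t k)"
      by (rule always_eventually) (auto simp: norm_mult intro!: mult_right_mono K)
    show "summable (\<lambda>k. K * norm (t k))" by (intro summable_mult st)
  qed simp
  have eq: "suminf (\<lambda>k. jtp_coeff p N (e k) * t k) = (\<Prod>k<N. (1 - w * p ^ k) * (1 - p / w * p ^ k))" for N
  proof -
    have "((\<lambda>k. jtp_coeff p N (e k) * t k) has_sum (\<Prod>k<N. (1 - w * p ^ k) * (1 - p / w * p ^ k))) UNIV"
      using has_sum_reindex_bij_betw[OF e, of "\<lambda>j. jtp_coeff p N j * jtp_term p w j"] finite_triple_product[OF p w, of N]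
      unfolding t_def by simp
    from has_sum_imp_sums[OF this] show ?thesis by (simp add: sums_iff)
  qed
  have "(\<lambda>N. \<Prod>k<N. (1 - w * p ^ k) * (1 - p / w * p ^ k)) \<longlonglongrightarrow> qpoch w p * qpoch (p / w) p"
    unfolding prod.distrib by (intro tendsto_intros qpoch_tendsto p)
  with lim[unfolded eq] have "suminf (\<lambda>k. 1 / qpoch p p * t k) = qpoch w p * qpoch (p / w) p"
    by (rule LIMSEQ_unique)
  moreover have "suminf (\<lambda>k. 1 / qpoch p p * t k) = 1 / qpoch p p * suminf t"
    by (rule suminf_mult[OF summable_norm_cancel[OF st]])
  ultimately have "suminf t = qpoch p p * qpoch w p * qpoch (p / w) p"
    using qpoch_nonzero[OF p(1) p(1)] by (simp add: field_simps)
  moreover have "(t has_sum suminf t) UNIV"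
    by (rule norm_summable_imp_has_sum[OF st summable_sums[OF summable_norm_cancel[OF st]]])
  ultimately show ?thesis
    using has_sum_reindex_bij_betw[OF e, of "jtp_term p w"] unfolding t_def by simp
qed

section \<open>The cubic theta function as a product\<close>

lemma has_sum_mult_product:
  fixes f g :: "'a \<Rightarrow> complex"
  assumes f: "(\<lambda>x. norm (f x)) summable_on UNIV" "(f has_sum a) UNIV"
    and g: "(\<lambda>x. norm (g x)) summable_on UNIV" "(g has_sum b) UNIV"
  shows "((\<lambda>(x, y). f x * g y) has_sum a * b) UNIV"
proof -
  have "(\<lambda>(x, y). norm (f x) * norm (g y)) summable_on (UNIV \<times> UNIV)"
  proof (rule summable_on_SigmaI)
    show "((\<lambda>y. case (x, y) of (x, y) \<Rightarrow> norm (f x) * norm (g y)) has_sum norm (f x) * infsum (\<lambda>y. norm (g y)) UNIV) UNIV" for x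
      using has_sum_cmult_right[OF has_sum_infsum[OF g(1)]] by simp
    show "(\<lambda>x. norm (f x) * infsum (\<lambda>y. norm (g y)) UNIV) summable_on UNIV"
      by (rule summable_on_cmult_left[OF f(1)])
  qed auto
  then have "(\<lambda>z. norm (case z of (x, y) \<Rightarrow> f x * g y)) summable_on (UNIV \<times> UNIV)"
    by (simp add: case_prod_unfold norm_mult)
  then have "(\<lambda>(x, y). f x * g y) summable_on (UNIV \<times> UNIV)"
    by (rule abs_summable_summable)
  then have "((\<lambda>(x, y). f x * g y) has_sum a * b) (UNIV \<times> UNIV)"
  proof (rule has_sum_SigmaI[rotated 2])
    show "((\<lambda>y. case (x, y) of (x, y) \<Rightarrow> f x * g y) has_sum f x * b) UNIV" for x
      using has_sum_cmult_right[OF g(2)] by simp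
    show "((\<lambda>x. f x * b) has_sum a * b) UNIV"
      by (rule has_sum_cmult_left[OF f(2)])
  qed
  then show ?thesis by simp
qed

text \<open>With x = j + k and y = j - k, x^2 + x y + y^2 becomes 3 j^2 + k^2 and x^2 + y^2 becomes
  2 j^2 + 2 k^2, so double series split into products of theta series.\<close>

lemma has_sum_parity_split:
  fixes f :: "int \<times> int \<Rightarrow> complex"
  assumes even: "((\<lambda>(j, k). f (j + k, j - k)) has_sum a) UNIV"
    and odd: "((\<lambda>(j, k). f (j + k + 1, j - k)) has_sum b) UNIV"
  shows "(f has_sum a + b) UNIV"
proof -
  let ?e = "\<lambda>(j, k). (j + k, j - k) :: int \<times> int" and ?o = "\<lambda>(j, k). (j + k + 1, j - k) :: int \<times> int"
  have "(f has_sum a) (range ?e)"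
    using even by (subst has_sum_reindex) (auto simp: inj_on_def o_def case_prod_unfold)
  moreover have "(f has_sum b) (range ?o)"
    using odd by (subst has_sum_reindex) (auto simp: inj_on_def o_def case_prod_unfold)
  moreover have "range ?e \<inter> range ?o = {}"
  proof -
    have "(j + k, j - k) \<noteq> (j' + k' + 1, j' - k' :: int)" for j k j' k' :: int by (auto; presburger)
    then show ?thesis by auto
  qed
  ultimately have "(f has_sum a + b) (range ?e \<union> range ?o)"
    by (rule has_sum_Un_disjoint)
  moreover have "range ?e \<union> range ?o = UNIV"
  proof -
    have "(x, y) \<in> range ?e \<union> range ?o" for x y :: int
    proof (cases "even (x + y)")
      case True
      then obtain j where "x + y = 2 * j" by (elim evenE)
      then have "(x, y) = ?e (j, x - j)" by auto
      then show ?thesis by blast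
    next
      case False
      then obtain j where "x + y = 2 * j + 1" by (elim oddE)
      then have "(x, y) = ?o (j, x - 1 - j)" by auto
      then show ?thesis by blast
    qed
    then show ?thesis by auto
  qed
  ultimately show ?thesis by simp
qed

definition jtp :: "complex \<Rightarrow> complex \<Rightarrow> complex" where
  "jtp p w = qpoch p p * qpoch w p * qpoch (p / w) p"

text \<open>
  Splitting by the parity of the sum of the two indices turns both the lattice sum and the double
  series for \<open>\<vartheta>(\<omega>) \<vartheta>(1/\<omega>)\<close> into a combination of the same two theta constants. The two
  coefficient vectors are proportional, with ratio the product of all \<open>(1 - Q\<^sup>3\<^sup>n) / (1 - Q\<^sup>n)\<close>.
\<close>

lemma cubic_theta_identity:
  fixes Q :: complex
  assumes Q: "norm Q < 1" "Q \<noteq> 0"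
  shows "((\<lambda>(m, n). Q powi (n\<^sup>2 + n * m + m\<^sup>2 + n + m)) has_sum 3 * qpoch (Q ^ 3) (Q ^ 3) ^ 3 / qpoch Q Q) UNIV"
proof -
  have pn: "norm (Q ^ n) < 1" if "n > 0" for n using Q that by (simp add: norm_power power_less_one_iff)
  note p2 = pn[of 2, simplified] and p3 = pn[of 3, simplified] and p6 = pn[of 6, simplified]
  have s: "(jtp_term p w has_sum jtp p w) UNIV" if "norm p < 1" "p \<noteq> 0" "w \<noteq> 0" for p w
    unfolding jtp_def by (rule jacobi_triple_product[OF that])
  have tt: "((\<lambda>(j, k). jtp_term p w j * jtp_term p' w' k) has_sum jtp p w * jtp p' w') UNIV"
    if "norm p < 1" "p \<noteq> 0" "w \<noteq> 0" "norm p' < 1" "p' \<noteq> 0" "w' \<noteq> 0" for p w p' w'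
    using that by (intro has_sum_mult_product jtp_term_abs_summable s)
  \<comment> \<open>With an even base the triangular exponent is doubled, and the division by 2
    disappears.\<close>
  have tq: "jtp_term (Q ^ (2 * a)) (c * Q ^ n) j = (- c) powi j * Q powi (int a * (j * (j - 1)) + int n * j)" for c a n j
  proof -
    have e: "int (2 * a) * (j * (j - 1) div 2) = int a * (j * (j - 1))"
    proof -
      have "j * (j - 1) div 2 * 2 = j * (j - 1)" by simp
      then show ?thesis by (simp add: mult_ac)
    qed
    have "(Q ^ (2 * a)) powi (j * (j - 1) div 2) = Q powi (int a * (j * (j - 1)))"
      unfolding power_int_of_nat[symmetric] power_int_mult[symmetric] e ..
    moreover have "(Q ^ n) powi j = Q powi (int n * j)"
      unfolding power_int_of_nat[symmetric] power_int_mult[symmetric] ..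
    moreover have "(- c) powi j = (- 1) powi j * c powi j"
      using power_int_mult_distrib[of "- 1" c j] by simp
    ultimately show ?thesis unfolding jtp_term_def power_int_mult_distrib power_int_add[OF disjI1[OF Q(2)]]
      by (simp only: mult_ac)
  qed
  have t1: "jtp_term Q c j = (- c) powi j * Q powi (j * (j - 1) div 2)" for c j
    unfolding jtp_term_def using power_int_mult_distrib[of "- 1" c j] by simp
  have w0: "- 1 \<noteq> (0::complex)" "- omega \<noteq> 0" "- (1 / omega) \<noteq> 0" using zeta6_neq by auto
  have Qn: "Q ^ n \<noteq> 0" for n using Q by simp
  \<comment> \<open>n = k + j, m = k - j turns the exponent into (3 k^2 + 2 k) + j^2, hence bases
    Q^6, Q^2 and arguments - Q^5, - Q; the odd class has 2 + (3 k^2 + 5 k) + (j^2 + j), hence - Q^8,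
    - Q^2. E2, B0, B1 arise likewise from the theta product at omega and 1 / omega.\<close>
  define A0 where "A0 = jtp (Q ^ 6) (- 1 * Q ^ 5)"
  define A1 where "A1 = jtp (Q ^ 6) (- 1 * Q ^ 8)"
  define E where "E = jtp (Q ^ 2) (- 1 * Q ^ 1)"
  define E1 where "E1 = jtp (Q ^ 2) (- 1 * Q ^ 2)"
  define E2 where "E2 = jtp (Q ^ 2) (- 1 * Q ^ 0)"
  define B0 where "B0 = jtp (Q ^ 2) (- (1 / omega) * Q ^ 1)"
  define B1 where "B1 = jtp (Q ^ 2) (- (1 / omega) * Q ^ 2)"
  have "((\<lambda>(k, j). jtp_term (Q ^ 6) (- 1 * Q ^ 5) k * jtp_term (Q ^ 2) (- 1 * Q ^ 1) j) has_sum A0 * E) UNIV"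
    unfolding A0_def E_def using p6 p2 Q by (intro tt) auto
  then have c_even: "((\<lambda>(k, j). (\<lambda>(n, m). Q powi (n\<^sup>2 + n * m + m\<^sup>2 + n + m)) (k + j, k - j)) has_sum A0 * E) UNIV"
  proof (rule has_sum_cong[THEN iffD1, rotated], clarify)
    fix k j :: int
    have "jtp_term (Q ^ 6) (- 1 * Q ^ 5) k = Q powi (3 * (k * (k - 1)) + 5 * k)"
      "jtp_term (Q ^ 2) (- 1 * Q ^ 1) j = Q powi (j * (j - 1) + j)"
      using tq[of 3 "- 1" 5 k] tq[of 1 "- 1" 1 j] by simp_all
    then have "jtp_term (Q ^ 6) (- 1 * Q ^ 5) k * jtp_term (Q ^ 2) (- 1 * Q ^ 1) j =
       Q powi (3 * (k * (k - 1)) + 5 * k + (j * (j - 1) + j))"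
      using Q by (simp only:) (simp add: power_int_add)
    also have "3 * (k * (k - 1)) + 5 * k + (j * (j - 1) + j) = (k + j)\<^sup>2 + (k + j) * (k - j) + (k - j)\<^sup>2 + (k + j) + (k - j)"
      by (simp add: power2_eq_square algebra_simps)
    finally show "jtp_term (Q ^ 6) (- 1 * Q ^ 5) k * jtp_term (Q ^ 2) (- 1 * Q ^ 1) j =
      Q powi ((k + j)\<^sup>2 + (k + j) * (k - j) + (k - j)\<^sup>2 + (k + j) + (k - j))" .
  qed
  have "((\<lambda>(k, j). jtp_term (Q ^ 6) (- 1 * Q ^ 8) k * jtp_term (Q ^ 2) (- 1 * Q ^ 2) j) has_sum A1 * E1) UNIV"
    unfolding A1_def E1_def using p6 p2 Q by (intro tt) auto
  from has_sum_cmult_right[OF this, of "Q ^ 2"]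
  have c_odd: "((\<lambda>(k, j). (\<lambda>(n, m). Q powi (n\<^sup>2 + n * m + m\<^sup>2 + n + m)) (k + j + 1, k - j)) has_sum Q ^ 2 * (A1 * E1)) UNIV"
  proof (rule has_sum_cong[THEN iffD1, rotated], clarify)
    fix k j :: int
    have "jtp_term (Q ^ 6) (- 1 * Q ^ 8) k = Q powi (3 * (k * (k - 1)) + 8 * k)"
      "jtp_term (Q ^ 2) (- 1 * Q ^ 2) j = Q powi (j * (j - 1) + 2 * j)"
      using tq[of 3 "- 1" 8 k] tq[of 1 "- 1" 2 j] by simp_all
    then have "Q ^ 2 * (jtp_term (Q ^ 6) (- 1 * Q ^ 8) k * jtp_term (Q ^ 2) (- 1 * Q ^ 2) j) =
       Q powi (2 + (3 * (k * (k - 1)) + 8 * k + (j * (j - 1) + 2 * j)))"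
      using Q by (simp only:) (simp add: power_int_add)
    also have "2 + (3 * (k * (k - 1)) + 8 * k + (j * (j - 1) + 2 * j)) =
      (k + j + 1)\<^sup>2 + (k + j + 1) * (k - j) + (k - j)\<^sup>2 + (k + j + 1) + (k - j)"
      by (simp add: power2_eq_square algebra_simps)
    finally show "Q ^ 2 * (jtp_term (Q ^ 6) (- 1 * Q ^ 8) k * jtp_term (Q ^ 2) (- 1 * Q ^ 2) j) =
      Q powi ((k + j + 1)\<^sup>2 + (k + j + 1) * (k - j) + (k - j)\<^sup>2 + (k + j + 1) + (k - j))" .
  qed
  have csum: "((\<lambda>(n, m). Q powi (n\<^sup>2 + n * m + m\<^sup>2 + n + m)) has_sum A0 * E + Q ^ 2 * (A1 * E1)) UNIV"
    by (rule has_sum_parity_split[OF c_even c_odd])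
  have Tsum: "((\<lambda>(a, b). jtp_term Q omega a * jtp_term Q (1 / omega) b) has_sum jtp Q omega * jtp Q (1 / omega)) UNIV"
    using Q zeta6_neq by (intro tt) auto
  have half: "x div 2 + y div 2 = z" if "x + y = 2 * z" "even x" for x y z :: int using that by presburger
  have evx: "even (x * (x - 1))" for x :: int by simp
  have inv: "(- (1 / omega)) powi b = (- omega) powi (- b)" for b
  proof -
    have "- (1 / omega) = inverse (- omega)" using zeta6_neq by (simp add: field_simps)
    then show ?thesis by (simp only: power_int_inverse power_int_minus)
  qed
  \<comment> \<open>The exponent of - omega in the product is a - b, which is 2 k or 1 + 2 k, so its
    even part is a power of 1 / omega.\<close>
  have sq: "(- omega) powi (2 * k) = (1 / omega) powi k" for k
  proof -
    have "(- omega) powi 2 = 1 / omega" using omega_square inverse_zeta6 by (simp add: power2_eq_square)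
    then show ?thesis by (simp only: power_int_mult)
  qed
  have tT: "jtp_term Q omega a * jtp_term Q (1 / omega) b =
      (- omega) powi (a - b) * Q powi (a * (a - 1) div 2 + b * (b - 1) div 2)" for a b
    unfolding t1 inv using Q zeta6_neq by (simp add: power_int_add power_int_diff power_int_minus divide_inverse)
  have ev: "- (- 1) = (1::complex)" "- (- (1 / omega)) = 1 / omega" by simp_all
  have "((\<lambda>(j, k). jtp_term (Q ^ 2) (- 1 * Q ^ 0) j * jtp_term (Q ^ 2) (- (1 / omega) * Q ^ 1) k) has_sum E2 * B0) UNIV"
    unfolding E2_def B0_def using p2 Q zeta6_neq by (intro tt) auto
  then have T_even: "((\<lambda>(j, k). (\<lambda>(a, b). jtp_term Q omega a * jtp_term Q (1 / omega) b) (j + k, j - k)) has_sum E2 * B0) UNIV"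
  proof (rule has_sum_cong[THEN iffD1, rotated], clarify)
    fix j k :: int
    have "(j + k) * (j + k - 1) div 2 + (j - k) * (j - k - 1) div 2 = j * (j - 1) + (k * (k - 1) + k)"
    proof -
      have d: "even ((j + k) * (j + k - 1))" "even ((j - k) * (j - k - 1))" by (rule evx)+
      have "(j + k) * (j + k - 1) + (j - k) * (j - k - 1) = 2 * (j * (j - 1) + (k * (k - 1) + k))"
        by (simp add: algebra_simps)
      then show ?thesis by (rule half[OF _ d(1)])
    qed
    moreover have "(j + k) - (j - k) = 2 * k" by simp
    ultimately have "jtp_term Q omega (j + k) * jtp_term Q (1 / omega) (j - k) =
        (1 / omega) powi k * Q powi (j * (j - 1) + (k * (k - 1) + k))"
      by (simp only: tT sq)
    moreover have "jtp_term (Q ^ 2) (- 1 * Q ^ 0) j = Q powi (j * (j - 1))"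
      using tq[of 1 "- 1" 0 j] by simp
    moreover have "jtp_term (Q ^ 2) (- (1 / omega) * Q ^ 1) k = (1 / omega) powi k * Q powi (k * (k - 1) + k)"
      using tq[of 1 "- (1 / omega)" 1 k] unfolding ev by simp
    ultimately show "jtp_term (Q ^ 2) (- 1 * Q ^ 0) j * jtp_term (Q ^ 2) (- (1 / omega) * Q ^ 1) k =
        jtp_term Q omega (j + k) * jtp_term Q (1 / omega) (j - k)"
      using Q by (simp only:) (simp add: power_int_add)
  qed
  have "((\<lambda>(j, k). jtp_term (Q ^ 2) (- 1 * Q ^ 1) j * jtp_term (Q ^ 2) (- (1 / omega) * Q ^ 2) k) has_sum E * B1) UNIV"
    unfolding E_def B1_def using p2 Q zeta6_neq by (intro tt) auto
  from has_sum_cmult_right[OF this, of "- omega"]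
  have T_odd: "((\<lambda>(j, k). (\<lambda>(a, b). jtp_term Q omega a * jtp_term Q (1 / omega) b) (j + k + 1, j - k)) has_sum - omega * (E * B1)) UNIV"
  proof (rule has_sum_cong[THEN iffD1, rotated], clarify)
    fix j k :: int
    have "(j + k + 1) * (j + k + 1 - 1) div 2 + (j - k) * (j - k - 1) div 2 = j * (j - 1) + j + (k * (k - 1) + 2 * k)"
    proof -
      have d: "even ((j + k + 1) * (j + k + 1 - 1))" "even ((j - k) * (j - k - 1))" by (rule evx)+
      have "(j + k + 1) * (j + k + 1 - 1) + (j - k) * (j - k - 1) = 2 * (j * (j - 1) + j + (k * (k - 1) + 2 * k))"
        by (simp add: algebra_simps)
      then show ?thesis by (rule half[OF _ d(1)])
    qed
    moreover have "(j + k + 1) - (j - k) = 1 + 2 * k" by simp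
    moreover have "(- omega) powi (1 + 2 * k) = - omega * (1 / omega) powi k"
      using zeta6_neq by (subst power_int_add) (simp_all add: sq)
    ultimately have "jtp_term Q omega (j + k + 1) * jtp_term Q (1 / omega) (j - k) =
        - omega * (1 / omega) powi k * Q powi (j * (j - 1) + j + (k * (k - 1) + 2 * k))"
      by (simp only: tT)
    moreover have "jtp_term (Q ^ 2) (- 1 * Q ^ 1) j = Q powi (j * (j - 1) + j)"
      using tq[of 1 "- 1" 1 j] by simp
    moreover have "jtp_term (Q ^ 2) (- (1 / omega) * Q ^ 2) k = (1 / omega) powi k * Q powi (k * (k - 1) + 2 * k)"
      using tq[of 1 "- (1 / omega)" 2 k] unfolding ev by simp
    ultimately show "- omega * (jtp_term (Q ^ 2) (- 1 * Q ^ 1) j * jtp_term (Q ^ 2) (- (1 / omega) * Q ^ 2) k) =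
        jtp_term Q omega (j + k + 1) * jtp_term Q (1 / omega) (j - k)"
      using Q by (simp only:) (simp add: power_int_add)
  qed
  have T: "jtp Q omega * jtp Q (1 / omega) = E2 * B0 - omega * (E * B1)"
    using has_sum_unique[OF Tsum has_sum_parity_split[OF T_even T_odd]] by simp
  define P1 P2 P3 P6 where "P1 = qpoch Q Q" and "P2 = qpoch (Q ^ 2) (Q ^ 2)"
    and "P3 = qpoch (Q ^ 3) (Q ^ 3)" and "P6 = qpoch (Q ^ 6) (Q ^ 6)"
  define a1 a2 a4 a5 where "a1 = qpoch (- Q) (Q ^ 6)" and "a2 = qpoch (- (Q ^ 2)) (Q ^ 6)"
    and "a4 = qpoch (- (Q ^ 4)) (Q ^ 6)" and "a5 = qpoch (- (Q ^ 5)) (Q ^ 6)"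
  define a3 a6 where "a3 = qpoch (- (Q ^ 3)) (Q ^ 6)" and "a6 = qpoch (- (Q ^ 6)) (Q ^ 6)"
  define u v where "u = qpoch (- Q) (Q ^ 2)" and "v = qpoch (- (Q ^ 2)) (Q ^ 2)"
  define r s where "r = qpoch (- (omega * Q)) (Q ^ 2) * qpoch (- (omega ^ 2 * Q)) (Q ^ 2)"
    and "s = qpoch (- (omega * Q ^ 2)) (Q ^ 2) * qpoch (- (omega ^ 2 * Q ^ 2)) (Q ^ 2)"
  have o1: "1 / omega = omega ^ 2" using omega_square inverse_zeta6 by (simp add: power2_eq_square)
  have o3: "1 + omega + omega ^ 2 = 0" using omega_square unfolding power2_eq_square by (simp add: omega_def)
  have nz: "P1 \<noteq> 0" "P2 \<noteq> 0" "P3 \<noteq> 0" "P6 \<noteq> 0" "a3 \<noteq> 0" "a6 \<noteq> 0" "v \<noteq> 0" "u \<noteq> 0"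
    unfolding P1_def P2_def P3_def P6_def a3_def a6_def v_def u_def
    using Q p2 p3 p6 by (simp_all add: qpoch_nonzero)
  have u: "u = a1 * a3 * a5" 
    unfolding u_def a1_def a3_def a5_def using qpoch_split3[OF p2, of "- Q"]
    by (simp add: power_mult[symmetric] flip: power_Suc power_add) 
  have v: "v = a2 * a4 * a6"
    unfolding v_def a2_def a4_def a6_def using qpoch_split3[OF p2, of "- (Q ^ 2)"]
    by (simp add: power_mult[symmetric] flip: power_add)
  have a36: "P6 = P3 * (a3 * a6)"
  proof -
    have "qpoch (- (Q ^ 3)) (Q ^ 3) = a3 * a6"
      unfolding a3_def a6_def using qpoch_split2[OF p3, of "- (Q ^ 3)"] by (simp add: power_mult[symmetric] flip: power_add)
    moreover have "P6 = P3 * qpoch (- (Q ^ 3)) (Q ^ 3)"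
      unfolding P6_def P3_def using qpoch_square[OF p3, of "Q ^ 3"] by (simp add: power_mult[symmetric])
    ultimately show ?thesis by simp
  qed
  have uv: "P2 = P1 * (u * v)"
  proof -
    have "qpoch (- Q) Q = u * v"
      unfolding u_def v_def using qpoch_split2[OF Q(1), of "- Q"] by (simp add: power2_eq_square)
    then show ?thesis unfolding P2_def P1_def using qpoch_square[OF Q(1), of Q] by simp
  qed
  have r: "a3 = u * r"
    unfolding a3_def u_def r_def using qpoch_cube[OF p2 o3, of "- Q"] by (simp add: power_mult[symmetric])
  have s': "a6 = v * s"
    unfolding a6_def v_def s_def using qpoch_cube[OF p2 o3, of "- (Q ^ 2)"] by (simp add: power_mult[symmetric])
  have A0: "A0 = P6 * a5 * a1"
    unfolding A0_def jtp_def P6_def a5_def a1_def using Q by (simp add: eval_nat_numeral)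
  have A1: "Q ^ 2 * A1 = P6 * a4 * a2"
  proof -
    \<comment> \<open>The argument - Q^(-2) lies outside the unit disc. Splitting off its first
      factor 1 + Q^(-2) returns to the disc, and the prefactor Q^2 turns this factor into the first
      factor 1 + Q^2 of \<open>a2\<close>.\<close>
    have 1: "qpoch (Q ^ 6 / (- 1 * Q ^ 8)) (Q ^ 6) = (1 + 1 / Q ^ 2) * a4"
      unfolding a4_def using qpoch_0_step[OF p6, of "Q ^ 6 / (- 1 * Q ^ 8)"] Q
      by (simp add: eval_nat_numeral)
    have 2: "a2 = (1 + Q ^ 2) * qpoch (- 1 * Q ^ 8) (Q ^ 6)"
      unfolding a2_def using qpoch_0_step[OF p6, of "- (Q ^ 2)"] by (simp flip: power_add)
    show ?thesis unfolding A1_def jtp_def 1 2 P6_def[symmetric] using Q by (simp add: field_simps)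
  qed
  have E12: "E1 = E2"
    unfolding E1_def E2_def jtp_def using Q by simp
  have B0: "B0 = P2 * r"
    unfolding B0_def jtp_def P2_def r_def o1[symmetric] using Q zeta6_neq by (simp add: power2_eq_square mult_ac)
  have B1: "- omega * B1 = P2 * s"
  proof -
    have 1: "qpoch (Q ^ 2 / (- (1 / omega) * Q ^ 2)) (Q ^ 2) = (1 + omega) * qpoch (- (omega * Q ^ 2)) (Q ^ 2)"
      using qpoch_0_step[OF p2, of "- omega"] Q zeta6_neq by (simp add: field_simps)
    have "- omega * (1 + omega) = 1" using o3 by algebra
    moreover have "- omega * B1 = (- omega * (1 + omega)) * (P2 * s)"
      unfolding B1_def jtp_def 1 unfolding P2_def s_def o1 by (simp add: mult_ac)
    ultimately show ?thesis by simp
  qed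
  \<comment> \<open>\<open>key0\<close> and \<open>key1\<close> say that (A0, Q^2 A1) is P3 / P1
    times (P2 s, P2 r). Each is proved after multiplication by a nonzero factor, so that only
    polynomial relations are used.\<close>
  have key0: "A0 * P1 = P3 * (P2 * s)"
  proof -
    have "(A0 * P1) * (a3 * v) = (P3 * (P2 * s)) * (a3 * v)"
      using u s' uv a36 A0 by algebra
    then show ?thesis using nz by simp
  qed
  have key1: "Q ^ 2 * A1 * P1 = P3 * (P2 * r)"
  proof -
    have "(Q ^ 2 * A1 * P1) * (a6 * u) = (P3 * (P2 * r)) * (a6 * u)"
      using v r uv a36 A1 by algebra
    then show ?thesis using nz by simp
  qed
  \<comment> \<open>Both theta values contain P1 x y = P3; the remaining factors give (1 - omega) (1
    - omega^2) = 3.\<close>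
  have TT: "jtp Q omega * jtp Q (1 / omega) = 3 * P3 ^ 2"
  proof -
    define x y where "x = qpoch (omega * Q) Q" and "y = qpoch (omega ^ 2 * Q) Q"
    have "Q / omega = omega ^ 2 * Q" unfolding o1[symmetric] by simp
    then have "jtp Q omega = P1 * ((1 - omega) * x) * y"
      unfolding jtp_def P1_def x_def y_def qpoch_0_step[OF Q(1), of omega] by simp
    moreover have "jtp Q (1 / omega) = P1 * ((1 - omega ^ 2) * y) * x"
    proof -
      have "jtp Q (1 / omega) = qpoch Q Q * qpoch (1 / omega) Q * qpoch (omega * Q) Q"
        by (simp add: jtp_def mult.commute)
      then show ?thesis unfolding o1 qpoch_0_step[OF Q(1), of "omega ^ 2"] P1_def x_def y_def .
    qed
    moreover have "P3 = P1 * (x * y)"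
      unfolding P3_def P1_def x_def y_def using qpoch_cube[OF Q(1) o3, of Q] by simp
    moreover have "(1 - omega) * (1 - omega ^ 2) = 3" using o3 by algebra
    ultimately show ?thesis by algebra
  qed
  have "(A0 * E + Q ^ 2 * (A1 * E1)) * P1 = 3 * P3 ^ 3"
  proof -
    have "(A0 * E + Q ^ 2 * (A1 * E1)) * P1 = (A0 * P1) * E + (Q ^ 2 * A1 * P1) * E2"
      by (simp add: E12 algebra_simps)
    also have "\<dots> = P3 * (E2 * (P2 * r) + E * (P2 * s))"
      unfolding key0 key1 by (simp add: algebra_simps)
    also have "\<dots> = P3 * (jtp Q omega * jtp Q (1 / omega))"
      unfolding T B0[symmetric] B1[symmetric] by (simp add: algebra_simps)
    also have "\<dots> = 3 * P3 ^ 3" unfolding TT by (simp add: power3_eq_cube power2_eq_square)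
    finally show ?thesis .
  qed
  then have "A0 * E + Q ^ 2 * (A1 * E1) = 3 * P3 ^ 3 / P1"
    using nz by (simp add: field_simps)
  moreover have "bij_betw (\<lambda>(m, n). (n, m)) UNIV (UNIV :: (int \<times> int) set)"
    by (rule bij_betwI[where g="\<lambda>(m, n). (n, m)"]) auto
  from has_sum_reindex_bij_betw[OF this, THEN iffD2, OF csum]
  have "((\<lambda>(m, n). Q powi (n\<^sup>2 + n * m + m\<^sup>2 + n + m)) has_sum A0 * E + Q ^ 2 * (A1 * E1)) UNIV"
    by (simp add: case_prod_unfold)
  ultimately show ?thesis unfolding P3_def P1_def by simp
qed

section \<open>Logarithmic derivatives of the products\<close>

text \<open>Both sides sum m q^(m n) over m, n >= 1, in the two orders. This identifies the series
  inside \<open>eis_const\<close> with the one in the constant of the heat equation.\<close>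

lemma lambert_sum_double:
  fixes q :: complex
  assumes q: "norm q < 1"
  shows "lambert_sum 0 rho1 q 1 = lambert_sum 1 rho0 q 1"
proof -
  define f :: "nat \<times> nat \<Rightarrow> complex" where "f = (\<lambda>(m, n). of_nat (Suc m) * q ^ (Suc m * Suc n))"
  define r where "r = norm q"
  have r: "0 \<le> r" "r < 1" using q by (auto simp: r_def)
  have pl: "norm (q ^ Suc m) < 1" "r ^ Suc m < 1" for m
    using power_Suc_less_one[of r m] r q by (auto simp: norm_power r_def simp del: power_Suc)
      (metis norm_ge_zero power_Suc_less_one power_0_Suc not_less_iff_gr_or_eq r_def zero_less_one order_less_le)+
  have f1: "f (m, n) = of_nat (Suc m) * q ^ Suc m * (q ^ Suc m) ^ n" for m n
    unfolding f_def by (simp only: prod.case power_mult power_Suc[of "q ^ Suc m"] mult.assoc)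
  have f2: "f (m, n) = q ^ Suc n * (of_nat (Suc m) * (q ^ Suc n) ^ m)" for m n
  proof -
    have "q ^ (Suc m * Suc n) = q ^ Suc n * (q ^ Suc n) ^ m" by (metis mult.commute power_Suc power_mult)
    then show ?thesis unfolding f_def by (simp only: prod.case mult.left_commute)
  qed
  have nf: "norm (f (m, n)) = real (Suc m) * r ^ Suc m * (r ^ Suc m) ^ n" for m n
    unfolding f1 r_def by (simp add: norm_mult norm_power del: of_nat_Suc power_Suc)
  have "(\<lambda>z. norm (f z)) summable_on (UNIV \<times> UNIV)"
  proof (rule summable_on_SigmaI)
    show "((\<lambda>n. norm (f (m, n))) has_sum real (Suc m) * (r ^ Suc m / (1 - r ^ Suc m))) UNIV" for m
    proof (rule sums_nonneg_imp_has_sum)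
      have "(\<lambda>n. (r ^ Suc m) ^ n) sums (1 / (1 - r ^ Suc m))"
        using pl(2)[of m] r by (intro geometric_sums) (simp del: power_Suc)
      from sums_mult[OF this, of "real (Suc m) * r ^ Suc m"]
      show "(\<lambda>n. norm (f (m, n))) sums (real (Suc m) * (r ^ Suc m / (1 - r ^ Suc m)))"
        unfolding nf by (simp add: mult.assoc del: power_Suc of_nat_Suc)
    qed simp
    show "(\<lambda>m. real (Suc m) * (r ^ Suc m / (1 - r ^ Suc m))) summable_on UNIV"
    \<comment> \<open>For m >= 1, 1 - r^m >= 1 - r bounds the row sums by multiples of m
      r^m.\<close>
    proof (rule norm_summable_imp_summable_on, rule summable_comparison_test')
      show "summable (\<lambda>m. real (Suc m) ^ 1 * r ^ Suc m * (1 / (1 - r)))"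
        by (intro summable_mult2 summable_poly_times_power r)
      fix m :: nat
      have "1 - r \<le> 1 - r ^ Suc m" using power_Suc_le_self[of r m] r by simp
      then have "r ^ Suc m / (1 - r ^ Suc m) \<le> r ^ Suc m / (1 - r)" 
        using r by (intro divide_left_mono) (auto simp: pl(2) simp del: power_Suc)
      then have "real (Suc m) * (r ^ Suc m / (1 - r ^ Suc m)) \<le> real (Suc m) * (r ^ Suc m / (1 - r))"
        by (intro mult_left_mono) auto
      moreover have nn: "0 \<le> real (Suc m) * (r ^ Suc m / (1 - r ^ Suc m))"
        using pl(2)[of m] r by (intro mult_nonneg_nonneg divide_nonneg_nonneg) (auto simp del: power_Suc)
      ultimately show "norm (norm (real (Suc m) * (r ^ Suc m / (1 - r ^ Suc m)))) \<le> real (Suc m) ^ 1 * r ^ Suc m * (1 / (1 - r))"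
        unfolding real_norm_def abs_abs abs_of_nonneg[OF nn] by (simp add: mult.assoc del: power_Suc of_nat_Suc)
    qed
  qed auto
  then have f: "f summable_on (UNIV \<times> UNIV)" by (rule abs_summable_summable)
  have hs: "((\<lambda>n. f (m, n)) has_sum s) UNIV" if "(\<lambda>n. f (m, n)) sums s" for m s
  proof -
    have "(\<lambda>n. f (m, n)) summable_on UNIV"
      using summable_on_SigmaD1[of "\<lambda>m n. f (m, n)" UNIV "\<lambda>_. UNIV" m] f by simp
    then show ?thesis using has_sum_imp_sums[OF has_sum_infsum] has_sum_infsum that sums_unique2 by metis
  qed
  have hs': "((\<lambda>m. f (m, n)) has_sum s) UNIV" if "(\<lambda>m. f (m, n)) sums s" for n s
  proof -
    have "(\<lambda>m. f (m, n)) summable_on UNIV"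
      using summable_on_SigmaD1[of "\<lambda>n m. f (m, n)" UNIV "\<lambda>_. UNIV" n] f summable_on_swap[of f UNIV UNIV] by simp
    then show ?thesis using has_sum_imp_sums[OF has_sum_infsum] has_sum_infsum that sums_unique2 by metis
  qed
  have row: "(\<lambda>n. f (m, n)) sums (of_nat (Suc m) * rho0 (q ^ Suc m))" for m
  proof -
    have "(\<lambda>n. (q ^ Suc m) ^ n) sums (1 / (1 - q ^ Suc m))"
      using pl(1)[of m] by (intro geometric_sums)
    from sums_mult[OF this, of "of_nat (Suc m) * q ^ Suc m"] show ?thesis
      unfolding f1 rho0_def by (simp add: mult.assoc del: power_Suc of_nat_Suc)
  qed
  have col: "(\<lambda>m. f (m, n)) sums rho1 (q ^ Suc n)" for n
  proof -
    have "(\<lambda>m. of_nat (Suc m) * (q ^ Suc n) ^ m) sums (1 / (1 - q ^ Suc n) ^ 2)"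
      using pl(1)[of n] by (intro geometric_deriv_sums)
    from sums_mult[OF this, of "q ^ Suc n"] show ?thesis
      unfolding f2 rho1_def by (simp del: power_Suc of_nat_Suc)
  qed
  have F: "(f has_sum infsum f (UNIV \<times> UNIV)) (UNIV \<times> UNIV)" by (rule has_sum_infsum[OF f])
  have "((\<lambda>m. of_nat (Suc m) * rho0 (q ^ Suc m)) has_sum infsum f (UNIV \<times> UNIV)) UNIV"
    by (rule has_sum_Sigma'[OF F]) (rule hs[OF row])
  moreover have "((\<lambda>n. rho1 (q ^ Suc n)) has_sum infsum f (UNIV \<times> UNIV)) UNIV"
    by (rule has_sum_Sigma'[OF F[unfolded has_sum_swap[of f]]]) (simp only: prod.case, rule hs'[OF col])
  ultimately show ?thesis
    unfolding lambert_sum_def by (auto dest!: has_sum_imp_sums simp: sums_iff)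
qed

text \<open>The principal branch suffices because Re (1 - s) > 0 on the unit disc. The Euler
  derivative is \<open>rho0\<close>, so this extends the \<open>rho\<close> family one step
  down.\<close>

definition mlog :: "complex \<Rightarrow> complex" where "mlog s = - Ln (1 - s)"

lemma Re_1_minus: "norm s < 1 \<Longrightarrow> Re (1 - s) > 0"
  using complex_Re_le_cmod[of s] by simp

lemma mlog_0 [simp]: "mlog 0 = 0"
  by (simp add: mlog_def)

lemma DERIV_mlog: "norm s < 1 \<Longrightarrow> (mlog has_field_derivative 1 / (1 - s)) (at s)"
  unfolding mlog_def[abs_def] using Re_1_minus[of s]
  by (auto intro!: derivative_eq_intros simp: complex_nonpos_Reals_iff divide_inverse)

lemma mlog_holomorphic: "mlog holomorphic_on ball 0 1"
  unfolding holomorphic_on_open[OF open_ball] by (metis DERIV_mlog mem_ball_0)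

lemma mlog_deriv: "norm s < 1 \<Longrightarrow> rho0 s = s * deriv mlog s"
  by (simp add: DERIV_imp_deriv[OF DERIV_mlog] rho0_def)

text \<open>Exponentiating a sum of principal logarithms avoids choosing a branch for the infinite
  product, and the differentiation of Lambert series becomes applicable to it.\<close>

lemma qpoch_lambert:
  assumes "norm q < 1" "norm (q * w) < 1"
  shows "qpoch (q * w) q = exp (- lambert_sum 0 mlog q w)"
proof -
  have s: "(\<lambda>n. - mlog (q ^ Suc n * w)) sums (- lambert_sum 0 mlog q w)"
    using sums_minus[OF sums_lambert_sum[OF mlog_holomorphic mlog_0 assms, of 0]] by simp
  have e: "exp (- mlog x) = 1 - x" if "norm x < 1" for x
  proof -
    have "1 - x \<noteq> 0" using that by auto
    then show ?thesis by (simp add: mlog_def)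
  qed
  have "1 - q * w * q ^ n = exp (- mlog (q ^ Suc n * w))" for n
    unfolding e[OF norm_power_times_less_1[OF assms]] by (simp add: mult_ac)
  then show ?thesis unfolding qpoch_def using prodinf_exp[OF sums_summable[OF s]] s by (simp add: sums_iff)
qed

lemma DERIV_qpoch_q:
  assumes q: "norm q < 1" "q \<noteq> 0" and w: "norm w = 1"
  shows "((\<lambda>q. qpoch (q * w) q) has_field_derivative
      qpoch (q * w) q * (- lambert_sum 1 rho0 q w) / q) (at q)"
proof -
  have n: "norm (x * w) < 1" if "x \<in> ball 0 1" for x using that w by (simp add: norm_mult)
  have "((\<lambda>q. exp (- lambert_sum 0 mlog q w)) has_field_derivative
      exp (- lambert_sum 0 mlog q w) * (- (lambert_sum (Suc 0) rho0 q w / q))) (at q)"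
    using DERIV_lambert_sum_q[OF mlog_holomorphic mlog_0 q(1) _ q(2) mlog_deriv, of w 0] n q
    by (auto intro!: derivative_eq_intros)
  then have "((\<lambda>q. qpoch (q * w) q) has_field_derivative
      exp (- lambert_sum 0 mlog q w) * (- (lambert_sum (Suc 0) rho0 q w / q))) (at q)"
    by (rule has_field_derivative_transform_within_open[where S="ball 0 1"])
      (use q n qpoch_lambert in auto)
  then show ?thesis using qpoch_lambert[of q w] n q by simp
qed

text \<open>theta without its factor w^(-1/2) (1 - w), which is constant in q; hence its
  q-logarithmic derivative is \<open>theta_qderiv\<close>.\<close>

definition theta_prod :: "complex \<Rightarrow> complex \<Rightarrow> complex" where
  "theta_prod w q = qpoch (q * w) q * qpoch (q * (1 / w)) q"

lemma theta_prod_nonzero: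
  assumes "norm q < 1" "norm w = 1"
  shows "theta_prod w q \<noteq> 0"
  unfolding theta_prod_def using assms by (simp add: qpoch_nonzero norm_mult norm_divide)

lemma DERIV_theta_prod:
  assumes q: "norm q < 1" "q \<noteq> 0" and w: "norm w = 1"
  shows "(theta_prod w has_field_derivative theta_prod w q * theta_qderiv q w / q) (at q)"
proof -
  have w': "norm (1 / w) = 1" using w by (simp add: norm_divide)
  show ?thesis
    using DERIV_mult[OF DERIV_qpoch_q[OF q w] DERIV_qpoch_q[OF q w']]
    unfolding theta_prod_def[abs_def] theta_qderiv_def by (rule DERIV_cong) (simp add: divide_inverse algebra_simps)
qed

text \<open>The eta quotient f as a function of the nome; its powers of q^(1/24) cancel, so it
  extends to q = 0, with value 1.\<close>

definition hauptmodul :: "complex \<Rightarrow> complex" where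
  "hauptmodul q = (theta_prod omega q / theta_prod zeta6 q) ^ 4"

text \<open>In the first difference the constants of the heat equation cancel. The second sum is the
  q-logarithmic derivative of c(2 tau): 2/3 is the exponent of its leading power of q and cancels
  16/24 from the sixteen copies of - B = k/6 - 1/24.\<close>

lemma qderiv_values:
  fixes q :: complex
  assumes q: "norm q < 1" "q \<noteq> 0"
  defines "y1 \<equiv> theta_logderiv q zeta6" and "y2 \<equiv> theta_logderiv q omega" and "k \<equiv> eis_const q"
  shows "4 * (theta_qderiv q omega - theta_qderiv q zeta6) = 2 * (y1 - 3 * y2) * (y1 + y2)"
    and "3 * theta_qderiv q zeta6 + 3 * theta_qderiv q omega + theta_qderiv q (- 1)
      - 2 * lambert_sum 1 rho0 q 1 + 2 / 3 = - (y1 ^ 2) + y1 * y2 - y2 ^ 2 + k / 3"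
proof -
  have an: "zeta6 \<in> annulus q" "omega \<in> annulus q" "- 1 \<in> annulus q"
    using q by (auto intro: annulus_unit)
  note h = theta_heat_equation[OF q an(1) zeta6_neq(2)] theta_heat_equation[OF q an(2) zeta6_neq(4)]
    theta_heat_equation[OF q an(3)]
  note t = torsion_values(1-3)[OF q, folded y1_def y2_def k_def]
  define B where "B = lambert_sum 1 rho0 q 1"
  have k: "B = 1 / 24 - k / 6"
    unfolding B_def k_def eis_const_def lambert_sum_double[OF q(1)] by (simp add: field_simps)
  have L1: "theta_qderiv q zeta6 = (y1 ^ 2 - (2 * y1 ^ 2 - 2 * y1 * y2 - y2 ^ 2 - k / 3) - k) / 2 - 2 * B"
    using h(1) unfolding t y1_def[symmetric] k_def[symmetric] B_def[symmetric] .
  have L2: "theta_qderiv q omega = (y2 ^ 2 - (3 * y2 ^ 2 - k / 3) - k) / 2 - 2 * B"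
    using h(2) unfolding t y2_def[symmetric] k_def[symmetric] B_def[symmetric] .
  have L3: "theta_qderiv q (- 1) = (0 ^ 2 - (- (y1 ^ 2) + 4 * y1 * y2 - y2 ^ 2 - k / 3) - k) / 2 - 2 * B"
    using h(3) unfolding theta_logderiv_minus1[OF q] t k_def[symmetric] B_def[symmetric] by simp
  show "4 * (theta_qderiv q omega - theta_qderiv q zeta6) = 2 * (y1 - 3 * y2) * (y1 + y2)"
    unfolding L1 L2 by (simp add: field_simps power2_eq_square)
  show "3 * theta_qderiv q zeta6 + 3 * theta_qderiv q omega + theta_qderiv q (- 1)
      - 2 * lambert_sum 1 rho0 q 1 + 2 / 3 = - (y1 ^ 2) + y1 * y2 - y2 ^ 2 + k / 3"
    unfolding L1 L2 L3 B_def[symmetric] k by (simp add: field_simps power2_eq_square)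
qed

lemma DERIV_hauptmodul:
  fixes q :: complex
  assumes q: "norm q < 1" "q \<noteq> 0"
  defines "y1 \<equiv> theta_logderiv q zeta6" and "y2 \<equiv> theta_logderiv q omega"
  shows "(hauptmodul has_field_derivative hauptmodul q * (2 * (y1 - 3 * y2) * (y1 + y2)) / q) (at q)"
proof -
  have nz: "theta_prod zeta6 q \<noteq> 0" using q by (simp add: theta_prod_nonzero)
  have "((\<lambda>q. theta_prod omega q / theta_prod zeta6 q) has_field_derivative
      theta_prod omega q / theta_prod zeta6 q * (theta_qderiv q omega - theta_qderiv q zeta6) / q) (at q)"
    by (rule DERIV_cong[OF DERIV_divide[OF DERIV_theta_prod[OF q norm_omega] DERIV_theta_prod[OF q norm_zeta6] nz]])
      (use nz q in \<open>simp add: field_simps\<close>)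
  moreover have "((\<lambda>q. g q ^ 4) has_field_derivative g q ^ 4 * (4 * L) / q) (at q)"
    if "(g has_field_derivative g q * L / q) (at q)" for g L
    using DERIV_power[OF that, of 4] by (rule DERIV_cong) (simp add: eval_nat_numeral)
  ultimately have "(hauptmodul has_field_derivative hauptmodul q * (4 * (theta_qderiv q omega - theta_qderiv q zeta6)) / q) (at q)"
    unfolding hauptmodul_def[abs_def] by blast
  then show ?thesis unfolding qderiv_values[OF q] y1_def y2_def .
qed

text \<open>q u' = E u has exponent E(0) = 0 at q = 0, so no solution has a zero of finite positive
  order there: with u = w^n g and g(0) nonzero, n g + w g' = E g would force n g(0) = 0.\<close>

lemma regular_singular_uniqueness:
  fixes u E :: "complex \<Rightarrow> complex"
  assumes u: "u holomorphic_on ball 0 1" and E: "E holomorphic_on ball 0 1" "E 0 = 0" "u 0 = 0"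
    and ode: "\<And>q. norm q < 1 \<Longrightarrow> q \<noteq> 0 \<Longrightarrow> (u has_field_derivative u q * E q / q) (at q)"
    and q: "norm q < 1"
  shows "u q = 0"
proof (rule ccontr)
  assume "u q \<noteq> 0"
  then have nc: "\<not> u constant_on ball 0 1"
    using E(3) q unfolding constant_on_def by (metis centre_in_ball mem_ball_0 zero_less_one)
  have z: "0 \<in> ball (0::complex) 1" by simp
  obtain g r n where n: "0 < n" and r: "0 < r" "ball 0 r \<subseteq> ball (0::complex) 1" and g: "g holomorphic_on ball 0 r"
    and ug: "\<And>w. w \<in> ball 0 r \<Longrightarrow> u w = (w - 0) ^ n * g w" and gnz: "\<And>w. w \<in> ball 0 r \<Longrightarrow> g w \<noteq> 0"
    by (rule holomorphic_factor_zero_nonconstant[OF u open_ball connected_ball z E(3) nc]) (rule that, assumption+)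
  define h where "h w = of_nat n * g w + w * deriv g w - E w * g w" for w
  have h0: "h w = 0" if w: "w \<in> ball 0 r" "w \<noteq> 0" for w
  proof -
    have "(g has_field_derivative deriv g w) (at w)" using holomorphic_derivI[OF g open_ball w(1)] .
    then have "((\<lambda>w. w ^ n * g w) has_field_derivative of_nat n * w ^ (n - 1) * g w + w ^ n * deriv g w) (at w)"
      by (auto intro!: derivative_eq_intros)
    then have "(u has_field_derivative of_nat n * w ^ (n - 1) * g w + w ^ n * deriv g w) (at w)"
      by (rule has_field_derivative_transform_within_open[OF _ open_ball w(1)]) (use ug in auto)
    moreover have "(u has_field_derivative u w * E w / w) (at w)" using w r by (intro ode) auto
    ultimately have eq: "of_nat n * w ^ (n - 1) * g w + w ^ n * deriv g w = u w * E w / w" by (rule DERIV_unique)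
    have wn: "w ^ n = w ^ (n - 1) * w" using n by (metis power_minus_mult)
    have "w ^ (n - 1) * h w = of_nat n * w ^ (n - 1) * g w + w ^ n * deriv g w - u w * E w / w"
      unfolding h_def ug[OF w(1)] using w(2) by (simp add: wn algebra_simps)
    then show ?thesis using eq w(2) by simp
  qed
  \<comment> \<open>The relation is known away from 0 only; continuity carries it to 0.\<close>
  have "h holomorphic_on ball 0 r"
    unfolding h_def by (intro holomorphic_intros g holomorphic_deriv holomorphic_on_subset[OF E(1) r(2)]) auto
  then have "continuous_on (ball 0 r) h" by (rule holomorphic_on_imp_continuous_on)
  then have "isCont h 0" using r(1) by (simp add: continuous_on_eq_continuous_at)
  then have "(h \<longlongrightarrow> h 0) (at 0)" by (simp add: isCont_def)
  moreover have "(h \<longlongrightarrow> 0) (at 0)"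
  proof (rule Lim_transform_eventually[OF tendsto_const])
    show "\<forall>\<^sub>F w in at 0. 0 = h w"
      using eventually_at_in_open[OF open_ball, of 0 0 r] r by (auto elim!: eventually_mono simp: h0)
  qed
  ultimately have "h 0 = 0" using tendsto_unique[OF trivial_limit_at] by blast
  then show False using gnz[of 0] r n E by (simp add: h_def)
qed

lemma lambert_sum_q0: "\<phi> 0 = 0 \<Longrightarrow> lambert_sum j \<phi> 0 w = 0"
  by (simp add: lambert_sum_def)

lemma theta_logderiv_holomorphic_q:
  "norm w = 1 \<Longrightarrow> (\<lambda>q. theta_logderiv q w) holomorphic_on ball 0 1"
  unfolding theta_logderiv_def
  by (intro holomorphic_intros lambert_sum_holomorphic_q rho_holomorphic rho_0) (auto simp: norm_divide)

lemma eis_const_holomorphic: "eis_const holomorphic_on ball 0 1"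
  unfolding eis_const_def[abs_def]
  by (intro holomorphic_intros lambert_sum_holomorphic_q rho_holomorphic rho_0) auto

lemma hauptmodul_holomorphic: "hauptmodul holomorphic_on ball 0 1"
proof -
  have e: "qpoch (q * w) q = exp (- lambert_sum 0 mlog q w)" if "q \<in> ball 0 1" "norm w = 1" for q w
    using that by (intro qpoch_lambert) (auto simp: norm_mult)
  have "(\<lambda>q. theta_prod w q) holomorphic_on ball 0 1" if w: "norm w = 1" for w
  proof -
    have w': "norm (1 / w) = 1" using w by (simp add: norm_divide)
    have "(\<lambda>q. exp (- lambert_sum 0 mlog q w) * exp (- lambert_sum 0 mlog q (1 / w))) holomorphic_on ball 0 1"
      using w w' by (intro holomorphic_intros lambert_sum_holomorphic_q mlog_holomorphic mlog_0) auto
    then show ?thesis by (rule holomorphic_transform) (use e[OF _ w] e[OF _ w'] in \<open>simp add: theta_prod_def\<close>)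
  qed
  then show ?thesis unfolding hauptmodul_def[abs_def]
    by (intro holomorphic_intros) (auto simp: theta_prod_nonzero)
qed

text \<open>At q = 0 all Lambert series vanish and only elementary terms survive. The values satisfy
  a = 3 b, in accordance with f = 1.\<close>

lemma torsion_values_q0:
  "theta_logderiv 0 zeta6 = - (\<i> * sqrt 3 / 2)" "theta_logderiv 0 omega = - (\<i> * sqrt 3 / 6)"
  "eis_const 0 = 1 / 4" "hauptmodul 0 = 1"
proof -
  have z: "zeta6 = 1 / 2 + \<i> * (sqrt 3 / 2)" by (simp add: zeta6_Complex complex_eq_iff)
  have s3: "(\<i> * sqrt 3) ^ 2 = - 3" by (simp add: power_mult_distrib flip: of_real_power)
  define s where "s = \<i> * complex_of_real (sqrt 3)"
  have s2: "s * s = - 3" using s3 by (simp add: s_def power2_eq_square)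
  have s2': "s * (s * x) = - 3 * x" for x using s2 by (metis mult.assoc)
  have zs: "zeta6 = 1 / 2 + s / 2" "omega = - 1 / 2 + s / 2"
    unfolding omega_def z by (simp_all add: s_def field_simps)
  have "zeta6 - 1 \<noteq> 0" "omega - 1 \<noteq> 0" using zeta6_neq by auto
  then show "theta_logderiv 0 zeta6 = - (\<i> * sqrt 3 / 2)" "theta_logderiv 0 omega = - (\<i> * sqrt 3 / 6)"
    unfolding theta_logderiv_def lambert_sum_q0[of rho0, OF rho_0(1)] s_def[symmetric] zs
    using s2 by (simp_all add: divide_simps) (simp_all add: algebra_simps s2')
  show "eis_const 0 = 1 / 4" by (simp add: eis_const_def lambert_sum_q0)
  show "hauptmodul 0 = 1" by (simp add: hauptmodul_def theta_prod_def qpoch_def)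
qed

text \<open>
  Both sides solve the same linear differential equation in \<open>q\<close> on the unit disc, regular singular
  at \<open>q = 0\<close> with exponent \<open>0\<close>, and they agree there.
\<close>

theorem hauptmodul_eq:
  assumes q: "norm q < 1"
  shows "3 * hauptmodul q * (theta_logderiv q zeta6 - 2 * theta_logderiv q omega) = theta_logderiv q zeta6"
proof -
  define y1 y2 where "y1 q = theta_logderiv q zeta6" and "y2 q = theta_logderiv q omega" for q
  define u where "u q = 3 * hauptmodul q * (y1 q - 2 * y2 q) - y1 q" for q
  \<comment> \<open>By \<open>torsion_system\<close>, E is the logarithmic derivative of y1 under q
    d/dq.\<close>
  define E where "E q = y1 q ^ 2 - y1 q * y2 q - 5 * y2 q ^ 2 + eis_const q / 3" for q
  have s3: "(\<i> * sqrt 3) ^ 2 = - 3" by (simp add: power_mult_distrib flip: of_real_power)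
  have "u q = 0"
  proof (rule regular_singular_uniqueness[where E=E and u=u and q=q])
    show "u holomorphic_on ball 0 1" "E holomorphic_on ball 0 1"
      unfolding u_def E_def y1_def y2_def
      by (intro holomorphic_intros hauptmodul_holomorphic theta_logderiv_holomorphic_q eis_const_holomorphic; simp)+
    show "u 0 = 0" unfolding u_def y1_def y2_def torsion_values_q0 by (simp add: field_simps)
    show "E 0 = 0" unfolding E_def y1_def y2_def torsion_values_q0 using s3 by (simp add: field_simps power2_eq_square)
    show "norm q < 1" by (rule q)
  next
    fix q :: complex assume q: "norm q < 1" "q \<noteq> 0"
    have d1: "(y1 has_field_derivative y1 q * E q / q) (at q)"
      using torsion_system(1)[OF q] unfolding y1_def y2_def E_def by simp
    have d2: "(y2 has_field_derivative
       (eis_const q * y2 q / 3 + y1 q ^ 3 - 3 * y1 q ^ 2 * y2 q + y2 q ^ 3) / q) (at q)"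
      using torsion_system(2)[OF q] unfolding y1_def y2_def by simp
    have df: "(hauptmodul has_field_derivative hauptmodul q * (2 * (y1 q - 3 * y2 q) * (y1 q + y2 q)) / q) (at q)"
      using DERIV_hauptmodul[OF q] unfolding y1_def y2_def .
    define d where "d = eis_const q * y2 q / 3 + y1 q ^ 3 - 3 * y1 q ^ 2 * y2 q + y2 q ^ 3"
    \<comment> \<open>Hence the product of \<open>hauptmodul\<close> and y1 - 2 y2 satisfies the
      equation of y1; stated without division by y1 - 2 y2.\<close>
    have key: "2 * (y1 q - 3 * y2 q) * (y1 q + y2 q) * (y1 q - 2 * y2 q) + (y1 q * E q - 2 * d) =
        (y1 q - 2 * y2 q) * E q"
      unfolding E_def d_def by (simp add: field_simps power2_eq_square power3_eq_cube)
    have gen: "((\<lambda>q. 3 * h q * (a q - 2 * b q) - a q) has_field_derivative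
        (3 * h' * (a q - 2 * b q) + 3 * h q * (a' - 2 * b') - a')) (at q)"
      if "(h has_field_derivative h') (at q)" "(a has_field_derivative a') (at q)"
        "(b has_field_derivative b') (at q)" for h a b h' a' b'
      by (auto intro!: derivative_eq_intros that simp: algebra_simps)
    have "(u has_field_derivative
       3 * (hauptmodul q * (2 * (y1 q - 3 * y2 q) * (y1 q + y2 q)) / q) * (y1 q - 2 * y2 q)
       + 3 * hauptmodul q * (y1 q * E q / q - 2 * (d / q)) - y1 q * E q / q) (at q)"
      unfolding u_def d_def by (rule gen[OF df d1 d2])
    also have "3 * (hauptmodul q * (2 * (y1 q - 3 * y2 q) * (y1 q + y2 q)) / q) * (y1 q - 2 * y2 q)
       + 3 * hauptmodul q * (y1 q * E q / q - 2 * (d / q)) - y1 q * E q / q =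
      (3 * hauptmodul q * (2 * (y1 q - 3 * y2 q) * (y1 q + y2 q) * (y1 q - 2 * y2 q) + (y1 q * E q - 2 * d)) - y1 q * E q) / q"
      by (simp add: diff_divide_distrib add_divide_distrib algebra_simps)
    also have "\<dots> = u q * E q / q" unfolding key u_def by (simp add: algebra_simps)
    finally show "(u has_field_derivative u q * E q / q) (at q)" .
  qed
  then show ?thesis by (simp add: u_def y1_def y2_def)
qed

section \<open>From the nome back to eta and the cubic theta function\<close>

definition nome :: "complex \<Rightarrow> complex" where
  "nome \<tau> = exp (2 * of_real pi * \<i> * \<tau>)"

lemma nome_nonzero [simp]: "nome \<tau> \<noteq> 0"
  by (simp add: nome_def)

lemma norm_nome: "Im \<tau> > 0 \<Longrightarrow> norm (nome \<tau>) < 1"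
  by (simp add: nome_def)

lemma nome_mult: "nome (of_nat n * \<tau>) = nome \<tau> ^ n"
  unfolding nome_def exp_of_nat_mult[symmetric] by (simp add: mult_ac)

text \<open>All prefactors are powers of the single number exp(2 pi i tau / 24), so they can be
  compared without choosing roots of q.\<close>

lemma dedekind_eta_qpoch:
  "dedekind_eta (of_nat n * \<tau>) = exp (2 * of_real pi * \<i> * \<tau> / 24) ^ n * qpoch (nome \<tau> ^ n) (nome \<tau> ^ n)"
proof -
  have "exp (2 * of_real pi * \<i> * of_nat (Suc k) * \<sigma>) = nome \<sigma> * nome \<sigma> ^ k" for k \<sigma>
    using nome_mult[of "Suc k" \<sigma>] by (simp add: nome_def mult_ac)
  moreover have "exp (2 * of_real pi * \<i> * (of_nat n * \<tau>) / 24) = exp (2 * of_real pi * \<i> * \<tau> / 24) ^ n"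
    unfolding exp_of_nat_mult[symmetric] by (simp add: mult_ac)
  ultimately show ?thesis unfolding dedekind_eta_def qpoch_def by (simp only: nome_mult)
qed

text \<open>The exponent is n^2 + n m + m^2 + n + m + 1/3, so a fixed factor q^(1/3) splits off and
  \<open>cubic_theta_identity\<close> applies. The result is 3 eta(3 sigma)^3 / eta(sigma).\<close>

lemma cubic_theta_c_qpoch:
  assumes "Im \<sigma> > 0"
  shows "cubic_theta_c \<sigma> = exp (2 * of_real pi * \<i> * \<sigma> / 3) *
    (3 * qpoch (nome \<sigma> ^ 3) (nome \<sigma> ^ 3) ^ 3 / qpoch (nome \<sigma>) (nome \<sigma>))"
proof -
  have e: "q_pow \<sigma> ((of_int n + 1/3)\<^sup>2 + (of_int n + 1/3) * (of_int m + 1/3) + (of_int m + 1/3)\<^sup>2)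
     = exp (2 * of_real pi * \<i> * \<sigma> / 3) * nome \<sigma> powi (n\<^sup>2 + n * m + m\<^sup>2 + n + m)" for m n :: int
  proof -
    have "(of_int n + 1/3)\<^sup>2 + (of_int n + 1/3) * (of_int m + 1/3) + (of_int m + 1/3)\<^sup>2 =
        (of_int (n\<^sup>2 + n * m + m\<^sup>2 + n + m) + 1 / 3 :: rat)"
      by (simp add: power2_eq_square field_simps)
    then have "q_pow \<sigma> ((of_int n + 1/3)\<^sup>2 + (of_int n + 1/3) * (of_int m + 1/3) + (of_int m + 1/3)\<^sup>2) =
        exp (2 * of_real pi * \<i> * (of_int (n\<^sup>2 + n * m + m\<^sup>2 + n + m) + 1 / 3) * \<sigma>)"
      unfolding q_pow_def by (simp only: of_rat_add of_rat_of_int_eq of_rat_divide of_rat_1 of_rat_numeral_eq)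
    also have "2 * of_real pi * \<i> * (of_int N + 1 / 3) * \<sigma> =
        2 * of_real pi * \<i> * \<sigma> / 3 + of_int N * (2 * of_real pi * \<i> * \<sigma>)" for N
      by (simp add: field_simps)
    also have "exp (2 * of_real pi * \<i> * \<sigma> / 3 + of_int N * (2 * of_real pi * \<i> * \<sigma>)) =
        exp (2 * of_real pi * \<i> * \<sigma> / 3) * nome \<sigma> powi N" for N
      unfolding exp_add nome_def exp_power_int ..
    finally show ?thesis .
  qed
  have "((\<lambda>(m, n). exp (2 * of_real pi * \<i> * \<sigma> / 3) * nome \<sigma> powi (n\<^sup>2 + n * m + m\<^sup>2 + n + m)) has_sum
      exp (2 * of_real pi * \<i> * \<sigma> / 3) *
      (3 * qpoch (nome \<sigma> ^ 3) (nome \<sigma> ^ 3) ^ 3 / qpoch (nome \<sigma>) (nome \<sigma>))) UNIV"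
    using has_sum_cmult_right[OF cubic_theta_identity[OF norm_nome[OF assms] nome_nonzero]]
    by (simp add: case_prod_unfold)
  then show ?thesis unfolding cubic_theta_c_def e by (rule infsumI)
qed

text \<open>1 - x^2, 1 - x^3 and 1 - x^6 factor over the roots of unity; those of exact order 1, 2,
  3, 6 contribute N, C, B, A.\<close>

lemma eta_products:
  fixes q :: complex
  assumes q: "norm q < 1"
  defines "N \<equiv> qpoch q q" and "A \<equiv> theta_prod zeta6 q" and "B \<equiv> theta_prod omega q" and "C \<equiv> qpoch (- q) q"
  shows "qpoch (q ^ 2) (q ^ 2) = N * C" and "qpoch (q ^ 3) (q ^ 3) = N * B"
    and "qpoch (q ^ 6) (q ^ 6) = N * A * B * C"
proof -
  have o1: "1 / omega = omega ^ 2" using omega_square inverse_zeta6 by (simp add: power2_eq_square)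
  have o3: "1 + omega + omega ^ 2 = 0" using omega_square unfolding power2_eq_square by (simp add: omega_def)
  have q3: "norm (q ^ 3) < 1" using q by (simp add: norm_power power_less_one_iff)
  show "qpoch (q ^ 2) (q ^ 2) = N * C" unfolding N_def C_def by (rule qpoch_square[OF q])
  have B: "B = qpoch (omega * q) q * qpoch (omega ^ 2 * q) q"
    unfolding B_def theta_prod_def o1 by (simp add: mult.commute)
  show 3: "qpoch (q ^ 3) (q ^ 3) = N * B"
    unfolding N_def B by (rule qpoch_cube[OF q o3])
  have A: "A = qpoch (omega * (- q)) q * qpoch (omega ^ 2 * (- q)) q"
    unfolding A_def theta_prod_def inverse_zeta6 using omega_square by (simp add: power2_eq_square mult.commute)
  have "qpoch (- (q ^ 3)) (q ^ 3) = C * A"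
    unfolding C_def A using qpoch_cube[OF q o3, of "- q"] by simp
  moreover have "qpoch (q ^ 6) (q ^ 6) = qpoch (q ^ 3) (q ^ 3) * qpoch (- (q ^ 3)) (q ^ 3)"
    using qpoch_square[OF q3, of "q ^ 3"] by (simp flip: power_mult)
  ultimately show "qpoch (q ^ 6) (q ^ 6) = N * A * B * C" unfolding 3 by (simp add: mult_ac)
qed

lemma eta_quotient_f_hauptmodul:
  assumes "Im \<tau> > 0"
  shows "eta_quotient_f \<tau> = hauptmodul (nome \<tau>)"
proof -
  define q where "q = nome \<tau>"
  have q: "norm q < 1" unfolding q_def by (rule norm_nome[OF assms])
  define e where "e = exp (2 * of_real pi * \<i> * \<tau> / 24)"
  define N A B C where "N = qpoch q q" and "A = theta_prod zeta6 q" and "B = theta_prod omega q" and "C = qpoch (- q) q"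
  have nz: "e \<noteq> 0" "N \<noteq> 0" "A \<noteq> 0" "B \<noteq> 0" "C \<noteq> 0"
    using q by (auto simp: e_def N_def A_def B_def C_def theta_prod_nonzero qpoch_nonzero)
  have eta: "dedekind_eta (of_nat n * \<tau>) = e ^ n * qpoch (q ^ n) (q ^ n)" for n
    unfolding e_def q_def by (rule dedekind_eta_qpoch)
  have "dedekind_eta \<tau> = e * N" "dedekind_eta (2 * \<tau>) = e ^ 2 * (N * C)"
    "dedekind_eta (3 * \<tau>) = e ^ 3 * (N * B)" "dedekind_eta (6 * \<tau>) = e ^ 6 * (N * A * B * C)"
    using eta[of 1] eta[of 2] eta[of 3] eta[of 6]
    unfolding eta_products[OF q] by (simp_all add: N_def A_def B_def C_def)
  then have "eta_quotient_f \<tau> = (e ^ 2 * (N * C)) ^ 4 * (e ^ 3 * (N * B)) ^ 8 / ((e * N) ^ 8 * (e ^ 6 * (N * A * B * C)) ^ 4)"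
    unfolding eta_quotient_f_def by simp
  also have "\<dots> = (e ^ 32 * N ^ 12 * C ^ 4 * B ^ 4) * B ^ 4 / ((e ^ 32 * N ^ 12 * C ^ 4 * B ^ 4) * A ^ 4)"
  proof -
    have "(e ^ 2 * (N * C)) ^ 4 * (e ^ 3 * (N * B)) ^ 8 = (e ^ 32 * N ^ 12 * C ^ 4 * B ^ 4) * B ^ 4" by algebra
    moreover have "(e * N) ^ 8 * (e ^ 6 * (N * A * B * C)) ^ 4 = (e ^ 32 * N ^ 12 * C ^ 4 * B ^ 4) * A ^ 4" by algebra
    ultimately show ?thesis by simp
  qed
  also have "\<dots> = (B / A) ^ 4" using nz by (simp add: power_divide)
  finally show ?thesis unfolding hauptmodul_def A_def B_def q_def .
qed

text \<open>This is \<open>c(2\<tau>)\<close> without its leading power of \<open>q\<close>, rewritten without quotients.\<close>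

definition weight_one_prod :: "complex \<Rightarrow> complex" where
  "weight_one_prod q = 3 * qpoch q q ^ 2 * theta_prod zeta6 q ^ 3 * theta_prod omega q ^ 3 * qpoch (- q) q ^ 2"

lemma cubic_theta_c_double:
  assumes "Im \<tau> > 0"
  shows "cubic_theta_c (2 * \<tau>) = exp (2 * of_real pi * \<i> * (2 * \<tau>) / 3) * weight_one_prod (nome \<tau>)"
proof -
  define q where "q = nome \<tau>"
  have q: "norm q < 1" unfolding q_def by (rule norm_nome[OF assms])
  have n2: "nome (2 * \<tau>) = q ^ 2" using nome_mult[of 2 \<tau>] by (simp add: q_def)
  have nz: "qpoch q q \<noteq> 0" "qpoch (- q) q \<noteq> 0" using q by (auto simp: qpoch_nonzero)
  have "cubic_theta_c (2 * \<tau>) = exp (2 * of_real pi * \<i> * (2 * \<tau>) / 3) *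
    (3 * qpoch (q ^ 6) (q ^ 6) ^ 3 / qpoch (q ^ 2) (q ^ 2))"
    using cubic_theta_c_qpoch[of "2 * \<tau>"] assms unfolding n2 by (simp flip: power_mult)
  also have "3 * qpoch (q ^ 6) (q ^ 6) ^ 3 / qpoch (q ^ 2) (q ^ 2) = weight_one_prod q"
    unfolding eta_products[OF q] weight_one_prod_def using nz
    by (simp add: power2_eq_square power3_eq_cube)
  finally show ?thesis unfolding q_def .
qed

lemma DERIV_weight_one_prod:
  fixes q :: complex
  assumes q: "norm q < 1" "q \<noteq> 0"
  defines "y1 \<equiv> theta_logderiv q zeta6" and "y2 \<equiv> theta_logderiv q omega" and "k \<equiv> eis_const q"
  shows "(weight_one_prod has_field_derivative
    weight_one_prod q * (- (y1 ^ 2) + y1 * y2 - y2 ^ 2 + k / 3 - 2 / 3) / q) (at q)"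
proof -
  define N A B C where "N = qpoch q q" and "A = theta_prod zeta6 q" and "B = theta_prod omega q" and "C = qpoch (- q) q"
  define l0 l1 l2 l3 where "l0 = - lambert_sum 1 rho0 q 1" and "l1 = theta_qderiv q zeta6"
    and "l2 = theta_qderiv q omega" and "l3 = - lambert_sum 1 rho0 q (- 1)"
  have d0: "((\<lambda>q. qpoch q q) has_field_derivative N * l0 / q) (at q)"
    using DERIV_qpoch_q[OF q, of 1] by (simp add: N_def l0_def)
  have d3: "((\<lambda>q. qpoch (- q) q) has_field_derivative C * l3 / q) (at q)"
    using DERIV_qpoch_q[OF q, of "- 1"] by (simp add: C_def l3_def)
  have d1: "(theta_prod zeta6 has_field_derivative A * l1 / q) (at q)"
    and d2: "(theta_prod omega has_field_derivative B * l2 / q) (at q)"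
    using DERIV_theta_prod[OF q] by (simp_all add: A_def B_def l1_def l2_def)
  have pw: "((\<lambda>x. f x ^ n) has_field_derivative f q ^ n * (of_nat n * l) / q) (at q)"
    if "(f has_field_derivative f q * l / q) (at q)" for f l n
  proof (cases n)
    case (Suc m)
    show ?thesis using DERIV_power[OF that, of n] by (rule DERIV_cong) (simp add: Suc mult_ac)
  qed simp
  have ml: "((\<lambda>x. f x * g x) has_field_derivative (f q * g q) * (l + l') / q) (at q)"
    if "(f has_field_derivative f q * l / q) (at q)" "(g has_field_derivative g q * l' / q) (at q)" for f g l l'
    by (rule DERIV_cong[OF DERIV_mult[OF that]]) (simp add: add_divide_distrib algebra_simps)
  have c: "((\<lambda>x. 3) has_field_derivative 3 * 0 / q) (at q)" by simp
  have "(weight_one_prod has_field_derivative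
     (3 * qpoch q q ^ 2 * theta_prod zeta6 q ^ 3 * theta_prod omega q ^ 3 * qpoch (- q) q ^ 2) *
     (0 + of_nat 2 * l0 + of_nat 3 * l1 + of_nat 3 * l2 + of_nat 2 * l3) / q) (at q)"
    unfolding weight_one_prod_def[abs_def]
    by (intro ml pw c) (use d0 d1 d2 d3 in \<open>simp_all add: N_def A_def B_def C_def\<close>)
  also have "0 + of_nat 2 * l0 + of_nat 3 * l1 + of_nat 3 * l2 + of_nat 2 * l3 = - (y1 ^ 2) + y1 * y2 - y2 ^ 2 + k / 3 - 2 / 3"
  proof -
    \<comment> \<open>-1 is its own inverse, so both factors of \<open>theta_prod\<close> agree
      there and the square of \<open>qpoch (- q) q\<close> accounts for one
      \<open>theta_qderiv\<close>.\<close>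
    have "2 * l3 = theta_qderiv q (- 1)" unfolding l3_def theta_qderiv_def by simp
    then have "0 + of_nat 2 * l0 + of_nat 3 * l1 + of_nat 3 * l2 + of_nat 2 * l3 =
      (3 * theta_qderiv q zeta6 + 3 * theta_qderiv q omega + theta_qderiv q (- 1)
      - 2 * lambert_sum 1 rho0 q 1 + 2 / 3) - 2 / 3"
      unfolding l0_def l1_def l2_def by simp
    then show ?thesis unfolding qderiv_values(2)[OF q] y1_def y2_def k_def .
  qed
  finally show ?thesis unfolding weight_one_prod_def .
qed

section \<open>The differential equation\<close>

text \<open>
  Here \<open>a\<close>, \<open>b\<close>, \<open>k\<close> are the values of \<open>theta_logderiv\<close> at the primitive sixth and cube roots of
  unity and of \<open>eis_const\<close>, \<open>Da\<close>, \<open>Db\<close>, \<open>Dk\<close> their images under \<open>q d/dq\<close>, \<open>M\<close> is the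
  \<open>q d/dq\<close>-logarithmic derivative of \<open>m\<close>, and \<open>1 / c\<close> is \<open>q df/dq\<close>. Since \<open>c \<noteq> 0\<close>, none of
  \<open>f\<close>, \<open>f - 1\<close>, \<open>f - 1/9\<close> vanishes.
\<close>

lemma second_order_algebra:
  fixes f a b k c m M :: complex
  assumes rel: "3 * f * (a - 2 * b) = a" and c: "f * (2 * (a - 3 * b) * (a + b)) * c = 1"
    and M: "M = - (a ^ 2) + a * b - b ^ 2 + k / 3"
    and Da: "Da = a * (a ^ 2 - a * b - 5 * b ^ 2 + k / 3)"
    and Db: "Db = k * b / 3 + a ^ 3 - 3 * a ^ 2 * b + b ^ 3"
    and Dk: "Dk = k ^ 2 / 3 + 6 * a ^ 3 * b - 18 * a ^ 2 * b ^ 2 - 3 * b ^ 4"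
  shows "m * c ^ 2 * (M ^ 2 + (- 2 * a * Da + Da * b + a * Db - 2 * b * Db + Dk / 3)
      - M * (2 * (a - 3 * b) * (a + b)) - M * (- 4 * a * b + 2 * b ^ 2 + 2 * k / 3))
    + ((1/3) / f - (1/3) / (f - 1) + 1 / (f - 1/9)) * (m * (M * c))
    + (f + 1/3) / (3 * f\<^sup>2 * (f - 1)\<^sup>2) * m = 0"
proof -
  define X where "X = 2 * (a - 3 * b) * (a + b)"
  \<comment> \<open>If a = 2 b, then \<open>rel\<close> gives a = 0, hence b = 0, and the left side
    of \<open>c\<close> would be 0.\<close>
  have s: "a - 2 * b \<noteq> 0"
  proof
    assume "a - 2 * b = 0"
    then have "a = 0" "b = 0" using rel by auto
    then show False using c by simp
  qed
  have f: "f = a / (3 * (a - 2 * b))" using rel s by (simp add: field_simps)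
  have f0: "f \<noteq> 0" using c by auto
  have a0: "a \<noteq> 0" using f f0 by auto
  have i1: "1 / f = c * X" using c f0 unfolding X_def by (simp add: field_simps)
  \<comment> \<open>The numerators of f - 1 and f - 1/9 are, up to constants, the two factors of X,
    so their reciprocals become c times a polynomial.\<close>
  have e2: "f - 1 = - 2 * (a - 3 * b) / (3 * (a - 2 * b))" unfolding f using s by (simp add: divide_simps)
  have e3: "f - 1 / 9 = 2 * (a + b) / (9 * (a - 2 * b))"
    unfolding f using s by (simp add: divide_simps) (simp add: algebra_simps)
  have e4: "f + 1 / 3 = 2 * (a - b) / (3 * (a - 2 * b))"
    unfolding f using s by (simp add: divide_simps) (simp add: algebra_simps)
  have cc: "a * (2 * (a - 3 * b) * (a + b)) * c = 3 * (a - 2 * b)"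
    using c s unfolding f by (simp add: divide_simps)
  have "(f - 1) * (- c * a * (a + b)) = 1"
  proof -
    have "(- 2 * d / (3 * s)) * (- c * a * e) = (a * (2 * d * e) * c) / (3 * s)" for d e s
      by (simp add: mult_ac)
    then have "(f - 1) * (- c * a * (a + b)) = (a * (2 * (a - 3 * b) * (a + b)) * c) / (3 * (a - 2 * b))"
      unfolding e2 .
    then show ?thesis unfolding cc using s by simp
  qed
  then have i2: "1 / (f - 1) = - c * a * (a + b)"
    by (metis inverse_eq_divide inverse_unique)
  have "(f - 1 / 9) * (c * (3 * a * (a - 3 * b))) = 1"
  proof -
    have "(2 * d / (9 * s)) * (c * (3 * a * e)) = (3 * (a * (2 * e * d) * c)) / (9 * s)" for d e s
      by (simp add: mult_ac)
    then have "(f - 1 / 9) * (c * (3 * a * (a - 3 * b))) = (3 * (a * (2 * (a - 3 * b) * (a + b)) * c)) / (9 * (a - 2 * b))"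
      unfolding e3 .
    then show ?thesis unfolding cc using s by simp
  qed
  then have i3: "1 / (f - 1 / 9) = c * (3 * a * (a - 3 * b))"
    by (metis inverse_eq_divide inverse_unique)
  have p: "(1/3) / f - (1/3) / (f - 1) + 1 / (f - 1/9) = c * (X / 3 + a * (a + b) / 3 + 3 * a * (a - 3 * b))"
  proof -
    have "(1/3) / f - (1/3) / (f - 1) + 1 / (f - 1/9) = (1 / f) / 3 - (1 / (f - 1)) / 3 + 1 / (f - 1/9)"
      by (simp only: divide_divide_eq_left mult.commute)
    also have "\<dots> = c * (X / 3 + a * (a + b) / 3 + 3 * a * (a - 3 * b))"
      unfolding i1 i2 i3 by (simp add: algebra_simps add_divide_distrib diff_divide_distrib)
    finally show ?thesis .
  qed
  have r: "(f + 1/3) / (3 * f\<^sup>2 * (f - 1)\<^sup>2) = c ^ 2 * (2 * (a - b) * (a - 2 * b) * (a + b) ^ 2)"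
  proof -
    have "1 / f = 3 * (a - 2 * b) / a" unfolding f using s a0 by simp
    moreover have "(f + 1/3) / (3 * f\<^sup>2 * (f - 1)\<^sup>2) = (f + 1/3) / 3 * (1 / f) ^ 2 * (1 / (f - 1)) ^ 2"
      by (simp add: power_divide)
    ultimately have "(f + 1/3) / (3 * f\<^sup>2 * (f - 1)\<^sup>2) =
       2 * (a - b) / (3 * (a - 2 * b)) / 3 * (3 * (a - 2 * b) / a) ^ 2 * (- c * a * (a + b)) ^ 2"
      unfolding i2 e4 by simp
    also have "\<dots> = c ^ 2 * (2 * (a - b) * (a - 2 * b) * (a + b) ^ 2)"
    proof -
      have "2 * d / (3 * s) / 3 * (3 * s / a) ^ 2 * (- c * a * e) ^ 2 = c ^ 2 * (2 * d * s * e ^ 2)"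
        if "s \<noteq> 0" for d s e :: complex
        using that a0 by (simp add: field_simps power2_eq_square)
      from this[OF s] show ?thesis .
    qed
    finally show ?thesis .
  qed
  define k3 where "k3 = k / 3"
  have k: "k = 3 * k3" by (simp add: k3_def)
  \<comment> \<open>The differential equation stripped of the factor m c^2 / 3: an identity
    homogeneous of weight 4, with a, b of weight 1 and k3 of weight 2.\<close>
  have poly: "3 * (M ^ 2 + (- 2 * a * Da + Da * b + a * Db - 2 * b * Db + Dk / 3)
      - M * X - M * (- 4 * a * b + 2 * b ^ 2 + 2 * k / 3))
     + M * (X + a * (a + b) + 9 * a * (a - 3 * b)) + 6 * (a - b) * (a - 2 * b) * (a + b) ^ 2 = 0"
  proof -
    have e: "Dk / 3 = k3 ^ 2 + 2 * a ^ 3 * b - 6 * a ^ 2 * b ^ 2 - b ^ 4" "2 * k / 3 = 2 * k3"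
      "Db = k3 * b + a ^ 3 - 3 * a ^ 2 * b + b ^ 3"
      unfolding Dk Db k by (simp_all add: field_simps power2_eq_square)
    show ?thesis unfolding M Da k3_def[symmetric] X_def e by algebra
  qed
  let ?T = "M ^ 2 + (- 2 * a * Da + Da * b + a * Db - 2 * b * Db + Dk / 3)
      - M * X - M * (- 4 * a * b + 2 * b ^ 2 + 2 * k / 3)"
  have "m * c ^ 2 * ?T + c * (X / 3 + a * (a + b) / 3 + 3 * a * (a - 3 * b)) * (m * (M * c))
    + c ^ 2 * (2 * (a - b) * (a - 2 * b) * (a + b) ^ 2) * m =
    m * c ^ 2 / 3 * (3 * ?T + M * (X + a * (a + b) + 9 * a * (a - 3 * b)) + 6 * (a - b) * (a - 2 * b) * (a + b) ^ 2)"
  proof -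
    have "m * c ^ 2 * T + c * (x / 3 + y / 3 + 3 * a * z) * (m * (M * c)) + c ^ 2 * (2 * u * v * w) * m =
      m * c ^ 2 / 3 * (3 * T + M * (x + y + 9 * a * z) + 6 * u * v * w)" for T x y z u v w :: complex
      by (simp add: field_simps power2_eq_square)
    then show ?thesis .
  qed
  then show ?thesis unfolding poly p r X_def[symmetric] by simp
qed

theorem theorem8p12:
  fixes U :: "complex set" and \<tau> m :: "complex \<Rightarrow> complex"
  assumes "local_holomorphic_inverse eta_quotient_f upper_half_plane U \<tau>"
    and "\<And>f. f \<in> U \<Longrightarrow> m f = cubic_theta_c (2 * \<tau> f)"
  shows "m holomorphic_on U \<and>
    (\<forall>f\<in>U.
       deriv (deriv m) f
       + ((1/3) / f - (1/3) / (f - 1) + 1 / (f - 1/9)) * deriv m f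
       + (f + 1/3) / (3 * f\<^sup>2 * (f - 1)\<^sup>2) * m f = 0)"
proof -
  have U: "open U" and hol: "\<tau> holomorphic_on U" and im: "\<And>f. f \<in> U \<Longrightarrow> Im (\<tau> f) > 0"
    and inv: "\<And>f. f \<in> U \<Longrightarrow> eta_quotient_f (\<tau> f) = f"
    using assms(1) by (auto simp: local_holomorphic_inverse_def upper_half_plane_def)
  define q where "q f = nome (\<tau> f)" for f
  \<comment> \<open>This is d log q / df, so d/df is c times q d/dq.\<close>
  define c where "c f = 2 * of_real pi * \<i> * deriv \<tau> f" for f
  have q: "norm (q f) < 1" "q f \<noteq> 0" if "f \<in> U" for f
    using norm_nome[OF im[OF that]] by (simp_all add: q_def)
  have dtau: "(\<tau> has_field_derivative deriv \<tau> f) (at f)" if "f \<in> U" for f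
    using holomorphic_derivI[OF hol U that] .
  have dq: "((\<lambda>f. F (q f)) has_field_derivative D * c f) (at f)"
    if "f \<in> U" "(F has_field_derivative D / q f) (at (q f))" for F D f
  proof -
    have "(q has_field_derivative q f * c f) (at f)"
      unfolding q_def nome_def c_def by (auto intro!: derivative_eq_intros dtau[OF that(1)])
    from DERIV_chain2[OF that(2) this] show ?thesis using q[OF that(1)] by simp
  qed
  define a b k where "a f = theta_logderiv (q f) zeta6" and "b f = theta_logderiv (q f) omega"
    and "k f = eis_const (q f)" for f
  define X where "X f = 2 * (a f - 3 * b f) * (a f + b f)" for f
  define M where "M f = - (a f ^ 2) + a f * b f - b f ^ 2 + k f / 3" for f
  define Da where "Da f = a f * (a f ^ 2 - a f * b f - 5 * b f ^ 2 + k f / 3)" for f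
  define Db where "Db f = k f * b f / 3 + a f ^ 3 - 3 * a f ^ 2 * b f + b f ^ 3" for f
  define Dk where "Dk f = k f ^ 2 / 3 + 6 * a f ^ 3 * b f - 18 * a f ^ 2 * b f ^ 2 - 3 * b f ^ 4" for f
  have da: "(a has_field_derivative Da f * c f) (at f)"
    and db: "(b has_field_derivative Db f * c f) (at f)"
    and dk: "(k has_field_derivative Dk f * c f) (at f)" if "f \<in> U" for f
    unfolding a_def[abs_def] b_def[abs_def] k_def[abs_def] Da_def Db_def Dk_def
    using torsion_system[OF q[OF that]] by (auto intro!: dq[OF that] simp: a_def b_def k_def)
  have haupt: "hauptmodul (q f) = f" if "f \<in> U" for f
    using eta_quotient_f_hauptmodul[OF im[OF that]] inv[OF that] by (simp add: q_def)
  have rel: "3 * f * (a f - 2 * b f) = a f" if "f \<in> U" for f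
    using hauptmodul_eq[OF q(1)[OF that]] haupt[OF that] by (simp add: a_def b_def)
  \<comment> \<open>f composed with its local inverse has derivative 1. This is where f, X and c are
    seen not to vanish on U.\<close>
  have fXc: "f * X f * c f = 1" if "f \<in> U" for f
  proof -
    have "((\<lambda>f. hauptmodul (q f)) has_field_derivative hauptmodul (q f) * X f * c f) (at f)"
      using DERIV_hauptmodul[OF q[OF that]] unfolding X_def a_def b_def by (intro dq[OF that])
    moreover have "((\<lambda>f. hauptmodul (q f)) has_field_derivative 1) (at f)"
      by (rule has_field_derivative_transform_within_open[OF DERIV_ident U that]) (simp add: haupt)
    ultimately show ?thesis using DERIV_unique haupt[OF that] by metis
  qed
  have meq: "m f = exp (2 * of_real pi * \<i> * (2 * \<tau> f) / 3) * weight_one_prod (q f)" if "f \<in> U" for f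
    using assms(2)[OF that] cubic_theta_c_double[OF im[OF that]] by (simp add: q_def)
  have dm: "(m has_field_derivative m f * (M f * c f)) (at f)" if "f \<in> U" for f
  proof -
    have 1: "((\<lambda>f. exp (2 * of_real pi * \<i> * (2 * \<tau> f) / 3)) has_field_derivative
       exp (2 * of_real pi * \<i> * (2 * \<tau> f) / 3) * (2 / 3 * c f)) (at f)"
      unfolding c_def by (auto intro!: derivative_eq_intros dtau[OF that])
    \<comment> \<open>The term - 2/3 here cancels the 2/3 from the exponential prefactor.\<close>
    have 2: "((\<lambda>f. weight_one_prod (q f)) has_field_derivative
       weight_one_prod (q f) * (M f - 2 / 3) * c f) (at f)"
      using DERIV_weight_one_prod[OF q[OF that]] unfolding M_def a_def b_def k_def by (intro dq[OF that])
    have "((\<lambda>f. exp (2 * of_real pi * \<i> * (2 * \<tau> f) / 3) * weight_one_prod (q f)) has_field_derivative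
       m f * (M f * c f)) (at f)"
      by (rule DERIV_cong[OF DERIV_mult[OF 1 2]]) (simp add: meq[OF that] algebra_simps)
    then show ?thesis
      by (rule has_field_derivative_transform_within_open[OF _ U that]) (simp add: meq)
  qed
  \<comment> \<open>c is differentiated as 1 / (f X), so the second derivative of tau is obtained
    from the system for a, b, k.\<close>
  have dc: "(c has_field_derivative - (c f ^ 2) * (X f + (- 4 * a f * b f + 2 * b f ^ 2 + 2 * k f / 3))) (at f)"
    if f: "f \<in> U" for f
  proof -
    define G where "G = - 4 * a f * b f + 2 * b f ^ 2 + 2 * k f / 3"
    have nz: "f * X f \<noteq> 0" using fXc[OF f] by auto
    have cf: "c f = 1 / (f * X f)" using fXc[OF f] nz by (simp add: field_simps)
    have "(X has_field_derivative 2 * (Da f * c f - 3 * (Db f * c f)) * (a f + b f)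
        + 2 * (a f - 3 * b f) * (Da f * c f + Db f * c f)) (at f)"
      unfolding X_def[abs_def] by (auto intro!: derivative_eq_intros da[OF f] db[OF f])
    \<comment> \<open>G is the q d/dq-logarithmic derivative of X.\<close>
    also have "2 * (Da f * c f - 3 * (Db f * c f)) * (a f + b f)
        + 2 * (a f - 3 * b f) * (Da f * c f + Db f * c f) = X f * G * c f"
      unfolding X_def G_def Da_def Db_def by (simp add: field_simps power2_eq_square power3_eq_cube)
    finally have dX: "(X has_field_derivative X f * G * c f) (at f)" .
    have "((\<lambda>f. f * X f) has_field_derivative 1 * X f + X f * G * c f * f) (at f)"
      by (rule DERIV_mult[OF DERIV_ident dX])
    also have "1 * X f + X f * G * c f * f = X f + (f * X f * c f) * G" by (simp add: algebra_simps)
    also have "\<dots> = X f + G" unfolding fXc[OF f] by simp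
    finally have d: "((\<lambda>f. f * X f) has_field_derivative X f + G) (at f)" .
    have "((\<lambda>f. 1 / (f * X f)) has_field_derivative - (c f ^ 2) * (X f + G)) (at f)"
      by (rule DERIV_cong[OF DERIV_divide[OF DERIV_const d nz]])
        (simp add: cf power2_eq_square diff_divide_distrib add_divide_distrib)
    then show ?thesis unfolding G_def[symmetric]
    proof (rule has_field_derivative_transform_within_open[OF _ U f])
      fix x assume x: "x \<in> U"
      then have "x * X x \<noteq> 0" using fXc[OF x] by auto
      then show "1 / (x * X x) = c x" using fXc[OF x] by (simp add: field_simps)
    qed
  qed
  have ode: "deriv (deriv m) f
       + ((1/3) / f - (1/3) / (f - 1) + 1 / (f - 1/9)) * deriv m f
       + (f + 1/3) / (3 * f\<^sup>2 * (f - 1)\<^sup>2) * m f = 0" if f: "f \<in> U" for f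
  proof -
    define DM where "DM = - 2 * a f * Da f + Da f * b f + a f * Db f - 2 * b f * Db f + Dk f / 3"
    define G where "G = - 4 * a f * b f + 2 * b f ^ 2 + 2 * k f / 3"
    have dM: "(M has_field_derivative DM * c f) (at f)"
      unfolding M_def[abs_def] DM_def
      by (auto intro!: derivative_eq_intros da[OF f] db[OF f] dk[OF f] simp: algebra_simps)
    have "((\<lambda>f. m f * (M f * c f)) has_field_derivative
        m f * (M f * c f) * (M f * c f) + (DM * c f * c f + - (c f ^ 2) * (X f + G) * M f) * m f) (at f)"
      using DERIV_mult[OF dm[OF f] DERIV_mult[OF dM dc[OF f]]] unfolding G_def[symmetric] by simp
    \<comment> \<open>\<open>dm\<close> holds on all of the open set U, so \<open>deriv m\<close>
      may be replaced by its formula before the second differentiation.\<close>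
    then have "(deriv m has_field_derivative
        m f * (M f * c f) * (M f * c f) + (DM * c f * c f + - (c f ^ 2) * (X f + G) * M f) * m f) (at f)"
      by (rule has_field_derivative_transform_within_open[OF _ U f]) (use dm DERIV_imp_deriv in metis)
    then have "deriv (deriv m) f = m f * c f ^ 2 * (M f ^ 2 + DM - M f * X f - M f * G)"
      by (rule DERIV_imp_deriv[THEN trans]) (simp add: power2_eq_square algebra_simps)
    moreover have "deriv m f = m f * (M f * c f)" using dm[OF f] by (rule DERIV_imp_deriv)
    ultimately show ?thesis
      using second_order_algebra[OF rel[OF f] _ M_def Da_def Db_def Dk_def, of "c f" "m f"] fXc[OF f]
      unfolding DM_def G_def X_def by simp
  qed
  have "m holomorphic_on U"
    using dm unfolding holomorphic_on_open[OF U] by blast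
  then show ?thesis using ode by blast
qed

end
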